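(* Let $k$ be a field of characteristic zero. (1) If $M$ is a matroid whose lattice of flats $L(M)$ is a modular geometric lattice, then the algebra $A_M=Q/\operatorname{Ann}_Q\Phi_M$ has the strong Lefschetz property. (2) Every (finite) modular geometric lattice has the Sperner property.
   Context: A matroid $M=(E,\mathcal{F})$ is a finite set $E$ with its system $\mathcal{F}\subset 2^E$ of independent sets; $\mathcal{B}$ is the set of bases (maximal independent sets). A flat is a subset $S\subset E$ equal to its matroid closure; $L(M)$ is the lattice of flats ordered by inclusion, graded by the matroid rank. $\Phi_M=\sum_{B\in\mathcal{B}}\prod_{b\in B}x_b\in k[x_e\mid e\in E]$. $Q=k[X_e\mid e\in E]$ acts on $k[x_e\mid e\in E]$ by $X_e=\partial/\partial x_e$, $\operatorname{Ann}_Q\Phi_M=\{\varphi\in Q:\varphi\cdot\Phi_M=0\}$, and $A_M=Q/\operatorname{Ann}_Q\Phi_M$ (a graded algebra). A finite graded lattice $L$ with rank function $r$ is (upper) semimodular if $r(x)+r(y)\ge r(x\wedge y)+r(x\vee y)$ for all $x,y\in L$, and modular if equality holds for all $x,y$. It is atomic if every element is a join of atoms (elements covering the minimum $\hat0$), and geometric if it is atomic and semimodular. A graded Artinian algebra $A=\bigoplus_{d=0}^D A_d$ with $A_D\ne0$ has the strong Lefschetz property (in the narrow sense) if there is $L\in A_1$ such that multiplication by $L^{D-2i}:A_i\to A_{D-i}$ is bijective for $i=0,\ldots,[D/2]$. A finite ranked poset $P=\bigcup_{i\ge0}P_i$ with level sets $P_i$ has the Sperner property if the maximal cardinality of an antichain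 of $P$ equals $\max_i\#P_i$. *)

theory Defs
  imports
    "HOL-Algebra.QuotRing"
    "HOL-Algebra.Lattice"
    "HOL-Library.Poly_Mapping"
    "HOL-Library.FuncSet"
begin

section \<open>Finite graded lattices\<close>

definition covers :: "'a gorder \<Rightarrow> 'a \<Rightarrow> 'a \<Rightarrow> bool" where
  "covers L x y \<longleftrightarrow> x \<in> carrier L \<and> y \<in> carrier L \<and> x \<sqsubset>\<^bsub>L\<^esub> y \<and>
     \<not> (\<exists>z\<in>carrier L. x \<sqsubset>\<^bsub>L\<^esub> z \<and> z \<sqsubset>\<^bsub>L\<^esub> y)"

definition atoms :: "'a gorder \<Rightarrow> 'a set" where
  "atoms L = {a. covers L \<bottom>\<^bsub>L\<^esub> a}"

text \<open>The locale of lattices in \<open>HOL-Algebra\<close> admits the empty carrier, which is excluded here,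
  so that \<open>\<bottom>\<close> exists.  A function \<open>r\<close> as below is unique if it exists.\<close>

definition finite_graded_lattice :: "'a gorder \<Rightarrow> ('a \<Rightarrow> nat) \<Rightarrow> bool" where
  "finite_graded_lattice L r \<longleftrightarrow>
     lattice L \<and> finite (carrier L) \<and> carrier L \<noteq> {} \<and>
     r \<bottom>\<^bsub>L\<^esub> = 0 \<and> (\<forall>x y. covers L x y \<longrightarrow> r y = Suc (r x))"

definition semimodular_lattice :: "'a gorder \<Rightarrow> ('a \<Rightarrow> nat) \<Rightarrow> bool" where
  "semimodular_lattice L r \<longleftrightarrow> finite_graded_lattice L r \<and>
     (\<forall>x\<in>carrier L. \<forall>y\<in>carrier L. r x + r y \<ge> r (x \<sqinter>\<^bsub>L\<^esub> y) + r (x \<squnion>\<^bsub>L\<^esub> y))"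

definition modular_lattice :: "'a gorder \<Rightarrow> ('a \<Rightarrow> nat) \<Rightarrow> bool" where
  "modular_lattice L r \<longleftrightarrow> finite_graded_lattice L r \<and>
     (\<forall>x\<in>carrier L. \<forall>y\<in>carrier L. r x + r y = r (x \<sqinter>\<^bsub>L\<^esub> y) + r (x \<squnion>\<^bsub>L\<^esub> y))"

definition atomic_lattice :: "'a gorder \<Rightarrow> bool" where
  "atomic_lattice L \<longleftrightarrow> (\<forall>x\<in>carrier L. \<exists>S\<subseteq>atoms L. x = \<Squnion>\<^bsub>L\<^esub> S)"

definition geometric_lattice :: "'a gorder \<Rightarrow> ('a \<Rightarrow> nat) \<Rightarrow> bool" where
  "geometric_lattice L r \<longleftrightarrow> atomic_lattice L \<and> semimodular_lattice L r"

definition modular_geometric_lattice :: "'a gorder \<Rightarrow> ('a \<Rightarrow> nat) \<Rightarrow> bool" where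
  "modular_geometric_lattice L r \<longleftrightarrow> geometric_lattice L r \<and> modular_lattice L r"

definition antichain :: "'a gorder \<Rightarrow> 'a set \<Rightarrow> bool" where
  "antichain P A \<longleftrightarrow> A \<subseteq> carrier P \<and> (\<forall>x\<in>A. \<forall>y\<in>A. x \<sqsubseteq>\<^bsub>P\<^esub> y \<longrightarrow> x = y)"

definition level_set :: "'a gorder \<Rightarrow> ('a \<Rightarrow> nat) \<Rightarrow> nat \<Rightarrow> 'a set" where
  "level_set P r i = {x \<in> carrier P. r x = i}"

text \<open>For posets with finite carrier; then both sets under \<open>Max\<close> are finite and nonempty.\<close>

definition sperner_property :: "'a gorder \<Rightarrow> ('a \<Rightarrow> nat) \<Rightarrow> bool" where
  "sperner_property P r \<longleftrightarrow>
     Max {card A | A. antichain P A} = Max {card (level_set P r i) | i. True}"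


section \<open>Matroids\<close>

locale matroid =
  fixes E :: "'e set" and F :: "'e set set"
  assumes finite_ground: "finite E"
    and indep_subset_ground: "I \<in> F \<Longrightarrow> I \<subseteq> E"
    and empty_indep: "{} \<in> F"
    and hereditary: "I \<in> F \<Longrightarrow> J \<subseteq> I \<Longrightarrow> J \<in> F"
    and augmentation:
      "I \<in> F \<Longrightarrow> J \<in> F \<Longrightarrow> card I < card J \<Longrightarrow> \<exists>e\<in>J - I. insert e I \<in> F"

definition bases :: "'e set set \<Rightarrow> 'e set set" where
  "bases F = {B \<in> F. \<forall>I\<in>F. B \<subseteq> I \<longrightarrow> I = B}"

definition matroid_rank :: "'e set set \<Rightarrow> 'e set \<Rightarrow> nat" where
  "matroid_rank F S = Max {card I | I. I \<in> F \<and> I \<subseteq> S}"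

definition matroid_closure :: "'e set \<Rightarrow> 'e set set \<Rightarrow> 'e set \<Rightarrow> 'e set" where
  "matroid_closure E F S = {e \<in> E. matroid_rank F (insert e S) = matroid_rank F S}"

definition flats :: "'e set \<Rightarrow> 'e set set \<Rightarrow> 'e set set" where
  "flats E F = {S. S \<subseteq> E \<and> matroid_closure E F S = S}"

definition lattice_of_flats :: "'e set \<Rightarrow> 'e set set \<Rightarrow> 'e set gorder" where
  "lattice_of_flats E F = \<lparr>carrier = flats E F, eq = (=), le = (\<subseteq>)\<rparr>"


section \<open>Polynomials as differential operators\<close>

text \<open>A monomial is its exponent vector, a polynomial the vector of its coefficients;
  multiplication in this type is the convolution product.\<close>

type_synonym ('e, 'k) mpoly = "('e \<Rightarrow>\<^sub>0 nat) \<Rightarrow>\<^sub>0 'k"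

definition mvar :: "'e \<Rightarrow> ('e, 'k::comm_ring_1) mpoly" where
  "mvar e = Poly_Mapping.single (Poly_Mapping.single e 1) 1"

definition mconst :: "'k::comm_ring_1 \<Rightarrow> ('e, 'k) mpoly" where
  "mconst c = Poly_Mapping.single 0 c"

text \<open>The truncated subtraction of exponents is harmless: where it truncates, the coefficient is 0.\<close>

definition partial_deriv :: "'e \<Rightarrow> ('e, 'k::comm_ring_1) mpoly \<Rightarrow> ('e, 'k) mpoly" where
  "partial_deriv e f = (\<Sum>m\<in>Poly_Mapping.keys f.
     Poly_Mapping.single (m - Poly_Mapping.single e 1)
       (of_nat (Poly_Mapping.lookup m e) * Poly_Mapping.lookup f m))"

text \<open>The monomial \<open>\<Prod>e. X\<^sub>e ^ m e\<close> as an operator.  The fold is independent of the order since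
  partial derivatives commute; see \<open>comp_fun_commute_partial_deriv\<close> below.\<close>

definition monomial_deriv ::
    "('e \<Rightarrow>\<^sub>0 nat) \<Rightarrow> ('e, 'k::comm_ring_1) mpoly \<Rightarrow> ('e, 'k) mpoly" where
  "monomial_deriv m f =
     Finite_Set.fold (\<lambda>e. partial_deriv e ^^ Poly_Mapping.lookup m e) f (Poly_Mapping.keys m)"

definition diff_action ::
    "('e, 'k::comm_ring_1) mpoly \<Rightarrow> ('e, 'k) mpoly \<Rightarrow> ('e, 'k) mpoly" where
  "diff_action \<phi> f = (\<Sum>m\<in>Poly_Mapping.keys \<phi>.
     mconst (Poly_Mapping.lookup \<phi> m) * monomial_deriv m f)"

lemma lookup_partial_deriv:
  "Poly_Mapping.lookup (partial_deriv e f) n =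
     of_nat (Suc (Poly_Mapping.lookup n e)) *
     Poly_Mapping.lookup f (n + Poly_Mapping.single e 1)"
proof -
  let ?s = "Poly_Mapping.single e (1::nat)" and ?N = "n + Poly_Mapping.single e (1::nat)"
  have shift: "m = ?N" if "m - ?s = n" "Poly_Mapping.lookup m e \<noteq> 0" for m
  proof (rule poly_mapping_eqI)
    fix x
    have "Poly_Mapping.lookup (m - ?s) x = Poly_Mapping.lookup n x" using that(1) by simp
    then show "Poly_Mapping.lookup m x = Poly_Mapping.lookup ?N x"
      using that(2) by (cases "x = e") (auto simp: lookup_minus lookup_add lookup_single)
  qed
  have unshift: "?N - ?s = n"
    by (rule poly_mapping_eqI) (simp add: lookup_minus lookup_add)
  have "Poly_Mapping.lookup (partial_deriv e f) n = (\<Sum>m\<in>Poly_Mapping.keys f.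
      if m = ?N then of_nat (Poly_Mapping.lookup m e) * Poly_Mapping.lookup f m else 0)"
    unfolding partial_deriv_def lookup_sum
  proof (rule sum.cong[OF refl])
    fix m
    show "Poly_Mapping.lookup (Poly_Mapping.single (m - ?s)
        (of_nat (Poly_Mapping.lookup m e) * Poly_Mapping.lookup f m)) n =
      (if m = ?N then of_nat (Poly_Mapping.lookup m e) * Poly_Mapping.lookup f m else 0)"
    proof (cases "m = ?N")
      case True
      then show ?thesis using unshift by simp
    next
      case False
      then have "m - ?s \<noteq> n \<or> Poly_Mapping.lookup m e = 0" using shift by blast
      then show ?thesis using False by (auto simp: lookup_single)
    qed
  qed
  also have "\<dots> = of_nat (Poly_Mapping.lookup ?N e) * Poly_Mapping.lookup f ?N"
    by (simp add: in_keys_iff)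
  finally show ?thesis by (simp add: lookup_add)
qed

lemma partial_deriv_commute:
  "partial_deriv e (partial_deriv e' f) = partial_deriv e' (partial_deriv e f)"
proof (cases "e = e'")
  case False
  then show ?thesis
    by (intro poly_mapping_eqI)
      (simp add: lookup_partial_deriv lookup_add lookup_single_not_eq algebra_simps)
qed simp

lemma comp_fun_commute_partial_deriv:
  "comp_fun_commute (\<lambda>e. (partial_deriv e :: ('e, 'k::comm_ring_1) mpoly \<Rightarrow> _) ^^ n e)"
proof
  fix x y :: 'e
  let ?d = "partial_deriv :: 'e \<Rightarrow> ('e, 'k) mpoly \<Rightarrow> ('e, 'k) mpoly"
  have one: "?d a ((?d b ^^ k) f) = (?d b ^^ k) (?d a f)" for a b k f
    by (induction k) (simp_all add: partial_deriv_commute[of a b])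
  have "(?d y ^^ j) ((?d x ^^ k) f) = (?d x ^^ k) ((?d y ^^ j) f)" for j k f
    by (induction j) (simp_all add: one)
  then show "?d y ^^ n y \<circ> ?d x ^^ n x = ?d x ^^ n x \<circ> ?d y ^^ n y"
    by (simp add: fun_eq_iff)
qed

definition poly_ring :: "'e set \<Rightarrow> ('e, 'k::comm_ring_1) mpoly ring" where
  "poly_ring E = \<lparr>carrier = {p. \<forall>m\<in>Poly_Mapping.keys p. Poly_Mapping.keys m \<subseteq> E},
     mult = (*), one = 1, zero = 0, add = (+)\<rparr>"

definition homogeneous_polys :: "'e set \<Rightarrow> nat \<Rightarrow> ('e, 'k::comm_ring_1) mpoly set" where
  "homogeneous_polys E d = {p \<in> carrier (poly_ring E). \<forall>m\<in>Poly_Mapping.keys p.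
     (\<Sum>e\<in>Poly_Mapping.keys m. Poly_Mapping.lookup m e) = d}"

definition annihilator :: "'e set \<Rightarrow> ('e, 'k::comm_ring_1) mpoly \<Rightarrow> ('e, 'k) mpoly set" where
  "annihilator E f = {\<phi> \<in> carrier (poly_ring E). diff_action \<phi> f = 0}"


section \<open>The algebra of a matroid\<close>

definition basis_polynomial :: "'e set set \<Rightarrow> ('e, 'k::comm_ring_1) mpoly" where
  "basis_polynomial F = (\<Sum>B\<in>bases F. \<Prod>b\<in>B. mvar b)"

definition matroid_algebra ::
    "'e set \<Rightarrow> 'e set set \<Rightarrow> ('e, 'k::comm_ring_1) mpoly set ring" where
  "matroid_algebra E F = poly_ring E Quot annihilator E (basis_polynomial F)"

definition matroid_algebra_component ::
    "'e set \<Rightarrow> 'e set set \<Rightarrow> nat \<Rightarrow> ('e, 'k::comm_ring_1) mpoly set set" where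
  "matroid_algebra_component E F d =
     (\<lambda>p. annihilator E (basis_polynomial F) +>\<^bsub>poly_ring E\<^esub> p) ` homogeneous_polys E d"


section \<open>The strong Lefschetz property\<close>

definition artinian_ring :: "('a, 'b) ring_scheme \<Rightarrow> bool" where
  "artinian_ring A \<longleftrightarrow> cring A \<and>
     (\<forall>I :: nat \<Rightarrow> 'a set. (\<forall>n. ideal (I n) A \<and> I (Suc n) \<subseteq> I n) \<longrightarrow> (\<exists>n. \<forall>m\<ge>n. I m = I n))"

text \<open>\<open>A\<close> is the internal direct sum of \<open>G 0, \<dots>, G D\<close>, and \<open>D\<close> is the top nonzero degree.
  For an algebra over a field whose scalars lie in \<open>G 0\<close>, such as \<open>matroid_algebra\<close>,
  the components are automatically subspaces.\<close>

definition graded_artinian_algebra ::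
    "('a, 'b) ring_scheme \<Rightarrow> (nat \<Rightarrow> 'a set) \<Rightarrow> nat \<Rightarrow> bool" where
  "graded_artinian_algebra A G D \<longleftrightarrow> artinian_ring A \<and>
     (\<forall>d. additive_subgroup (G d) A) \<and>
     bij_betw (\<lambda>a. finsum A a {..D}) (\<Pi>\<^sub>E d\<in>{..D}. G d) (carrier A) \<and>
     \<one>\<^bsub>A\<^esub> \<in> G 0 \<and>
     (\<forall>i j. \<forall>x\<in>G i. \<forall>y\<in>G j. x \<otimes>\<^bsub>A\<^esub> y \<in> G (i + j)) \<and>
     G D \<noteq> {\<zero>\<^bsub>A\<^esub>} \<and> (\<forall>d>D. G d = {\<zero>\<^bsub>A\<^esub>})"

definition strong_lefschetz_property ::
    "('a, 'b) ring_scheme \<Rightarrow> (nat \<Rightarrow> 'a set) \<Rightarrow> bool" where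
  "strong_lefschetz_property A G \<longleftrightarrow>
     (\<exists>D. graded_artinian_algebra A G D \<and>
       (\<exists>l\<in>G 1. \<forall>i\<le>D div 2.
         bij_betw (\<lambda>x. l [^]\<^bsub>A\<^esub> (D - 2 * i) \<otimes>\<^bsub>A\<^esub> x) (G i) (G (D - i))))"

end

theory Submission
  imports Defs Complex_Main "HOL-Library.Function_Algebras"
begin

text \<open>
  Replace each element of a modular geometric lattice by the set of atoms below it.  Perspectivity
  splits the atoms into classes, and every covering pair of flats belongs to one class \<open>c\<close>.  On the
  space of functions on the lattice, let \<open>U\<^sub>c\<close> and \<open>D\<^sub>c\<close> raise and lower along coverings of class \<open>c\<close>,
  weighted by the number of atoms gained and by its inverse.  Counting shows that operators of
  different classes commute and that \<open>D\<^sub>c U\<^sub>c - U\<^sub>c D\<^sub>c\<close> multiplies by \<open>[n - i] - [i]\<close> in degree \<open>i\<close>,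
  where \<open>[m] = 1 + q + \<dots> + q^(m-1)\<close>.  The Casimir operators of the classes commute with everything
  and are annihilated by polynomials that split, so the kernel of a power of \<open>U = \<Sum>\<^sub>c U\<^sub>c\<close>, if nonzero,
  contains a joint eigenvector.  On a joint eigenspace the \<open>D\<^sub>c\<close> can be rescaled to satisfy the
  undeformed sl2 relation with \<open>U\<close>, which makes \<open>U\<close> a Lefschetz operator.  Symmetrically, lowering is
  injective in the upper half.  The Sperner property follows by pushing an antichain to the middle
  level.

  For the algebra of a matroid, a monomial whose support is independent is mapped to the flat it
  spans, all other monomials to 0.  The kernel of this map is the annihilator of the basis polynomial,
  because no nonzero function in degree below the top is killed by all points; and a sum of one
  variable for each atom acts as \<open>U\<close>.
\<close>

section \<open>Commuting families of deformed sl2 operators\<close>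

text \<open>The obstacle: for several classes the scalars [n - i] - [i] in general do not add up to
  a function of the total rank, so U belongs to no single sl2, deformed or not. The Casimir
  eigenvalue repairs this. If it is given by j, raising after lowering in one class acts in degree i
  as the scalar [i][n + 1 - i] - [j][n + 1 - j], and multiplying the lowering operator by a function
  of the degree replaces this scalar by its value at q = 1. The new commutators are n - 2i, which do
  add up. The replacement is possible because coincidences among the numbers [i][n + 1 - i] do not
  depend on q. Up to sign these integers are also the roots of the polynomials that annihilate the
  Casimir operators, so eigenvectors exist over every field of characteristic zero.

  The weights come from the algebra: the sum of all points carries F to G once for each point of G -
  F. Inverse weights for lowering make the two routes between distinct flats of equal rank, through
  their join and through their meet, contribute the same amount.\<close>

primrec qint :: "nat \<Rightarrow> nat \<Rightarrow> nat" where
  "qint q 0 = 0"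
| "qint q (Suc m) = 1 + q * qint q m"

lemma qint_less: "q \<ge> 1 \<Longrightarrow> a < b \<Longrightarrow> qint q a < qint q b"
proof (induction b arbitrary: a)
  case (Suc b)
  show ?case
  proof (cases a)
    case (Suc a')
    then have "q * qint q a' < q * qint q b" using Suc.IH[of a'] Suc.prems by simp
    then show ?thesis using Suc by simp
  qed simp
qed simp

text \<open>For i \<le> n + 1 this is the sum of the commutator scalars [n - h] - [h] over all
  degrees h < i; \<open>qcas_Suc\<close> is one step of that sum, free of subtraction between the
  terms.\<close>

definition qcas :: "nat \<Rightarrow> nat \<Rightarrow> nat \<Rightarrow> nat" where
  "qcas q n i = qint q i * qint q (Suc n - i)"

lemma qcas_sym: "i \<le> Suc n \<Longrightarrow> qcas q n (Suc n - i) = qcas q n i"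
  by (simp add: qcas_def)

lemma qcas_Suc: "i \<le> n \<Longrightarrow> qcas q n (Suc i) + qint q i = qcas q n i + qint q (n - i)"
  by (simp add: qcas_def Suc_diff_le algebra_simps)

lemma qcas_less: "q \<ge> 1 \<Longrightarrow> i < j \<Longrightarrow> 2 * j \<le> Suc n \<Longrightarrow> qcas q n i < qcas q n j"
proof (induction j)
  case (Suc j)
  have "qint q j < qint q (n - j)" using Suc.prems by (intro qint_less) auto
  then have "qcas q n j < qcas q n (Suc j)" using qcas_Suc[of j n q] Suc.prems by simp
  then show ?case using Suc by (cases "i = j") auto
qed simp

lemma qcas_eq_low:
  assumes "q \<ge> 1" "2 * i \<le> Suc n" "2 * j \<le> Suc n" "qcas q n i = qcas q n j"
  shows "i = j"
  using qcas_less[OF assms(1), of i j n] qcas_less[OF assms(1), of j i n] assms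
  by (cases i j rule: linorder_cases) auto

text \<open>The numbers increase strictly up to the middle and are mirrored beyond it, so a
  coincidence means r = j or r = n + 1 - j, whatever q is. Hence the numerator of \<open>kap\<close>
  vanishes wherever its denominator does.\<close>

lemma qcas_eqD:
  assumes q: "q \<ge> 1" and j: "2 * j \<le> n" and r: "r \<le> Suc n" and eq: "qcas q n r = qcas q n j"
  shows "qcas 1 n r = qcas 1 n j"
proof (cases "2 * r \<le> Suc n")
  case True
  then show ?thesis using qcas_eq_low[OF q True _ eq] j by simp
next
  case False
  have "qcas q n (Suc n - r) = qcas q n j" using qcas_sym[OF r, of q] eq by simp
  moreover have "2 * (Suc n - r) \<le> Suc n" using False by linarith
  ultimately have "Suc n - r = j" using qcas_eq_low[OF q] j by simp
  then show ?thesis using qcas_sym[OF r, of 1] by simp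
qed

lemma qint_1: "qint 1 m = m"
  by (induction m) auto

section \<open>Operators given by kernels on a finite set\<close>

text \<open>The source is the first argument of the kernel and the target the second; thus
  \<open>up c x y\<close> and \<open>dn c y x\<close> both belong to the step from x up to
  y.\<close>

definition lin :: "'b set \<Rightarrow> ('b \<Rightarrow> 'b \<Rightarrow> 'k) \<Rightarrow> ('b \<Rightarrow> 'k) \<Rightarrow> 'b \<Rightarrow> 'k::comm_ring_1" where
  "lin S k f y = (\<Sum>x\<in>S. k x y * f x)"

lemma lin_add: "lin S k (\<lambda>x. f x + g x) = (\<lambda>y. lin S k f y + lin S k g y)"
  by (auto simp: lin_def algebra_simps sum.distrib)

lemma lin_diff: "lin S k (\<lambda>x. f x - g x) = (\<lambda>y. lin S k f y - lin S k g y)"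
  by (auto simp: lin_def algebra_simps sum_subtractf)

lemma lin_mult: "lin S k (\<lambda>x. a * f x) = (\<lambda>y. a * lin S k f y)"
  by (auto simp: lin_def algebra_simps sum_distrib_left)

lemma lin_zero: "lin S k (\<lambda>x. 0) = (\<lambda>y. 0)"
  by (auto simp: lin_def)

lemma lin_sum: "lin S k (\<lambda>x. \<Sum>i\<in>I. f i x) = (\<lambda>y. \<Sum>i\<in>I. lin S k (f i) y)"
  by (rule ext, induction I rule: infinite_finite_induct) (auto simp: lin_zero lin_add)

text \<open>No lattice appears, only kernels and degrees, so that the results serve raising and,
  with the degrees reversed, lowering. Different classes commute; inside one class
  \<open>rel\<close> holds instead, with a scalar depending on the degree in that class
  alone.\<close>

locale sl2_family =
  fixes S :: "'b set" and C :: "'c set"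
    and up dn :: "'c \<Rightarrow> 'b \<Rightarrow> 'b \<Rightarrow> 'k::field_char_0"
    and \<rho> :: "'c \<Rightarrow> 'b \<Rightarrow> nat" and n q :: "'c \<Rightarrow> nat"
  assumes finite_S: "finite S" and finite_C: "finite C"
    and q_pos: "c \<in> C \<Longrightarrow> q c \<ge> 1"
    and rho_le: "c \<in> C \<Longrightarrow> x \<in> S \<Longrightarrow> \<rho> c x \<le> n c"
    and up_supp: "c \<in> C \<Longrightarrow> up c x y \<noteq> 0 \<Longrightarrow> x \<in> S \<and> y \<in> S \<and> \<rho> c y = Suc (\<rho> c x)"
    and up_supp': "c \<in> C \<Longrightarrow> c' \<in> C \<Longrightarrow> c' \<noteq> c \<Longrightarrow> up c x y \<noteq> 0 \<Longrightarrow> \<rho> c' y = \<rho> c' x"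
    and dn_supp: "c \<in> C \<Longrightarrow> dn c y x \<noteq> 0 \<Longrightarrow> x \<in> S \<and> y \<in> S \<and> \<rho> c y = Suc (\<rho> c x)"
    and dn_supp': "c \<in> C \<Longrightarrow> c' \<in> C \<Longrightarrow> c' \<noteq> c \<Longrightarrow> dn c y x \<noteq> 0 \<Longrightarrow> \<rho> c' y = \<rho> c' x"
    and UU: "c \<in> C \<Longrightarrow> c' \<in> C \<Longrightarrow> c \<noteq> c' \<Longrightarrow>
      lin S (up c) (lin S (up c') f) = lin S (up c') (lin S (up c) f)"
    and DD: "c \<in> C \<Longrightarrow> c' \<in> C \<Longrightarrow> c \<noteq> c' \<Longrightarrow>
      lin S (dn c) (lin S (dn c') f) = lin S (dn c') (lin S (dn c) f)"
    and DU: "c \<in> C \<Longrightarrow> c' \<in> C \<Longrightarrow> c \<noteq> c' \<Longrightarrow>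
      lin S (dn c) (lin S (up c') f) = lin S (up c') (lin S (dn c) f)"
    and rel: "c \<in> C \<Longrightarrow> x \<in> S \<Longrightarrow> lin S (dn c) (lin S (up c) f) x = lin S (up c) (lin S (dn c) f) x
      + (of_nat (qint (q c) (n c - \<rho> c x)) - of_nat (qint (q c) (\<rho> c x))) * f x"
begin

section \<open>The Casimir operators and their commutation\<close>

definition "U c = lin S (up c)"
definition "D c = lin S (dn c)"
definition phi :: "'c \<Rightarrow> nat \<Rightarrow> 'k" where "phi c i = of_nat (qcas (q c) (n c) i)"
definition gam :: "'c \<Rightarrow> nat \<Rightarrow> 'k" where "gam c i = of_nat (qcas 1 (n c) i)"
definition V :: "('b \<Rightarrow> 'k) set" where "V = {f. \<forall>x. x \<notin> S \<longrightarrow> f x = 0}"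
text \<open>The subtracted term makes two expressions agree on V: UD minus \<open>phi\<close> of the
  degree, and DU minus \<open>phi\<close> of the degree plus one. On a vector of degree i killed by
  \<open>D c\<close> the operator is - \<open>phi c i\<close>.\<close>

definition casimir :: "'c \<Rightarrow> ('b \<Rightarrow> 'k) \<Rightarrow> 'b \<Rightarrow> 'k" where
  "casimir c f = (\<lambda>x. U c (D c f) x - phi c (\<rho> c x) * f x)"

lemma U_V: "c \<in> C \<Longrightarrow> U c f \<in> V"
  unfolding V_def U_def lin_def using up_supp by (fastforce intro!: sum.neutral)

lemma D_V: "c \<in> C \<Longrightarrow> D c f \<in> V"
  unfolding V_def D_def lin_def using dn_supp by (fastforce intro!: sum.neutral)

text \<open>A function of the degree passes \<open>U c\<close> with its argument shifted by one.
  These weight rules replace commutators with a degree operator.\<close>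

lemma U_weight: "c \<in> C \<Longrightarrow> U c (\<lambda>x. w (Suc (\<rho> c x)) * f x) = (\<lambda>y. w (\<rho> c y) * U c f y)"
  unfolding U_def lin_def sum_distrib_left using up_supp by (fastforce intro!: sum.cong)

lemma U_weight': "c \<in> C \<Longrightarrow> c' \<in> C \<Longrightarrow> c' \<noteq> c \<Longrightarrow>
    U c (\<lambda>x. w (\<rho> c' x) * f x) = (\<lambda>y. w (\<rho> c' y) * U c f y)"
  unfolding U_def lin_def sum_distrib_left using up_supp' by (fastforce intro!: sum.cong)

lemma D_weight: "c \<in> C \<Longrightarrow> D c (\<lambda>x. w (\<rho> c x) * f x) = (\<lambda>y. w (Suc (\<rho> c y)) * D c f y)"
  unfolding D_def lin_def sum_distrib_left using dn_supp by (fastforce intro!: sum.cong)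

lemma D_weight': "c \<in> C \<Longrightarrow> c' \<in> C \<Longrightarrow> c' \<noteq> c \<Longrightarrow>
    D c (\<lambda>x. w (\<rho> c' x) * f x) = (\<lambda>y. w (\<rho> c' y) * D c f y)"
  unfolding D_def lin_def sum_distrib_left using dn_supp' by (fastforce intro!: sum.cong)

lemma phi_Suc:
  assumes "i \<le> n c"
  shows "of_nat (qint (q c) (n c - i)) - of_nat (qint (q c) i) = phi c (Suc i) - phi c i"
proof -
  have "(of_nat (qcas (q c) (n c) (Suc i) + qint (q c) i) :: 'k) =
      of_nat (qcas (q c) (n c) i + qint (q c) (n c - i))"
    using qcas_Suc[OF assms, of "q c"] by simp
  then show ?thesis by (simp add: phi_def algebra_simps)
qed

lemma DU_eq:
  assumes c: "c \<in> C" and f: "f \<in> V"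
  shows "D c (U c f) = (\<lambda>x. U c (D c f) x + (phi c (Suc (\<rho> c x)) - phi c (\<rho> c x)) * f x)"
proof
  fix x
  show "D c (U c f) x = U c (D c f) x + (phi c (Suc (\<rho> c x)) - phi c (\<rho> c x)) * f x"
  proof (cases "x \<in> S")
    case True
    then show ?thesis using rel[OF c True, of f] phi_Suc[OF rho_le[OF c True]]
      by (simp add: U_def D_def)
  next
    case False
    then show ?thesis using f U_V[OF c, of "D c f"] D_V[OF c, of "U c f"] by (auto simp: V_def)
  qed
qed

lemma casimir_DU:
  "c \<in> C \<Longrightarrow> f \<in> V \<Longrightarrow> casimir c f = (\<lambda>x. D c (U c f) x - phi c (Suc (\<rho> c x)) * f x)"
  by (auto simp: casimir_def DU_eq algebra_simps)

lemma casimir_V: "c \<in> C \<Longrightarrow> f \<in> V \<Longrightarrow> casimir c f \<in> V"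
  using U_V[of c "D c f"] by (auto simp: casimir_def V_def)

lemma casimir_add: "casimir c (\<lambda>x. f x + g x) = (\<lambda>x. casimir c f x + casimir c g x)"
  by (auto simp: casimir_def U_def D_def lin_add algebra_simps)

lemma casimir_diff: "casimir c (\<lambda>x. f x - g x) = (\<lambda>x. casimir c f x - casimir c g x)"
  by (auto simp: casimir_def U_def D_def lin_diff algebra_simps)

lemma casimir_mult: "casimir c (\<lambda>x. a * f x) = (\<lambda>x. a * casimir c f x)"
  by (auto simp: casimir_def U_def D_def lin_mult algebra_simps)

lemma casimir_sum: "casimir c (\<lambda>x. \<Sum>i\<in>I. f i x) = (\<lambda>x. \<Sum>i\<in>I. casimir c (f i) x)"
  by (auto simp: casimir_def U_def D_def lin_sum sum_subtractf sum_distrib_left)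

text \<open>In the same class both sides contain UDU: one reads the Casimir operator through UD, the
  other through DU, and the shift of the weight absorbs the difference. For another class each term
  commutes separately.\<close>

lemma casimir_U:
  assumes c: "c \<in> C" and c': "c' \<in> C" and f: "f \<in> V"
  shows "casimir c (U c' f) = U c' (casimir c f)"
proof (cases "c = c'")
  case True
  have "U c (casimir c f) = (\<lambda>y. U c (D c (U c f)) y - phi c (\<rho> c y) * U c f y)"
    using U_weight[OF c, of "phi c" f] by (simp add: casimir_DU[OF c f]) (simp add: U_def lin_diff)
  then show ?thesis unfolding True[symmetric] by (simp add: casimir_def)
next
  case False
  have "U c' (casimir c f) = (\<lambda>y. U c' (U c (D c f)) y - phi c (\<rho> c y) * U c' f y)"
    using U_weight'[OF c' c, of "phi c" f] False by (simp add: casimir_def) (simp add: U_def lin_diff)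
  also have "U c' (U c (D c f)) = U c (D c (U c' f))"
    using UU[OF c' c] DU[OF c c'] False unfolding U_def D_def by metis
  finally show ?thesis by (simp add: casimir_def)
qed

lemma casimir_D:
  assumes c: "c \<in> C" and c': "c' \<in> C" and f: "f \<in> V"
  shows "casimir c (D c' f) = D c' (casimir c f)"
proof (cases "c = c'")
  case True
  have "D c (casimir c f) = (\<lambda>y. D c (U c (D c f)) y - phi c (Suc (\<rho> c y)) * D c f y)"
    using D_weight[OF c, of "phi c" f] by (simp add: casimir_def) (simp add: D_def lin_diff)
  then show ?thesis unfolding True[symmetric] by (simp add: casimir_DU[OF c D_V[OF c]])
next
  case False
  have "D c' (casimir c f) = (\<lambda>y. D c' (U c (D c f)) y - phi c (\<rho> c y) * D c' f y)"
    using D_weight'[OF c' c, of "phi c" f] False by (simp add: casimir_def) (simp add: D_def lin_diff)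
  also have "D c' (U c (D c f)) = U c (D c (D c' f))"
    using DD[OF c' c] DU[OF c' c] False unfolding U_def D_def by metis
  finally show ?thesis by (simp add: casimir_def)
qed

lemma casimir_weight:
  assumes c: "c \<in> C" and c': "c' \<in> C"
  shows "casimir c (\<lambda>x. w (\<rho> c' x) * f x) = (\<lambda>x. w (\<rho> c' x) * casimir c f x)"
proof (cases "c = c'")
  case True
  have "U c (D c (\<lambda>x. w (\<rho> c x) * f x)) = (\<lambda>y. w (\<rho> c y) * U c (D c f) y)"
    by (simp only: D_weight[OF c] U_weight[OF c])
  then show ?thesis unfolding True[symmetric] casimir_def by (simp add: right_diff_distrib mult.left_commute)
next
  case False
  have "U c (D c (\<lambda>x. w (\<rho> c' x) * f x)) = (\<lambda>y. w (\<rho> c' y) * U c (D c f) y)"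
    using False by (simp only: D_weight'[OF c c' False[symmetric]] U_weight'[OF c c' False[symmetric]])
  then show ?thesis unfolding casimir_def by (simp add: right_diff_distrib mult.left_commute)
qed

lemma casimir_casimir:
  assumes c: "c \<in> C" and c': "c' \<in> C" and f: "f \<in> V"
  shows "casimir c (casimir c' f) = casimir c' (casimir c f)"
proof -
  have "casimir c (casimir c' f) =
      (\<lambda>x. casimir c (U c' (D c' f)) x - phi c' (\<rho> c' x) * casimir c f x)"
    unfolding casimir_def[of c' f] casimir_diff casimir_weight[OF c c'] by simp
  also have "casimir c (U c' (D c' f)) = U c' (D c' (casimir c f))"
    by (simp add: casimir_U[OF c c' D_V[OF c']] casimir_D[OF c c' f])
  finally show ?thesis by (simp add: casimir_def[of c' "casimir c f"])
qed

section \<open>Annihilating polynomials and eigenvectors\<close>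

text \<open>The product of the factors casimir + \<open>phi c i\<close> for i < j. Its roots are the
  eigenvalues that lowest-degree vectors of degrees below j would have.\<close>

primrec cpoly :: "'c \<Rightarrow> nat \<Rightarrow> ('b \<Rightarrow> 'k) \<Rightarrow> 'b \<Rightarrow> 'k" where
  "cpoly c 0 f = f"
| "cpoly c (Suc j) f = (\<lambda>x. casimir c (cpoly c j f) x + phi c j * cpoly c j f x)"

lemma cpoly_V: "c \<in> C \<Longrightarrow> f \<in> V \<Longrightarrow> cpoly c j f \<in> V"
  by (induction j) (use casimir_V in \<open>auto simp: V_def\<close>)

lemma cpoly_shift:
  "cpoly c (Suc j) f = cpoly c j (\<lambda>x. casimir c f x + phi c j * f x)"
proof -
  have "cpoly c i (\<lambda>x. casimir c f x + a * f x) = (\<lambda>x. casimir c (cpoly c i f) x + a * cpoly c i f x)"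
    for a i
    by (induction i) (auto simp: casimir_add casimir_mult algebra_simps)
  then show ?thesis by simp
qed

lemma cpoly_sum: "cpoly c j (\<lambda>x. \<Sum>i\<in>I. f i x) = (\<lambda>x. \<Sum>i\<in>I. cpoly c j (f i) x)"
  by (induction j) (auto simp: casimir_sum sum.distrib sum_distrib_left)

lemma cpoly_vanish_mono:
  assumes "cpoly c i f = (\<lambda>x. 0)" "i \<le> j" shows "cpoly c j f = (\<lambda>x. 0)"
  using assms(2,1) by (induction rule: dec_induct) (auto simp: casimir_def U_def D_def lin_zero)

lemma cpoly_U: "c \<in> C \<Longrightarrow> f \<in> V \<Longrightarrow> cpoly c j (U c f) = U c (cpoly c j f)"
  by (induction j) (auto simp: casimir_U cpoly_V, auto simp: U_def lin_add lin_mult)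

lemma cpoly_D: "c \<in> C \<Longrightarrow> f \<in> V \<Longrightarrow> cpoly c j (D c f) = D c (cpoly c j f)"
  by (induction j) (auto simp: casimir_D cpoly_V, auto simp: D_def lin_add lin_mult)

definition homog :: "'c \<Rightarrow> nat \<Rightarrow> ('b \<Rightarrow> 'k) set" where
  "homog c i = {f \<in> V. \<forall>x. f x \<noteq> 0 \<longrightarrow> \<rho> c x = i}"

lemma U_homog:
  assumes "c \<in> C" "f \<in> homog c i" shows "U c f \<in> homog c (Suc i)"
proof -
  have "\<rho> c y = Suc i" if "U c f y \<noteq> 0" for y
  proof -
    obtain x where "x \<in> S" "up c x y * f x \<noteq> 0"
      using \<open>U c f y \<noteq> 0\<close> unfolding U_def lin_def by (meson sum.neutral)
    then show ?thesis using assms up_supp[OF assms(1), of x y] by (auto simp: homog_def)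
  qed
  then show ?thesis using U_V[OF assms(1)] by (auto simp: homog_def)
qed

lemma D_homog:
  assumes "c \<in> C" "f \<in> homog c i" "D c f x \<noteq> 0" shows "Suc (\<rho> c x) = i"
proof -
  obtain y where "y \<in> S" "dn c y x * f y \<noteq> 0"
    using assms(3) unfolding D_def lin_def by (meson sum.neutral)
  then show ?thesis using assms dn_supp[OF assms(1), of y x] by (auto simp: homog_def)
qed

text \<open>In degree i the factor casimir + \<open>phi c i\<close> equals UD. It therefore factors
  through \<open>D c f\<close>, one degree lower, and the remaining factors commute with
  \<open>U c\<close> and annihilate \<open>D c f\<close> by induction. In degree 0 already
  \<open>D c f\<close> is zero.\<close>

lemma cpoly_low:
  assumes c: "c \<in> C" shows "f \<in> homog c i \<Longrightarrow> cpoly c (Suc i) f = (\<lambda>x. 0)"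
proof (induction i arbitrary: f)
  case (0 f)
  have "D c f = (\<lambda>x. 0)" using D_homog[OF c 0] by auto
  then have "casimir c f x = - phi c 0 * f x" for x
    using 0 by (auto simp: casimir_def U_def lin_zero homog_def)
  then show ?case by simp
next
  case (Suc i f)
  have V: "f \<in> V" using Suc.prems by (simp add: homog_def)
  have "casimir c f x + phi c (Suc i) * f x = U c (D c f) x" for x
    using Suc.prems by (auto simp: casimir_def homog_def)
  then have "cpoly c (Suc (Suc i)) f = U c (cpoly c (Suc i) (D c f))"
    by (simp add: cpoly_shift[of c "Suc i"] cpoly_U[OF c D_V[OF c]] del: cpoly.simps)
  moreover have "D c f \<in> homog c i" using D_homog[OF c Suc.prems] D_V[OF c] by (auto simp: homog_def)
  ultimately show ?case using Suc.IH by (simp add: U_def lin_zero)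
qed

text \<open>The mirror image: by the symmetry of \<open>qcas\<close> the factor with index m = n - i
  acts in degree i as DU, so the induction passes through \<open>U c f\<close>, one degree nearer to
  the top.\<close>

lemma cpoly_high:
  assumes c: "c \<in> C"
  shows "f \<in> homog c i \<Longrightarrow> i + m = n c \<Longrightarrow> cpoly c (Suc m) f = (\<lambda>x. 0)"
proof (induction m arbitrary: f i)
  case (0 f)
  have V: "f \<in> V" using 0 by (simp add: homog_def)
  have "phi c (Suc i) = phi c 0" using 0 by (simp add: phi_def qcas_def)
  moreover have "U c f = (\<lambda>x. 0)"
    using U_homog[OF c 0(1)] rho_le[OF c] 0(2) by (fastforce simp: homog_def V_def)
  ultimately have "casimir c f x = - phi c 0 * f x" for x
    using 0 by (auto simp: casimir_DU[OF c V] D_def lin_zero homog_def)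
  then show ?case by simp
next
  case (Suc m f i)
  have V: "f \<in> V" using Suc.prems by (simp add: homog_def)
  have "Suc (n c) - Suc i = Suc m" "Suc i \<le> Suc (n c)" using Suc.prems(2) by auto
  then have "phi c (Suc m) = phi c (Suc i)"
    using qcas_sym[of "Suc i" "n c" "q c"] by (simp only: phi_def)
  then have "casimir c f x + phi c (Suc m) * f x = D c (U c f) x" for x
    using Suc.prems by (auto simp: casimir_DU[OF c V] homog_def)
  then have "cpoly c (Suc (Suc m)) f = D c (cpoly c (Suc m) (U c f))"
    by (simp add: cpoly_shift[of c "Suc m"] cpoly_D[OF c U_V[OF c]] del: cpoly.simps)
  moreover have "U c f \<in> homog c (Suc i)" using U_homog[OF c Suc.prems(1)] .
  ultimately show ?case using Suc.IH[of "U c f" "Suc i"] Suc.prems(2)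
    by (simp add: D_def lin_zero del: cpoly.simps)
qed

text \<open>Degrees up to n div 2 are killed from below and the others from above, so the factors of
  the lower half suffice. This confines the eigenvalues to 2 * j \<le> n, where \<open>qcas\<close>
  is injective.\<close>

lemma cpoly_annihilates:
  assumes c: "c \<in> C" and f: "f \<in> V"
  shows "cpoly c (Suc (n c div 2)) f = (\<lambda>x. 0)"
proof -
  let ?g = "\<lambda>i x. if \<rho> c x = i then f x else 0"
  have "f x = (\<Sum>i\<le>n c. ?g i x)" for x
    using f rho_le[OF c, of x] by (cases "x \<in> S") (auto simp: V_def)
  then have "f = (\<lambda>x. \<Sum>i\<le>n c. ?g i x)" by (rule ext)
  then have "cpoly c (Suc (n c div 2)) f = (\<lambda>x. \<Sum>i\<le>n c. cpoly c (Suc (n c div 2)) (?g i) x)"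
    using cpoly_sum[of c "Suc (n c div 2)" ?g "{..n c}"] by simp
  moreover have "cpoly c (Suc (n c div 2)) (?g i) = (\<lambda>x. 0)" if "i \<le> n c" for i
  proof -
    have h: "?g i \<in> homog c i" using f by (auto simp: homog_def V_def)
    show ?thesis
    proof (cases "i \<le> n c div 2")
      case True
      then show ?thesis using cpoly_vanish_mono[OF cpoly_low[OF c h]] by (simp del: cpoly.simps)
    next
      case False
      then have "Suc (n c - i) \<le> Suc (n c div 2)" by linarith
      then show ?thesis using cpoly_vanish_mono[OF cpoly_high[OF c h, of "n c - i"]] that
        by (simp del: cpoly.simps)
    qed
  qed
  ultimately show ?thesis by (simp del: cpoly.simps)
qed

text \<open>The factors of \<open>cpoly\<close> are applied to f one after the other. The last
  nonzero vector is annihilated by the next factor, hence an eigenvector, and it stays in K because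
  K is stable under each factor.\<close>

lemma eigenvector_exists:
  assumes c: "c \<in> C" and KV: "K \<subseteq> V" and f: "f \<in> K" "f \<noteq> (\<lambda>x. 0)"
    and K: "\<And>g a. g \<in> K \<Longrightarrow> (\<lambda>x. casimir c g x + a * g x) \<in> K"
  obtains g j where "g \<in> K" "g \<noteq> (\<lambda>x. 0)" "2 * j \<le> n c" "casimir c g = (\<lambda>x. - phi c j * g x)"
proof -
  have KK: "cpoly c j f \<in> K" for j by (induction j) (auto simp: f K)
  have *: "cpoly c (Suc (n c div 2)) f = (\<lambda>x. 0)" using cpoly_annihilates[OF c] f KV by auto
  define t where "t = (LEAST t. cpoly c t f = (\<lambda>x. 0))"
  have t: "cpoly c t f = (\<lambda>x. 0)" "t \<le> Suc (n c div 2)"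
    using LeastI[of "\<lambda>t. cpoly c t f = (\<lambda>x. 0)", OF *] Least_le[of "\<lambda>t. cpoly c t f = (\<lambda>x. 0)", OF *]
    by (auto simp: t_def)
  obtain j where j: "t = Suc j" using t f(2) by (cases t) auto
  have "cpoly c j f \<noteq> (\<lambda>x. 0)"
    using not_less_Least[of j "\<lambda>t. cpoly c t f = (\<lambda>x. 0)"] j by (auto simp: t_def)
  moreover have "casimir c (cpoly c j f) x = - phi c j * cpoly c j f x" for x
    using fun_cong[OF t(1), of x] unfolding j by (simp add: eq_neg_iff_add_eq_0)
  moreover have "2 * j \<le> n c" using t(2) j by simp
  ultimately show ?thesis using that[OF KK] by blast
qed

lemma joint_eigenvector_exists:
  assumes KV: "K \<subseteq> V" and f: "f \<in> K" "f \<noteq> (\<lambda>x. 0)"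
    and K: "\<And>c g a. c \<in> C \<Longrightarrow> g \<in> K \<Longrightarrow> (\<lambda>x. casimir c g x + a * g x) \<in> K"
  obtains g j where "g \<in> K" "g \<noteq> (\<lambda>x. 0)"
    "\<And>c. c \<in> C \<Longrightarrow> 2 * j c \<le> n c \<and> casimir c g = (\<lambda>x. - phi c (j c) * g x)"
proof -
  have "\<exists>g j. g \<in> K \<and> g \<noteq> (\<lambda>x. 0) \<and>
      (\<forall>c\<in>C'. 2 * j c \<le> n c \<and> casimir c g = (\<lambda>x. - phi c (j c) * g x))"
    if "finite C'" "C' \<subseteq> C" for C'
    using that
  proof (induction C')
    case empty
    then show ?case using f by auto
  next
    case (insert c C')
    then obtain h j where h: "h \<in> K" "h \<noteq> (\<lambda>x. 0)"
      and hj: "\<forall>c\<in>C'. 2 * j c \<le> n c \<and> casimir c h = (\<lambda>x. - phi c (j c) * h x)" by auto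
    \<comment> \<open>The induction continues inside the joint eigenspace of the classes already
      treated, which is stable under the next Casimir operator because the operators
      commute.\<close>
    let ?K = "{g \<in> K. \<forall>c\<in>C'. casimir c g = (\<lambda>x. - phi c (j c) * g x)}"
    have c: "c \<in> C" using insert by auto
    have inv: "(\<lambda>x. casimir c g x + a * g x) \<in> ?K" if g: "g \<in> ?K" for g a
    proof -
      have "casimir c' (\<lambda>x. casimir c g x + a * g x) =
          (\<lambda>x. - phi c' (j c') * (casimir c g x + a * g x))" if c': "c' \<in> C'" for c'
      proof -
        have "casimir c' (casimir c g) = (\<lambda>x. - phi c' (j c') * casimir c g x)"
          using casimir_casimir[OF _ c, of c' g] g KV c' insert.prems casimir_mult[of c "- phi c' (j c')" g]
          by auto
        then show ?thesis using g c' by (simp add: casimir_add casimir_mult algebra_simps)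
      qed
      then show ?thesis using g K[OF c] by auto
    qed
    have "?K \<subseteq> V" "h \<in> ?K" using KV h hj by auto
    from eigenvector_exists[OF c this h(2) inv]
    obtain g i where g: "g \<in> ?K" "g \<noteq> (\<lambda>x. 0)" "2 * i \<le> n c" "casimir c g = (\<lambda>x. - phi c i * g x)"
      by blast
    then show ?case using insert.hyps hj by (intro exI[of _ g] exI[of _ "j(c := i)"]) auto
  qed
  from this[OF finite_C order_refl] show ?thesis using that by blast
qed

section \<open>Undeforming the lowering operators on a joint eigenspace\<close>

text \<open>The factor by which lowering from degree r is multiplied to turn the deformed scalar of
  UD into the undeformed one. Division by zero gives 0, and this value is consistent because then
  the numerator is 0 as well (\<open>kap_eq\<close>).\<close>

definition kap :: "nat \<Rightarrow> 'c \<Rightarrow> nat \<Rightarrow> 'k" where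
  "kap j c r = (gam c r - gam c j) / (phi c r - phi c j)"

lemma kap_eq:
  assumes "c \<in> C" "2 * j \<le> n c" "r \<le> Suc (n c)"
  shows "kap j c r * (phi c r - phi c j) = gam c r - gam c j"
proof (cases "phi c r = phi c j")
  case True
  then have "qcas (q c) (n c) r = qcas (q c) (n c) j" by (simp add: phi_def)
  from qcas_eqD[OF q_pos[OF assms(1)] assms(2,3) this] show ?thesis by (simp add: gam_def True)
qed (simp add: kap_def)

lemma gam_Suc: "r \<le> n c \<Longrightarrow> gam c (Suc r) - gam c r = of_nat (n c) - 2 * of_nat r"
proof -
  assume "r \<le> n c"
  then have "(of_nat (qcas 1 (n c) (Suc r) + r) :: 'k) = of_nat (qcas 1 (n c) r + (n c - r))"
    using qcas_Suc[of r "n c" 1] by (simp only: qint_1)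
  then show ?thesis using \<open>r \<le> n c\<close> by (simp add: gam_def of_nat_diff algebra_simps)
qed

definition E :: "('c \<Rightarrow> nat) \<Rightarrow> ('b \<Rightarrow> 'k) set" where
  "E j = {f \<in> V. \<forall>c\<in>C. casimir c f = (\<lambda>x. - phi c (j c) * f x)}"

definition Ut :: "('b \<Rightarrow> 'k) \<Rightarrow> 'b \<Rightarrow> 'k" where
  "Ut f = (\<lambda>x. \<Sum>c\<in>C. U c f x)"

definition Dt :: "('c \<Rightarrow> nat) \<Rightarrow> ('b \<Rightarrow> 'k) \<Rightarrow> 'b \<Rightarrow> 'k" where
  "Dt j f = (\<lambda>x. \<Sum>c\<in>C. D c (\<lambda>y. kap (j c) c (\<rho> c y) * f y) x)"

abbreviation deg :: "'b \<Rightarrow> nat" where "deg x \<equiv> (\<Sum>c\<in>C. \<rho> c x)"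

lemma Ut_V: "Ut f \<in> V"
  using U_V by (auto simp: Ut_def V_def intro!: sum.neutral)

lemma Dt_V: "Dt j f \<in> V"
  using D_V by (auto simp: Dt_def V_def intro!: sum.neutral)

lemma casimir_Ut: "c \<in> C \<Longrightarrow> f \<in> V \<Longrightarrow> casimir c (Ut f) = Ut (casimir c f)"
  by (auto simp: Ut_def casimir_sum casimir_U)

lemma Ut_mult: "Ut (\<lambda>x. a * f x) = (\<lambda>x. a * Ut f x)"
  by (auto simp: Ut_def U_def lin_mult sum_distrib_left)

lemma Ut_add: "Ut (\<lambda>x. f x + g x) = (\<lambda>x. Ut f x + Ut g x)"
  by (auto simp: Ut_def U_def lin_add sum.distrib)

lemma Ut_E: "f \<in> E j \<Longrightarrow> Ut f \<in> E j"
  using casimir_Ut Ut_V by (auto simp: E_def Ut_mult)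
    (simp add: Ut_mult[of "- phi _ (j _)", simplified])

lemma Dt_E: "f \<in> E j \<Longrightarrow> Dt j f \<in> E j"
proof -
  assume f: "f \<in> E j"
  have "casimir c (Dt j f) = (\<lambda>x. - phi c (j c) * Dt j f x)" if c: "c \<in> C" for c
  proof -
    have "casimir c (D c' (\<lambda>y. kap (j c') c' (\<rho> c' y) * f y)) =
        (\<lambda>x. - phi c (j c) * D c' (\<lambda>y. kap (j c') c' (\<rho> c' y) * f y) x)" if c': "c' \<in> C" for c'
    proof -
      let ?g = "\<lambda>y. kap (j c') c' (\<rho> c' y) * f y"
      have "?g \<in> V" using f by (auto simp: E_def V_def)
      then have "casimir c (D c' ?g) = D c' (casimir c ?g)" using casimir_D[OF c c'] by simp
      also have "casimir c ?g = (\<lambda>x. - phi c (j c) * ?g x)"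
        using casimir_weight[OF c c', of "kap (j c') c'" f] f c by (simp add: E_def algebra_simps)
      finally show ?thesis by (simp only: D_def lin_mult)
    qed
    then show ?thesis by (simp add: Dt_def casimir_sum sum_distrib_left)
  qed
  then show ?thesis using Dt_V by (auto simp: E_def)
qed

text \<open>Pairs of different classes cancel, because a weight in the degree of c passes the
  raising operator of another class unchanged. Within a class UD and DU are scalars on the
  eigenspace, \<open>kap\<close> turns \<open>phi\<close> into \<open>gam\<close>, and consecutive
  values of \<open>gam\<close> differ by n - 2r, which is linear in r and so adds up to a function
  of the total degree.\<close>

lemma sl2_relation:
  assumes f: "f \<in> E j" and j: "\<And>c. c \<in> C \<Longrightarrow> 2 * j c \<le> n c"
  shows "Dt j (Ut f) x = Ut (Dt j f) x + (of_nat (\<Sum>c\<in>C. n c) - 2 * of_nat (deg x)) * f x"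
proof (cases "x \<in> S")
  case False
  then show ?thesis using Ut_V[of "Dt j f"] Dt_V[of j "Ut f"] f by (auto simp: V_def E_def)
next
  case True
  define k where "k c y = kap (j c) c (\<rho> c y)" for c y
  have V: "f \<in> V" using f by (simp add: E_def)
  have "D c (\<lambda>y. k c y * U c' f y) x = U c' (D c (\<lambda>y. k c y * f y)) x +
      (if c = c' then (of_nat (n c) - 2 * of_nat (\<rho> c x)) * f x else 0)"
    if c: "c \<in> C" and c': "c' \<in> C" for c c'
  proof (cases "c = c'")
    case False
    have "(\<lambda>y. k c y * U c' f y) = U c' (\<lambda>y. k c y * f y)"
      using U_weight'[OF c' c False, of "kap (j c) c" f] by (simp add: k_def)
    then show ?thesis using DU[OF c c' False] False by (simp add: U_def D_def)
  next
    case True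
    define r where "r = \<rho> c x"
    have r: "r \<le> n c" using rho_le[OF c \<open>x \<in> S\<close>] by (simp add: r_def)
    \<comment> \<open>The eigenvalue equation solved for UD: in degree r it is a scalar.\<close>
    have cas: "U c (D c f) x = (phi c r - phi c (j c)) * f x"
    proof -
      have "casimir c f x = - phi c (j c) * f x" using f c by (simp add: E_def)
      then show ?thesis by (simp add: casimir_def r_def algebra_simps)
    qed
    have "D c (U c f) x = (phi c (Suc r) - phi c (j c)) * f x"
      using cas by (simp add: DU_eq[OF c V] r_def algebra_simps)
    then have 1: "D c (\<lambda>y. k c y * U c f y) x = (gam c (Suc r) - gam c (j c)) * f x"
      using kap_eq[OF c j[OF c], of "Suc r"] r
      by (simp add: k_def D_weight[OF c] r_def[symmetric] mult.assoc[symmetric])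
    have "U c (D c (\<lambda>y. k c y * f y)) x = kap (j c) c r * U c (D c f) x"
      using U_weight[OF c, of "kap (j c) c" "D c f"] by (simp add: k_def D_weight[OF c] r_def)
    then have 2: "U c (D c (\<lambda>y. k c y * f y)) x = (gam c r - gam c (j c)) * f x"
      using kap_eq[OF c j[OF c], of r] r cas by (simp add: mult.assoc[symmetric])
    have 3: "of_nat (n c) - 2 * of_nat r = gam c (Suc r) - gam c r" using gam_Suc[OF r] by simp
    show ?thesis unfolding True[symmetric] 1 2 r_def[symmetric] if_P[OF refl] 3
      by (simp add: algebra_simps)
  qed note * = this
  have "Dt j (Ut f) x = (\<Sum>c\<in>C. \<Sum>c'\<in>C. D c (\<lambda>y. k c y * U c' f y) x)"
    by (simp add: Dt_def Ut_def D_def k_def sum_distrib_left lin_sum)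
  also have "\<dots> = (\<Sum>c\<in>C. \<Sum>c'\<in>C. U c' (D c (\<lambda>y. k c y * f y)) x) +
      (\<Sum>c\<in>C. (of_nat (n c) - 2 * of_nat (\<rho> c x)) * f x)"
    using finite_C by (simp add: * sum.distrib)
  also have "(\<Sum>c\<in>C. \<Sum>c'\<in>C. U c' (D c (\<lambda>y. k c y * f y)) x) = Ut (Dt j f) x"
    by (subst sum.swap) (simp add: Ut_def Dt_def U_def k_def lin_sum)
  also have "(\<Sum>c\<in>C. (of_nat (n c) - 2 * of_nat (\<rho> c x)) * f x) =
      (of_nat (\<Sum>c\<in>C. n c) - 2 * of_nat (deg x)) * f x"
    by (simp add: sum_distrib_right[symmetric] sum_subtractf sum_distrib_left)
  finally show ?thesis .
qed

section \<open>The total degree and the Lefschetz property\<close>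

definition H :: "nat \<Rightarrow> ('b \<Rightarrow> 'k) set" where
  "H i = {f \<in> V. \<forall>x. f x \<noteq> 0 \<longrightarrow> deg x = i}"

lemma H_combine:
  assumes "f \<in> H i" "g \<in> H i" shows "(\<lambda>x. f x + a * g x) \<in> H i"
proof -
  have "f x \<noteq> 0 \<or> g x \<noteq> 0" if "f x + a * g x \<noteq> 0" for x using that by auto
  then show ?thesis using assms unfolding H_def V_def by fastforce
qed

lemma up_deg:
  assumes c: "c \<in> C" and "up c x y \<noteq> 0" shows "deg y = Suc (deg x)"
proof -
  have "(\<Sum>c'\<in>C - {c}. \<rho> c' y) = (\<Sum>c'\<in>C - {c}. \<rho> c' x)"
    using up_supp'[OF c] assms by (intro sum.cong) auto
  then show ?thesis using up_supp[OF assms] by (simp add: sum.remove[OF finite_C c])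
qed

lemma dn_deg:
  assumes c: "c \<in> C" and "dn c y x \<noteq> 0" shows "deg y = Suc (deg x)"
proof -
  have "(\<Sum>c'\<in>C - {c}. \<rho> c' y) = (\<Sum>c'\<in>C - {c}. \<rho> c' x)"
    using dn_supp'[OF c] assms by (intro sum.cong) auto
  then show ?thesis using dn_supp[OF assms] by (simp add: sum.remove[OF finite_C c])
qed

lemma Ut_H: "f \<in> H i \<Longrightarrow> Ut f \<in> H (Suc i)"
proof -
  assume f: "f \<in> H i"
  have "deg y = Suc i" if y: "Ut f y \<noteq> 0" for y
  proof -
    obtain c where c: "c \<in> C" "U c f y \<noteq> 0" using y unfolding Ut_def by (meson sum.neutral)
    then obtain x where "x \<in> S" "up c x y * f x \<noteq> 0" unfolding U_def lin_def by (meson sum.neutral)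
    then show ?thesis using f up_deg[OF c(1), of x y] by (auto simp: H_def)
  qed
  then show ?thesis using Ut_V by (auto simp: H_def)
qed

lemma Dt_H: "f \<in> H i \<Longrightarrow> Dt j f x \<noteq> 0 \<Longrightarrow> Suc (deg x) = i"
proof -
  assume f: "f \<in> H i" and x: "Dt j f x \<noteq> 0"
  obtain c where c: "c \<in> C" "D c (\<lambda>y. kap (j c) c (\<rho> c y) * f y) x \<noteq> 0"
    using x unfolding Dt_def by (meson sum.neutral)
  then obtain y where "y \<in> S" "dn c y x * (kap (j c) c (\<rho> c y) * f y) \<noteq> 0"
    unfolding D_def lin_def by (meson sum.neutral)
  then show ?thesis using f dn_deg[OF c(1), of y x] by (auto simp: H_def)
qed

lemma Ut_pow_E: "f \<in> E j \<Longrightarrow> (Ut ^^ m) f \<in> E j"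
  by (induction m) (auto intro: Ut_E)

lemma Ut_pow_H: "f \<in> H i \<Longrightarrow> (Ut ^^ m) f \<in> H (i + m)"
  by (induction m) (auto intro: Ut_H)

lemma Ut_pow_mult: "(Ut ^^ m) (\<lambda>x. a * f x) = (\<lambda>x. a * (Ut ^^ m) f x)"
  by (induction m) (auto simp: Ut_mult)

lemma Ut_pow_add: "(Ut ^^ m) (\<lambda>x. f x + g x) = (\<lambda>x. (Ut ^^ m) f x + (Ut ^^ m) g x)"
  by (induction m) (auto simp: Ut_add)

lemma Ut_zero: "Ut (\<lambda>x. 0) = (\<lambda>x. 0)"
  by (simp add: Ut_def U_def lin_zero)

lemma Ut_pow_zero: "(Ut ^^ m) (\<lambda>x. 0) = (\<lambda>x. 0)"
  by (induction m) (auto simp: Ut_zero)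

lemma casimir_Ut_pow: "c \<in> C \<Longrightarrow> f \<in> V \<Longrightarrow> casimir c ((Ut ^^ m) f) = (Ut ^^ m) (casimir c f)"
proof (induction m)
  case (Suc m)
  have "(Ut ^^ m) f \<in> V" using Suc Ut_V by (cases m) auto
  then show ?case using Suc by (simp add: casimir_Ut)
qed simp

text \<open>The commutators picked up in degrees i, ..., i + m are N - 2(i + h) for h \<le> m, and
  their sum is (m + 1)(N - 2i - m).\<close>

lemma sl2_power:
  assumes f: "f \<in> E j" "f \<in> H i" and j: "\<And>c. c \<in> C \<Longrightarrow> 2 * j c \<le> n c"
  shows "Dt j ((Ut ^^ Suc m) f) x = (Ut ^^ Suc m) (Dt j f) x +
    of_nat (Suc m) * (of_nat (\<Sum>c\<in>C. n c) - 2 * of_nat i - of_nat m) * (Ut ^^ m) f x"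
proof (induction m arbitrary: x)
  case 0
  show ?case using sl2_relation[OF f(1) j, of x] f(2) by (auto simp: H_def)
next
  case (Suc m)
  let ?N = "of_nat (\<Sum>c\<in>C. n c) :: 'k"
  let ?g = "(Ut ^^ Suc m) f"
  have g: "?g \<in> E j" "?g \<in> H (i + Suc m)" using Ut_pow_E[OF f(1)] Ut_pow_H[OF f(2)] by blast+
  have "Dt j (Ut ?g) x = Ut (Dt j ?g) x + (?N - 2 * of_nat (deg x)) * ?g x"
    using sl2_relation[OF g(1) j] .
  also have "(?N - 2 * of_nat (deg x)) * ?g x = (?N - 2 * of_nat (i + Suc m)) * ?g x"
    using g(2) by (cases "?g x = 0") (auto simp: H_def simp del: funpow.simps)
  also have "Ut (Dt j ?g) x = (Ut ^^ Suc (Suc m)) (Dt j f) x +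
      of_nat (Suc m) * (?N - 2 * of_nat i - of_nat m) * ?g x"
    unfolding ext[of "Dt j ?g", OF Suc.IH] by (simp add: Ut_add Ut_mult)
  finally show ?case by (simp add: algebra_simps)
qed

text \<open>Outer induction on the degree, inner induction on the exponent. If U^(m+1) f = 0, then
  \<open>sl2_power\<close> makes U^(m+1) of \<open>Dt j f\<close> a nonzero multiple of U^m f. One
  more U annihilates it, so \<open>Dt j f\<close>, one degree lower, is zero by the outer hypothesis
  with exponent m + 2. What is left is U^m f = 0. In degree 0 the vector \<open>Dt j f\<close>
  vanishes at once.\<close>

lemma lefschetz_E:
  assumes j: "\<And>c. c \<in> C \<Longrightarrow> 2 * j c \<le> n c"
  shows "f \<in> E j \<Longrightarrow> f \<in> H i \<Longrightarrow> m + 2 * i \<le> (\<Sum>c\<in>C. n c) \<Longrightarrow> (Ut ^^ m) f = (\<lambda>x. 0) \<Longrightarrow> f = (\<lambda>x. 0)"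
proof (induction i arbitrary: m f)
  case (0 m f)
  have D0: "Dt j f = (\<lambda>x. 0)" using Dt_H[OF 0(2)] by fastforce
  show ?case using 0(3,4)
  proof (induction m)
    case (Suc m)
    have "Dt j ((Ut ^^ Suc m) f) = (\<lambda>x. 0)" using Suc.prems(2) by (simp add: Dt_def D_def lin_zero)
    from fun_cong[OF this] have "of_nat (Suc m) * (of_nat (\<Sum>c\<in>C. n c) - of_nat m) * (Ut ^^ m) f x = 0" for x
      using sl2_power[OF 0(1,2) j, of m x] Ut_pow_zero[of "Suc m"]
        by (simp add: D0 del: of_nat_Suc funpow.simps of_nat_sum)
    moreover have "(of_nat (\<Sum>c\<in>C. n c) - of_nat m :: 'k) \<noteq> 0"
      using Suc.prems(1) by (metis Suc_n_not_le_n add_leD1 eq_iff_diff_eq_0 of_nat_eq_iff)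
    ultimately have "(Ut ^^ m) f = (\<lambda>x. 0)" by (simp add: fun_eq_iff del: of_nat_Suc of_nat_sum)
    then show ?case using Suc by simp
  qed simp
next
  case (Suc i m f)
  note f = Suc.prems(1,2) and IH = Suc.IH
  have DH: "Dt j f \<in> H i" using Dt_H[OF f(2)] Dt_V by (fastforce simp: H_def)
  show ?case using Suc.prems(3,4)
  proof (induction m)
    case (Suc m)
    let ?c = "of_nat (Suc m) * (of_nat (\<Sum>c\<in>C. n c) - 2 * of_nat (Suc i) - of_nat m) :: 'k"
    have "of_nat (\<Sum>c\<in>C. n c) - 2 * of_nat (Suc i) - of_nat m =
        (of_nat (\<Sum>c\<in>C. n c) - of_nat (2 * Suc i + m) :: 'k)" by simp
    also have "\<dots> \<noteq> 0" using Suc.prems(1)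
      by (metis Suc_n_not_le_n add.commute add_Suc eq_iff_diff_eq_0 of_nat_eq_iff)
    finally have c: "?c \<noteq> 0" by (simp del: of_nat_Suc of_nat_sum)
    have "Dt j ((Ut ^^ Suc m) f) = (\<lambda>x. 0)" using Suc.prems(2) by (simp add: Dt_def D_def lin_zero)
    from fun_cong[OF this] have eq: "(Ut ^^ Suc m) (Dt j f) x + ?c * (Ut ^^ m) f x = 0" for x
      using sl2_power[OF f j, of m x] by simp
    then have eq': "(Ut ^^ Suc m) (Dt j f) = (\<lambda>x. - ?c * (Ut ^^ m) f x)"
      by (auto simp: fun_eq_iff eq_neg_iff_add_eq_0 simp del: funpow.simps of_nat_Suc of_nat_sum)
    have "(Ut ^^ Suc (Suc m)) (Dt j f) = Ut ((Ut ^^ Suc m) (Dt j f))" by simp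
    also have "\<dots> = (\<lambda>x. - ?c * (Ut ^^ Suc m) f x)" unfolding eq' Ut_mult by simp
    finally have "(Ut ^^ Suc (Suc m)) (Dt j f) = (\<lambda>x. 0)" using Suc.prems(2) by simp
    then have "Dt j f = (\<lambda>x. 0)" using Suc.prems(1)
      by (intro IH[OF Dt_E[OF f(1)] DH, of "Suc (Suc m)"]) auto
    then have "?c * (Ut ^^ m) f x = 0" for x using eq[of x] Ut_pow_zero[of "Suc m"] by simp
    then have "(Ut ^^ m) f = (\<lambda>x. 0)" using c by (metis mult_eq_0_iff)
    then show ?case using Suc by simp
  qed simp
qed

text \<open>The Casimir operators commute with \<open>Ut\<close> and preserve the total degree, so
  they preserve the kernel of the power in degree i. A nonzero kernel would contain a joint
  eigenvector, contrary to \<open>lefschetz_E\<close>.\<close>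

theorem lefschetz:
  assumes "f \<in> H i" "m + 2 * i \<le> (\<Sum>c\<in>C. n c)" "(Ut ^^ m) f = (\<lambda>x. 0)"
  shows "f = (\<lambda>x. 0)"
proof (rule ccontr)
  assume nz: "f \<noteq> (\<lambda>x. 0)"
  let ?K = "{f \<in> H i. (Ut ^^ m) f = (\<lambda>x. 0)}"
  have inv: "(\<lambda>x. casimir c g x + a * g x) \<in> ?K" if c: "c \<in> C" and g: "g \<in> ?K" for c g a
  proof -
    have V: "g \<in> V" using g by (auto simp: H_def)
    have cas: "casimir c g \<in> V" "(Ut ^^ m) (casimir c g) = (\<lambda>x. 0)"
      using casimir_V[OF c V] casimir_Ut_pow[OF c V, of m] g casimir_mult[of c 0 g] by auto
    have "deg x = i" if "casimir c g x \<noteq> 0" for x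
    proof (rule ccontr)
      assume ne: "deg x \<noteq> i"
      then have "g x = 0" using g by (auto simp: H_def)
      then have "U c (D c g) x \<noteq> 0" using that by (simp add: casimir_def)
      then obtain y where y: "up c y x * D c g y \<noteq> 0" unfolding U_def lin_def by (meson sum.neutral)
      then have "D c g y \<noteq> 0" by auto
      then obtain z where z: "dn c z y * g z \<noteq> 0" unfolding D_def lin_def by (meson sum.neutral)
      show False using up_deg[OF c, of y x] dn_deg[OF c, of z y] y z g ne by (auto simp: H_def)
    qed
    then have "casimir c g \<in> H i" using cas(1) by (auto simp: H_def)
    then have "(\<lambda>x. casimir c g x + a * g x) \<in> H i" using g by (intro H_combine) auto
    moreover have "(Ut ^^ m) (\<lambda>x. casimir c g x + a * g x) = (\<lambda>x. 0)"
      using cas(2) g by (simp add: Ut_pow_add Ut_pow_mult)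
    ultimately show ?thesis by simp
  qed
  have K: "?K \<subseteq> V" "f \<in> ?K" using assms by (auto simp: H_def)
  obtain g j where g: "g \<in> ?K" "g \<noteq> (\<lambda>x. 0)"
    "\<And>c. c \<in> C \<Longrightarrow> 2 * j c \<le> n c \<and> casimir c g = (\<lambda>x. - phi c (j c) * g x)"
    by (rule joint_eigenvector_exists[OF K nz], rule inv, assumption+, rule that)
  then have "g \<in> E j" by (auto simp: E_def H_def)
  then show False using lefschetz_E[of j g i m] g assms(2) by auto
qed

end

section \<open>Modular geometries\<close>

text \<open>Flats are sets of points, so the meet is the intersection. The join in the modular law
  is the least flat containing both, written as an intersection of flats; it is \<open>cl\<close> of
  the union below.\<close>

locale modular_geometry =
  fixes P :: "'p set" and L :: "'p set set" and r :: "'p set \<Rightarrow> nat"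
  assumes finite_P: "finite P" and L_sub: "F \<in> L \<Longrightarrow> F \<subseteq> P"
    and P_L: "P \<in> L" and empty_L: "{} \<in> L" and point_L: "p \<in> P \<Longrightarrow> {p} \<in> L"
    and Int_L: "F \<in> L \<Longrightarrow> G \<in> L \<Longrightarrow> F \<inter> G \<in> L"
    and r_empty: "r {} = 0" and r_point: "p \<in> P \<Longrightarrow> r {p} = 1"
    and r_strict: "F \<in> L \<Longrightarrow> G \<in> L \<Longrightarrow> F \<subset> G \<Longrightarrow> r F < r G"
    and modular: "F \<in> L \<Longrightarrow> G \<in> L \<Longrightarrow> r F + r G = r (F \<inter> G) + r (\<Inter>{H \<in> L. F \<union> G \<subseteq> H})"
begin

section \<open>Closure, coverings and lines\<close>

definition cl :: "'p set \<Rightarrow> 'p set" where "cl S = \<Inter>{H \<in> L. S \<subseteq> H}"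

lemma finite_L: "finite L"
  by (rule finite_subset[of _ "Pow P"]) (use L_sub finite_P in auto)

lemma finite_flat: "F \<in> L \<Longrightarrow> finite F"
  using L_sub finite_P finite_subset by blast

lemma cl_L: assumes "S \<subseteq> P" shows "cl S \<in> L"
proof -
  have "\<Inter>A \<in> L" if "finite A" "A \<noteq> {}" "A \<subseteq> L" for A
    using that by (induction A rule: finite_ne_induct) (auto intro: Int_L)
  from this[of "{H \<in> L. S \<subseteq> H}"] show ?thesis
    unfolding cl_def using finite_L P_L assms by auto
qed

lemma cl_super: "S \<subseteq> cl S" by (auto simp: cl_def)
lemma cl_least: "H \<in> L \<Longrightarrow> S \<subseteq> H \<Longrightarrow> cl S \<subseteq> H" by (auto simp: cl_def)
lemma cl_flat: "F \<in> L \<Longrightarrow> cl F = F" using cl_super cl_least by blast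
lemma cl_mono: "S \<subseteq> T \<Longrightarrow> cl S \<subseteq> cl T" by (auto simp: cl_def)

lemma r_mono: "F \<in> L \<Longrightarrow> G \<in> L \<Longrightarrow> F \<subseteq> G \<Longrightarrow> r F \<le> r G"
  using r_strict[of F G] by (cases "F = G") (auto simp: less_imp_le psubset_eq)

lemma r_eqD: "F \<in> L \<Longrightarrow> G \<in> L \<Longrightarrow> F \<subseteq> G \<Longrightarrow> r G \<le> r F \<Longrightarrow> F = G"
  using r_strict[of F G] by (cases "F = G") auto

lemma rank_zero: "F \<in> L \<Longrightarrow> r F = 0 \<Longrightarrow> F = {}"
  using r_eqD[OF empty_L, of F] by simp

lemma modular_cl: "F \<in> L \<Longrightarrow> G \<in> L \<Longrightarrow> r F + r G = r (F \<inter> G) + r (cl (F \<union> G))"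
  using modular by (simp add: cl_def)

lemma join_L: "F \<in> L \<Longrightarrow> G \<in> L \<Longrightarrow> cl (F \<union> G) \<in> L"
  using L_sub by (intro cl_L) blast

lemma max_flat:
  assumes "A \<subseteq> L" "A \<noteq> {}" shows "\<exists>X\<in>A. \<forall>Y\<in>A. r Y \<le> r X"
proof -
  have fin: "finite A" using assms(1) finite_L finite_subset by blast
  then have "Max (r ` A) \<in> r ` A" using assms(2) by (intro Max_in) auto
  then show ?thesis using Max_ge[of "r ` A"] fin by force
qed

definition cover :: "'p set \<Rightarrow> 'p set \<Rightarrow> bool" where
  "cover F G \<longleftrightarrow> F \<in> L \<and> G \<in> L \<and> F \<subseteq> G \<and> r G = Suc (r F)"

text \<open>Modularity for F and the rank-one flat {p}, which have empty meet.\<close>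

lemma cover_insert:
  assumes "F \<in> L" "p \<in> P" "p \<notin> F" shows "cover F (cl (insert p F))"
proof -
  have "F \<inter> {p} = {}" "F \<union> {p} = insert p F" using assms by auto
  then have "r (cl (insert p F)) = Suc (r F)"
    using modular_cl[OF assms(1) point_L[OF assms(2)]] r_point[OF assms(2)] r_empty by simp
  then show ?thesis using assms cl_L[of "insert p F"] cl_super[of "insert p F"] L_sub
    by (auto simp: cover_def)
qed

lemma cover_cl:
  assumes "cover F G" "p \<in> G" "p \<notin> F" shows "cl (insert p F) = G"
proof -
  have "p \<in> P" using assms L_sub by (auto simp: cover_def)
  from cover_insert[of F p] this assms show ?thesis
    using r_eqD[of "cl (insert p F)" G] cl_least[of G "insert p F"] by (auto simp: cover_def)
qed

lemma cover_ex: assumes "cover F G" obtains p where "p \<in> G" "p \<notin> F"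
proof -
  have "F \<noteq> G" using assms by (auto simp: cover_def)
  then show ?thesis using assms that by (auto simp: cover_def)
qed

lemma cover_neqD: "cover F G \<Longrightarrow> cover F' G \<Longrightarrow> F \<noteq> F' \<Longrightarrow> \<not> F' \<subseteq> F"
  using r_eqD[of F' F] by (auto simp: cover_def)

lemma cover_neqD': "cover F G \<Longrightarrow> cover F G' \<Longrightarrow> G \<noteq> G' \<Longrightarrow> \<not> G' \<subseteq> G"
  using r_eqD[of G' G] by (auto simp: cover_def)

text \<open>Distinct hyperplanes of G span G, because a point of one outside the other already does
  so together with the latter. Modularity then places their meet one rank below each.\<close>

lemma cover_meet:
  assumes "cover F G" "cover F' G" "F \<noteq> F'"
  shows "cover (F \<inter> F') F" "cover (F \<inter> F') F'" "cl (F \<union> F') = G"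
proof -
  have L: "F \<in> L" "F' \<in> L" "G \<in> L" using assms by (auto simp: cover_def)
  obtain p where p: "p \<in> F'" "p \<notin> F" using cover_neqD[OF assms] by auto
  have "G = cl (insert p F)" using cover_cl[OF assms(1), of p] p assms(2) by (auto simp: cover_def)
  also have "\<dots> \<subseteq> cl (F \<union> F')" using p by (intro cl_mono) auto
  finally have "G \<subseteq> cl (F \<union> F')" .
  moreover have "cl (F \<union> F') \<subseteq> G" using L assms by (intro cl_least) (auto simp: cover_def)
  ultimately show G: "cl (F \<union> F') = G" by auto
  then show "cover (F \<inter> F') F" "cover (F \<inter> F') F'"
    using modular_cl[OF L(1,2)] assms Int_L[OF L(1,2)] by (auto simp: cover_def)
qed

lemma cover_join:
  assumes "cover K F" "cover K F'" "F \<noteq> F'"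
  shows "F \<inter> F' = K" "cover F (cl (F \<union> F'))" "cover F' (cl (F \<union> F'))"
proof -
  have L: "F \<in> L" "F' \<in> L" "K \<in> L" using assms by (auto simp: cover_def)
  have "F \<inter> F' \<subset> F" using cover_neqD'[OF assms(2,1)] assms(3) by auto
  then have "r (F \<inter> F') < r F" using r_strict Int_L L by auto
  then have "K = F \<inter> F'" using assms L by (intro r_eqD Int_L) (auto simp: cover_def)
  then show K: "F \<inter> F' = K" by simp
  show "cover F (cl (F \<union> F'))" "cover F' (cl (F \<union> F'))"
    using modular_cl[OF L(1,2)] assms join_L[OF L(1,2)] cl_super[of "F \<union> F'"] K
    by (auto simp: cover_def)
qed

lemma line_L: "p \<in> P \<Longrightarrow> q \<in> P \<Longrightarrow> p \<noteq> q \<Longrightarrow> cover {p} (cl {p, q}) \<and> r (cl {p, q}) = 2"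
  using cover_insert[of "{p}" q] point_L r_point by (auto simp: cover_def insert_commute)

lemma line_eq:
  assumes "l \<in> L" "r l = 2" "p \<in> l" "q \<in> l" "p \<noteq> q" shows "cl {p, q} = l"
proof -
  have pq: "p \<in> P" "q \<in> P" using assms L_sub by auto
  have "cover {p} l" using assms pq point_L r_point by (auto simp: cover_def)
  from cover_cl[OF this, of q] show ?thesis using assms by (simp add: insert_commute)
qed

lemma lines_eq:
  "l \<in> L \<Longrightarrow> r l = 2 \<Longrightarrow> l' \<in> L \<Longrightarrow> r l' = 2 \<Longrightarrow> p \<in> l \<Longrightarrow> q \<in> l \<Longrightarrow> p \<in> l' \<Longrightarrow> q \<in> l' \<Longrightarrow> p \<noteq> q \<Longrightarrow> l = l'"
  using line_eq by metis

lemma rank_one: assumes "X \<in> L" "r X = 1" shows "\<exists>s. X = {s}"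
proof -
  have "X \<noteq> {}" using assms r_empty by auto
  then obtain s where s: "s \<in> X" by auto
  then have "s \<in> P" using L_sub assms by auto
  have "{s} = X" using s assms r_point[OF \<open>s \<in> P\<close>] by (intro r_eqD point_L \<open>s \<in> P\<close>) auto
  then show ?thesis by blast
qed

text \<open>The incidence axiom of projective geometry in every dimension: the line and the
  hyperplane span G, so modularity leaves rank 1 for their meet.\<close>

lemma line_meets:
  assumes F: "cover F G" and l: "l \<in> L" "r l = 2" "l \<subseteq> G" "\<not> l \<subseteq> F"
  shows "\<exists>s. F \<inter> l = {s}"
proof -
  obtain p where p: "p \<in> l" "p \<notin> F" using l by auto
  have FL: "F \<in> L" using F by (simp add: cover_def)
  have "G \<subseteq> cl (F \<union> l)"
    using cover_cl[OF F, of p] p l cl_mono[of "insert p F" "F \<union> l"] by blast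
  moreover have "cl (F \<union> l) \<subseteq> G" using F l by (intro cl_least) (simp_all add: cover_def)
  ultimately have "cl (F \<union> l) = G" by blast
  then have "r (F \<inter> l) = 1" using modular_cl[OF FL l(1)] F l(2) unfolding cover_def by simp
  then show ?thesis using rank_one[OF Int_L[OF FL l(1)]] by blast
qed

subsection \<open>Perspectivity classes\<close>

text \<open>Perspectivity of points in a projective geometry: the line joining them has a third
  point. The classes are the irreducible components.\<close>

definition persp :: "'p \<Rightarrow> 'p \<Rightarrow> bool" where
  "persp p q \<longleftrightarrow> p = q \<or> (\<exists>s\<in>cl {p, q}. s \<noteq> p \<and> s \<noteq> q)"

lemma persp_sym: "persp p q \<Longrightarrow> persp q p"
  by (auto simp: persp_def insert_commute)

text \<open>The line through p and q meets the hyperplane F, and the meeting point is the third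
  point.\<close>

lemma cover_persp:
  assumes "cover F G" "p \<in> G" "p \<notin> F" "q \<in> G" "q \<notin> F" shows "persp p q"
proof (cases "p = q")
  case False
  have GL: "G \<in> L" using assms(1) by (simp add: cover_def)
  have P: "p \<in> P" "q \<in> P" using assms(2,4) L_sub[OF GL] by auto
  have l: "cl {p, q} \<in> L" "r (cl {p, q}) = 2" using line_L[OF P False] unfolding cover_def by blast+
  have "cl {p, q} \<subseteq> G" using assms(2,4) by (intro cl_least[OF GL]) simp
  moreover have "\<not> cl {p, q} \<subseteq> F" using cl_super[of "{p, q}"] assms(3) by blast
  ultimately obtain s where "F \<inter> cl {p, q} = {s}" using line_meets[OF assms(1) l] by blast
  then have "s \<in> cl {p, q}" "s \<noteq> p" "s \<noteq> q" using assms(3,5) by auto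
  then show ?thesis unfolding persp_def by blast
qed (simp add: persp_def)

lemma cl_pair_left: "p \<in> cl {p, q}" and cl_pair_right: "q \<in> cl {p, q}"
  using cl_super[of "{p, q}"] by auto

lemma line_cl: "p \<in> P \<Longrightarrow> q \<in> P \<Longrightarrow> p \<noteq> q \<Longrightarrow> cl {p, q} \<in> L" "p \<in> P \<Longrightarrow> q \<in> P \<Longrightarrow> p \<noteq> q \<Longrightarrow> r (cl {p, q}) = 2"
  using line_L unfolding cover_def by blast+

text \<open>The Veblen-Young configuration: in a triangle p, q, s with third points a on pq and b on
  qs, the line ab meets the side ps. Were the meeting point p or s, the sides pq and qs would
  coincide. If p, q, s are collinear, q itself is the third point.\<close>

lemma persp_trans:
  assumes P: "p \<in> P" "q \<in> P" "s \<in> P" and pq: "persp p q" and qs: "persp q s"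
  shows "persp p s"
proof (cases "p = q \<or> q = s \<or> p = s")
  case True
  then show ?thesis using pq qs by (auto simp: persp_def)
next
  case False
  then obtain a b where a: "a \<in> cl {p, q}" "a \<noteq> p" "a \<noteq> q" and b: "b \<in> cl {q, s}" "b \<noteq> q" "b \<noteq> s"
    using pq qs by (auto simp: persp_def)
  let ?pq = "cl {p, q}" and ?qs = "cl {q, s}" and ?ps = "cl {p, s}"
  have L: "?pq \<in> L" "?qs \<in> L" "?ps \<in> L" and r2: "r ?pq = 2" "r ?qs = 2" "r ?ps = 2"
    using line_cl P False by auto
  have aP: "a \<in> P" "b \<in> P" using a b L L_sub by auto
  note m = cl_pair_left cl_pair_right
  show ?thesis
  proof (cases "s \<in> ?pq")
    case True
    then have "?ps = ?pq" using line_eq[OF L(1) r2(1), of p s] False cl_pair_left by auto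
    then have "q \<in> ?ps" using cl_pair_right[of q p] by simp
    then show ?thesis using False unfolding persp_def by metis
  next
    case ns: False
    have ne: "?pq \<noteq> ?qs" using ns m by metis
    have anb: "a \<noteq> b" using lines_eq[OF L(1) r2(1) L(2) r2(2), of a q] a b m ne by blast
    let ?l = "cl {a, b}"
    let ?G = "cl (insert s ?pq)"
    have l: "?l \<in> L" "r ?l = 2" using line_cl aP anb by auto
    have G: "cover ?pq ?G" using cover_insert[OF L(1) P(3) ns] .
    then have GL: "?G \<in> L" by (simp add: cover_def)
    have pqG: "?pq \<subseteq> ?G" "s \<in> ?G" using cl_super by blast+
    have qsG: "?qs \<subseteq> ?G" "?ps \<subseteq> ?G" using pqG m[of p q] m[of q p] by (auto intro!: cl_least[OF GL])
    have lG: "?l \<subseteq> ?G" using pqG qsG a b by (intro cl_least[OF GL]) auto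
    have psG: "cover ?ps ?G" using G qsG L r2 by (auto simp: cover_def)
    have "\<not> ?l \<subseteq> ?ps"
    proof
      assume "?l \<subseteq> ?ps"
      then have "a \<in> ?ps" using m by blast
      then have "?ps = ?pq" using lines_eq[OF L(3) r2(3) L(1) r2(1), of a p] a m by blast
      then show False using ns m by metis
    qed
    from line_meets[OF psG l lG this] obtain z where z: "z \<in> ?ps" "z \<in> ?l" by blast
    have "z \<noteq> p"
    proof
      assume "z = p"
      then have "?l = ?pq" using lines_eq[OF l L(1) r2(1), of a p] a m z by blast
      then have "b \<in> ?pq" using m by metis
      then show False using lines_eq[OF L(1) r2(1) L(2) r2(2), of b q] b m ne by blast
    qed
    moreover have "z \<noteq> s"
    proof
      assume "z = s"
      then have "?l = ?qs" using lines_eq[OF l L(2) r2(2), of b s] b m z by blast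
      then have "a \<in> ?qs" using m by metis
      then show False using lines_eq[OF L(1) r2(1) L(2) r2(2), of a q] a m ne by blast
    qed
    ultimately show ?thesis using z unfolding persp_def by blast
  qed
qed

definition cls :: "'p \<Rightarrow> 'p set" where "cls p = {q \<in> P. persp p q}"
definition C :: "'p set set" where "C = cls ` P"

lemma finite_C: "finite C" using finite_P by (simp add: C_def)

lemma cls_self: "p \<in> P \<Longrightarrow> p \<in> cls p" by (auto simp: cls_def persp_def)

lemma C_sub: "c \<in> C \<Longrightarrow> c \<subseteq> P" by (auto simp: C_def cls_def)

lemma C_eq: "c \<in> C \<Longrightarrow> p \<in> c \<Longrightarrow> c = cls p"
  unfolding C_def cls_def using persp_trans persp_sym by blast

lemma C_disjoint: "c \<in> C \<Longrightarrow> c' \<in> C \<Longrightarrow> p \<in> c \<Longrightarrow> p \<in> c' \<Longrightarrow> c = c'"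
  using C_eq by metis

section \<open>Coverings of a given class\<close>

text \<open>The points gained in a covering are pairwise perspective, so each covering has exactly
  one class and a single gained point determines it.\<close>

definition cov :: "'p set \<Rightarrow> 'p set \<Rightarrow> 'p set \<Rightarrow> bool" where
  "cov c F G \<longleftrightarrow> cover F G \<and> G - F \<subseteq> c"

lemma cov_cover: "cov c F G \<Longrightarrow> cover F G" by (simp add: cov_def)

lemma covI:
  assumes "cover F G" "p \<in> G" "p \<notin> F" "c \<in> C" "p \<in> c" shows "cov c F G"
proof -
  have "G - F \<subseteq> cls p"
    using cover_persp[OF assms(1-3)] assms(1) L_sub by (auto simp: cls_def cover_def)
  then show ?thesis using C_eq[OF assms(4,5)] assms(1) by (simp add: cov_def)
qed

lemma cov_ex: assumes "cover F G" shows "\<exists>c\<in>C. cov c F G"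
proof -
  obtain p where p: "p \<in> G" "p \<notin> F" using cover_ex[OF assms] .
  then have "p \<in> P" using assms L_sub by (auto simp: cover_def)
  then show ?thesis using covI[OF assms p, of "cls p"] cls_self by (auto simp: C_def)
qed

lemma cov_unique: "cov c F G \<Longrightarrow> cov c' F G \<Longrightarrow> c \<in> C \<Longrightarrow> c' \<in> C \<Longrightarrow> c = c'"
  using cover_ex[of F G] C_disjoint unfolding cov_def by (metis DiffI subsetD)

text \<open>A flat of maximal rank inside c exhausts c: a further point of c would give a covering
  of class c, and its top would still lie in c.\<close>

lemma class_L: assumes c: "c \<in> C" shows "c \<in> L"
proof -
  let ?A = "{X \<in> L. X \<subseteq> c}"
  have "?A \<subseteq> L" "?A \<noteq> {}" using empty_L by auto
  from max_flat[OF this] obtain X where X: "X \<in> L" "X \<subseteq> c"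
    "\<And>Y. Y \<in> L \<Longrightarrow> Y \<subseteq> c \<Longrightarrow> r Y \<le> r X" by blast
  have "c \<subseteq> X"
  proof
    fix p assume p: "p \<in> c"
    show "p \<in> X"
    proof (rule ccontr)
      assume np: "p \<notin> X"
      then have cov: "cover X (cl (insert p X))" using cover_insert X C_sub[OF c] p by auto
      have "cov c X (cl (insert p X))" using covI[OF cov _ np c p] cl_super by blast
      then have "cl (insert p X) \<subseteq> c" using X by (auto simp: cov_def)
      then show False using X(3)[of "cl (insert p X)"] cov by (auto simp: cover_def)
    qed
  qed
  then show ?thesis using X by auto
qed

definition rho :: "'p set \<Rightarrow> 'p set \<Rightarrow> nat" where "rho c F = r (F \<inter> c)"

lemma rho_le: "c \<in> C \<Longrightarrow> F \<in> L \<Longrightarrow> rho c F \<le> r c"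
  unfolding rho_def using Int_L[of F c] class_L[of c] r_mono[of "F \<inter> c" c] by auto

text \<open>Modularity for G \<inter> c and F: they meet in F \<inter> c, and they span G because
  the gained points lie in c.\<close>

lemma cov_rho:
  assumes c: "c \<in> C" and cov: "cov c F G" shows "rho c G = Suc (rho c F)"
proof -
  have L: "F \<in> L" "G \<in> L" "F \<subseteq> G" "cover F G" using cov by (auto simp: cov_def cover_def)
  have GL: "G \<inter> c \<in> L" using Int_L L class_L[OF c] by auto
  obtain p where p: "p \<in> G" "p \<notin> F" using cover_ex[OF L(4)] .
  then have pc: "p \<in> c" using cov by (auto simp: cov_def)
  have "G \<subseteq> cl ((G \<inter> c) \<union> F)"
    using cover_cl[OF L(4) p] cl_mono[of "insert p F" "(G \<inter> c) \<union> F"] p pc by auto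
  moreover have "cl ((G \<inter> c) \<union> F) \<subseteq> G" using L by (intro cl_least) auto
  moreover have "(G \<inter> c) \<inter> F = F \<inter> c" using L by auto
  ultimately show ?thesis using modular_cl[OF GL L(1)] L(4) by (auto simp: rho_def cover_def)
qed

lemma cov_rho':
  assumes "c \<in> C" "c' \<in> C" "c' \<noteq> c" "cov c F G" shows "rho c' G = rho c' F"
proof -
  have "G \<inter> c' = F \<inter> c'" using C_disjoint[OF assms(1,2)] assms(3,4) by (auto simp: cov_def cover_def)
  then show ?thesis by (simp add: rho_def)
qed

lemma lower_cover_ex:
  assumes F: "F \<in> L" "F \<noteq> {}" shows "\<exists>K. cover K F"
proof -
  let ?A = "{X \<in> L. X \<subset> F}"
  have "?A \<subseteq> L" "?A \<noteq> {}" using empty_L F by auto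
  from max_flat[OF this] obtain X where X: "X \<in> L" "X \<subset> F"
    "\<And>Y. Y \<in> L \<Longrightarrow> Y \<subset> F \<Longrightarrow> r Y \<le> r X" by blast
  obtain p where p: "p \<in> F" "p \<notin> X" using X by auto
  then have cov: "cover X (cl (insert p X))" using cover_insert[OF X(1)] L_sub[OF F(1)] by blast
  have "cl (insert p X) \<subseteq> F" using p X F by (intro cl_least) auto
  moreover have "\<not> cl (insert p X) \<subset> F"
    using X(3)[of "cl (insert p X)"] cov unfolding cover_def by linarith
  ultimately have "cl (insert p X) = F" by blast
  then show ?thesis using cov by auto
qed

text \<open>Along a maximal chain each covering raises the degree of exactly one class, and raises
  it by one. The total degree of the operator family is therefore the rank.\<close>

lemma sum_rho: "F \<in> L \<Longrightarrow> (\<Sum>c\<in>C. rho c F) = r F"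
proof (induction "r F" arbitrary: F)
  case 0
  then have "F = {}" using rank_zero[OF 0(2) 0(1)[symmetric]] by blast
  then show ?case by (simp add: rho_def r_empty)
next
  case (Suc m F)
  then have "F \<noteq> {}" using r_empty by auto
  then obtain K where K: "cover K F" using lower_cover_ex[OF Suc.prems] by blast
  then have KL: "K \<in> L" "r F = Suc (r K)" by (simp_all add: cover_def)
  then have m: "m = r K" using Suc.hyps(2) by linarith
  obtain c where c: "c \<in> C" "cov c K F" using cov_ex[OF K] by blast
  have "(\<Sum>c'\<in>C - {c}. rho c' F) = (\<Sum>c'\<in>C - {c}. rho c' K)"
    by (intro sum.cong refl cov_rho'[OF c(1) _ _ c(2)]) auto
  then have "(\<Sum>c\<in>C. rho c F) = Suc (\<Sum>c\<in>C. rho c K)"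
    using cov_rho[OF c] by (simp add: sum.remove[OF finite_C c(1)])
  also have "(\<Sum>c\<in>C. rho c K) = r K" using Suc.hyps(1)[OF m KL(1)] .
  finally show ?case unfolding KL(2) .
qed

subsection \<open>Counting\<close>

text \<open>Projecting from a point outside identifies the points of a hyperplane with the lines through
  that point.\<close>

lemma card_hyperplane:
  assumes F: "cover F G" and x: "x \<in> G" "x \<notin> F"
  shows "card F = card {l \<in> L. x \<in> l \<and> l \<subseteq> G \<and> r l = 2}"
proof (rule bij_betw_same_card[of "\<lambda>y. cl {x, y}"])
  have FL: "F \<in> L" "G \<in> L" "F \<subseteq> G" using F by (auto simp: cover_def)
  have P: "x \<in> P" "\<And>y. y \<in> F \<Longrightarrow> y \<in> P" using FL L_sub x by auto
  have line: "cl {x, y} \<in> L" "r (cl {x, y}) = 2" "cl {x, y} \<subseteq> G" if "y \<in> F" for y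
  proof -
    have "x \<noteq> y" using that x(2) by auto
    then show "cl {x, y} \<in> L" "r (cl {x, y}) = 2" using line_cl[OF P(1) P(2)[OF that]] by auto
    show "cl {x, y} \<subseteq> G" using x that FL by (intro cl_least) auto
  qed
  have inj: "y = y'" if y: "y \<in> F" "y' \<in> F" and eq: "cl {x, y} = cl {x, y'}" for y y'
  proof -
    obtain s where "F \<inter> cl {x, y} = {s}"
      using line_meets[OF F line[OF y(1)]] x(2) cl_pair_left[of x y] by blast
    moreover have "y \<in> F \<inter> cl {x, y}" "y' \<in> F \<inter> cl {x, y}"
      using y cl_pair_right[of y x] cl_pair_right[of y' x] eq by auto
    ultimately show ?thesis by (metis singletonD)
  qed
  have surj: "\<exists>y\<in>F. l = cl {x, y}" if l: "l \<in> L" "x \<in> l" "l \<subseteq> G" "r l = 2" for l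
  proof -
    obtain s where s: "F \<inter> l = {s}" using line_meets[OF F l(1,4,3)] x l by blast
    then have "s \<in> l" "s \<in> F" by auto
    then have "cl {x, s} = l" using x by (intro line_eq[OF l(1,4,2)]) auto
    then show ?thesis using \<open>s \<in> F\<close> by blast
  qed
  show "bij_betw (\<lambda>y. cl {x, y}) F {l \<in> L. x \<in> l \<and> l \<subseteq> G \<and> r l = 2}"
  proof (rule bij_betwI')
    show "cl {x, y} = cl {x, y'} \<longleftrightarrow> y = y'" if "y \<in> F" "y' \<in> F" for y y'
      using inj[OF that] by auto
    show "cl {x, y} \<in> {l \<in> L. x \<in> l \<and> l \<subseteq> G \<and> r l = 2}" if "y \<in> F" for y
      using line[OF that] cl_pair_left[of x y] by simp
    show "\<exists>y\<in>F. l = cl {x, y}" if "l \<in> {l \<in> L. x \<in> l \<and> l \<subseteq> G \<and> r l = 2}" for l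
      using surj that by simp
  qed
qed

lemma card_hyperplane_eq:
  "cover F G \<Longrightarrow> cover F' G \<Longrightarrow> x \<in> G \<Longrightarrow> x \<notin> F \<Longrightarrow> x \<notin> F' \<Longrightarrow> card F = card F'"
  using card_hyperplane[of F G x] card_hyperplane[of F' G x] by simp

lemma cover_Diff_pos: "cover F G \<Longrightarrow> card (G - F) > 0"
  using cover_ex[of F G] finite_flat[of G] by (auto simp: card_gt_0_iff cover_def)

text \<open>If a point of G avoids both hyperplanes, they have equal size and the factors agree one
  by one. Otherwise G is their union, so G - F and G - F' are the increments of F' and F over the
  meet, and both products consist of the same two numbers.\<close>

lemma diamond_weight:
  assumes F: "cover F G" "cover F' G" "F \<noteq> F'"
  shows "card (G - F) * card (F - F \<inter> F') = card (G - F') * card (F' - F \<inter> F')"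
proof (cases "\<exists>x\<in>G. x \<notin> F \<and> x \<notin> F'")
  case True
  then have "card F = card F'" using card_hyperplane_eq[OF F(1,2)] by auto
  moreover have "finite F" "finite F'" "F \<subseteq> G" "F' \<subseteq> G" using F finite_flat by (auto simp: cover_def)
  ultimately show ?thesis by (simp add: card_Diff_subset)
next
  case False
  then have "G - F = F' - F \<inter> F'" "G - F' = F - F \<inter> F'" using F by (auto simp: cover_def)
  then show ?thesis by simp
qed

text \<open>Two such distinct lines are hyperplanes of the plane they span. As s and t are
  perspective, the line st has a third point; it lies on neither line, so projection from it equates
  their sizes.\<close>

lemma card_line_eq:
  assumes c: "c \<in> C" and p: "p \<in> c" "s \<in> c" "t \<in> c" "p \<noteq> s" "p \<noteq> t"
  shows "card (cl {p, s}) = card (cl {p, t})"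
proof (cases "t \<in> cl {p, s}")
  have P: "p \<in> P" "s \<in> P" "t \<in> P" using p C_sub[OF c] by auto
  case True
  then have "cl {p, t} = cl {p, s}"
    using line_eq[OF line_cl[OF P(1,2)], of p t] p True cl_pair_left by blast
  then show ?thesis by simp
next
  have P: "p \<in> P" "s \<in> P" "t \<in> P" using p C_sub[OF c] by auto
  case False
  let ?l = "cl {p, s}" and ?m = "cl {p, t}" and ?n = "cl {s, t}"
  note m = cl_pair_left cl_pair_right
  have st: "s \<noteq> t" using False m by metis
  have L: "?l \<in> L" "r ?l = 2" "?m \<in> L" "r ?m = 2" "?n \<in> L" "r ?n = 2"
    using line_cl P p st by auto
  have "persp s t" using C_eq[OF c p(2)] p(3) by (auto simp: cls_def)
  then obtain x where x: "x \<in> ?n" "x \<noteq> s" "x \<noteq> t" using st by (auto simp: persp_def)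
  let ?G = "cl (insert t ?l)"
  have G: "cover ?l ?G" using cover_insert[OF L(1) P(3) False] .
  then have GL: "?G \<in> L" by (simp add: cover_def)
  have lG: "?l \<subseteq> ?G" "t \<in> ?G" using cl_super by blast+
  have mG: "?m \<subseteq> ?G" "?n \<subseteq> ?G" using lG m[of p s] m[of s p] by (auto intro!: cl_least[OF GL])
  have G': "cover ?m ?G" using G L mG by (auto simp: cover_def)
  have "x \<notin> ?l"
  proof
    assume "x \<in> ?l"
    then have "?l = ?n" using lines_eq[OF L(1,2,5,6), of x s] x m by blast
    then show False using False m by metis
  qed
  moreover have "x \<notin> ?m"
  proof
    assume "x \<in> ?m"
    then have "?m = ?n" using lines_eq[OF L(3,4,5,6), of x t] x m by blast
    then have "?m = ?l" using lines_eq[OF L(3,4,1,2), of p s] p m by metis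
    then show False using False m by metis
  qed
  ultimately show ?thesis using card_hyperplane_eq[OF G G'] x mG by auto
qed

lemma line_ex2:
  assumes "l \<in> L" "r l = 2" obtains p s where "p \<in> l" "s \<in> l" "p \<noteq> s"
proof -
  obtain K where K: "cover K l" using lower_cover_ex[of l] assms r_empty by fastforce
  then obtain p where p: "p \<in> l" "p \<notin> K" by (rule cover_ex)
  have "K \<noteq> {}" using K assms r_empty by (auto simp: cover_def)
  then show ?thesis using that p K by (auto simp: cover_def)
qed

text \<open>Each line is compared with a line joining a point of l to a point of l'.\<close>

lemma card_lines_eq:
  assumes c: "c \<in> C" and l: "l \<in> L" "r l = 2" "l \<subseteq> c" and l': "l' \<in> L" "r l' = 2" "l' \<subseteq> c"
  shows "card l = card l'"
proof -
  obtain p s where p: "p \<in> l" "s \<in> l" "p \<noteq> s" using line_ex2 l by blast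
  obtain p' s' where p': "p' \<in> l'" "s' \<in> l'" "p' \<noteq> s'" using line_ex2 l' by blast
  have eq: "l = cl {p, s}" "l' = cl {p', s'}" using line_eq l l' p p' by auto
  show ?thesis
  proof (cases "p = p'")
    case True
    then show ?thesis using card_line_eq[OF c, of p s s'] p p' l l' unfolding eq by blast
  next
    case False
    have "card l = card (cl {p, p'})" using card_line_eq[OF c, of p s p'] p p' l l' False unfolding eq(1)
      by blast
    also have "\<dots> = card l'" using card_line_eq[OF c, of p' p s'] p p' l l' False unfolding eq(2)
      by (metis insert_commute subsetD)
    finally show ?thesis .
  qed
qed

text \<open>The order of the component: its lines have q + 1 points. A class without lines has rank
  1, where only [0] and [1] occur; these are the same for all q, and the default 1 meets the bound
  in \<open>q_pos\<close>.\<close>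

definition q :: "'p set \<Rightarrow> nat" where
  "q c = (if \<exists>l\<in>L. r l = 2 \<and> l \<subseteq> c then card (SOME l. l \<in> L \<and> r l = 2 \<and> l \<subseteq> c) - 1 else 1)"

lemma card_line:
  assumes c: "c \<in> C" and l: "l \<in> L" "r l = 2" "l \<subseteq> c"
  shows "card l = Suc (q c)"
proof -
  let ?Q = "\<lambda>l. l \<in> L \<and> r l = 2 \<and> l \<subseteq> c"
  have "?Q (SOME l. ?Q l)" using someI[of ?Q l] l by blast
  then have "card (SOME l. ?Q l) = card l" using card_lines_eq[OF c _ _ _ l] by blast
  then have "q c = card l - 1" using l by (auto simp: q_def)
  moreover have "card l > 0" using l finite_flat r_empty by (auto simp: card_gt_0_iff)
  ultimately show ?thesis by simp
qed

lemma q_pos: assumes c: "c \<in> C" shows "q c \<ge> 1"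
proof (cases "\<exists>l\<in>L. r l = 2 \<and> l \<subseteq> c")
  case True
  then obtain l where l: "l \<in> L" "r l = 2" "l \<subseteq> c" by auto
  obtain p s where p: "p \<in> l" "s \<in> l" "p \<noteq> s" using line_ex2 l by blast
  then have "card {p, s} \<le> card l" using finite_flat[OF l(1)] by (intro card_mono) auto
  then show ?thesis using card_line[OF c l] p by simp
next
  case False
  then show ?thesis unfolding q_def by (simp only: if_False)
qed

section \<open>Intervals of length two\<close>

definition mid :: "'p set \<Rightarrow> 'p set \<Rightarrow> 'p set set" where
  "mid K G = {F. cover K F \<and> cover F G}"

lemma finite_mid: "finite (mid K G)"
  by (rule finite_subset[OF _ finite_L]) (auto simp: mid_def cover_def)

lemma mid_ex2:
  assumes "cover K F" "cover F G" obtains F' where "F' \<in> mid K G" "F' \<noteq> F"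
proof -
  obtain p where p: "p \<in> G" "p \<notin> F" using cover_ex[OF assms(2)] .
  have K: "K \<in> L" "p \<in> P" "p \<notin> K" using p assms L_sub by (auto simp: cover_def)
  let ?F = "cl (insert p K)"
  have F': "cover K ?F" using cover_insert K by auto
  moreover have pF: "p \<in> ?F" using cl_super by blast
  moreover have "?F \<subseteq> G" using p assms by (intro cl_least) (auto simp: cover_def)
  ultimately have "cover ?F G" "?F \<noteq> F" using assms p by (auto simp: cover_def)
  then show ?thesis using that F' by (auto simp: mid_def)
qed

text \<open>The line through a point of F - K and a point of G - F misses K and together with K
  spans G. Each middle flat meets it in one point and is the span of K and that point, so there are
  as many middle flats as points on the line.\<close>

lemma mid_same:
  assumes c: "c \<in> C" and K: "cov c K F" "cov c F G" shows "card (mid K G) = Suc (q c)"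
proof -
  have KL: "K \<in> L" "G \<in> L" "K \<subseteq> F" "F \<subseteq> G" "F \<in> L" "r G = r K + 2" using K by (auto simp: cov_def cover_def)
  obtain s where s: "s \<in> F" "s \<notin> K" using cover_ex cov_cover[OF K(1)] by blast
  obtain t where t: "t \<in> G" "t \<notin> F" using cover_ex cov_cover[OF K(2)] by blast
  have st: "s \<noteq> t" "s \<in> P" "t \<in> P" using s t KL L_sub by auto
  let ?l = "cl {s, t}"
  have l: "?l \<in> L" "r ?l = 2" using line_cl st by auto
  have sc: "s \<in> c" "t \<in> c" using s t K KL by (auto simp: cov_def)
  then have lc: "?l \<subseteq> c" using class_L[OF c] by (intro cl_least) auto
  have lG: "?l \<subseteq> G" using s t KL by (intro cl_least) auto
  have "G \<subseteq> cl (K \<union> ?l)"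
  proof -
    have 1: "F \<subseteq> cl (K \<union> ?l)"
      using cover_cl[OF cov_cover[OF K(1)] s] cl_mono[of "insert s K" "K \<union> ?l"] cl_pair_left[of s t] by auto
    have "insert t F \<subseteq> cl (K \<union> ?l)" using 1 cl_super[of "K \<union> ?l"] cl_pair_right[of t s] by auto
    then have "cl (insert t F) \<subseteq> cl (K \<union> ?l)" using join_L[OF KL(1) l(1)] by (intro cl_least)
    then show ?thesis using cover_cl[OF cov_cover[OF K(2)] t] by simp
  qed
  moreover have "cl (K \<union> ?l) \<subseteq> G" using KL lG by (intro cl_least) auto
  ultimately have join: "cl (K \<union> ?l) = G" by auto
  have "r (K \<inter> ?l) = 0" using modular_cl[OF KL(1) l(1)] l KL join by simp
  then have disj: "K \<inter> ?l = {}"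
    using r_strict[of "{}" "K \<inter> ?l"] empty_L Int_L[OF KL(1) l(1)]
      by (metis empty_subsetI less_nat_zero_code psubsetI)
  have "bij_betw (\<lambda>x. cl (insert x K)) ?l (mid K G)"
    unfolding bij_betw_def
  proof (intro conjI inj_onI equalityI subsetI)
    have xP: "x \<in> P" "x \<notin> K" if "x \<in> ?l" for x using that disj l L_sub by auto
    have cov: "cover K (cl (insert x K))" if "x \<in> ?l" for x using cover_insert[OF KL(1) xP[OF that]] .
    have xin: "x \<in> cl (insert x K)" for x using cl_super by blast
    fix x y assume x: "x \<in> ?l" "y \<in> ?l" and eq: "cl (insert x K) = cl (insert y K)"
    show "x = y"
    proof (rule ccontr)
      assume "x \<noteq> y"
      then have "cl {x, y} = ?l" by (rule line_eq[OF l x])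
      moreover have "cl {x, y} \<subseteq> cl (insert x K)" using xin[of x] xin[of y] eq cov[OF x(1)]
        by (intro cl_least) (auto simp: cover_def)
      ultimately have "K \<union> ?l \<subseteq> cl (insert x K)" using cov[OF x(1)] by (auto simp: cover_def)
      then have "cl (K \<union> ?l) \<subseteq> cl (insert x K)" using cov[OF x(1)] by (intro cl_least) (auto simp: cover_def)
      then have "r G \<le> r (cl (insert x K))" using join KL cov[OF x(1)]
        by (intro r_mono) (auto simp: cover_def)
      then show False using cov[OF x(1)] KL by (auto simp: cover_def)
    qed
  next
    fix H assume "H \<in> (\<lambda>x. cl (insert x K)) ` ?l"
    then obtain x where x: "x \<in> ?l" "H = cl (insert x K)" by auto
    then have "x \<in> P" "x \<notin> K" using disj l L_sub by auto
    then have "cover K H" using cover_insert[OF KL(1)] x by auto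
    moreover have "H \<subseteq> G" unfolding x(2) using x(1) lG KL by (intro cl_least) auto
    ultimately show "H \<in> mid K G" using KL by (auto simp: mid_def cover_def)
  next
    fix H assume "H \<in> mid K G"
    then have H: "cover K H" "cover H G" by (auto simp: mid_def)
    have "\<not> ?l \<subseteq> H"
    proof
      assume "?l \<subseteq> H"
      then have "cl (K \<union> ?l) \<subseteq> H" using H by (intro cl_least) (auto simp: cover_def)
      then have "r G \<le> r H" using join H r_mono by (auto simp: cover_def)
      then show False using H by (auto simp: cover_def)
    qed
    then obtain x where x: "H \<inter> ?l = {x}" using line_meets[OF H(2) l lG] by auto
    then have "H = cl (insert x K)" using cover_cl[OF H(1), of x] disj by blast
    then show "H \<in> (\<lambda>x. cl (insert x K)) ` ?l" using x by blast
  qed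
  from bij_betw_same_card[OF this] show ?thesis using card_line[OF c l lc] by simp
qed

text \<open>The points of G missing from F' lie in c and those missing from F in c'. Distinct
  classes are disjoint, so no point is missing from both.\<close>

lemma mid_union:
  assumes c: "c \<in> C" "c' \<in> C" "c \<noteq> c'" and K: "cov c K F" "cov c' F G"
    and F': "F' \<in> mid K G" "F' \<noteq> F"
  shows "F \<union> F' = G" "F \<inter> F' = K"
proof -
  have cF: "cover K F" "cover F G" "cover K F'" "cover F' G" using K F' by (auto simp: cov_def mid_def)
  show K': "F \<inter> F' = K" using cover_join(1)[OF cF(1,3)] F' by auto
  obtain p where p: "p \<in> F" "p \<notin> F'" using cover_neqD[OF cF(4,2)] F' by auto
  have "p \<in> c" using p K cF K' by (auto simp: cov_def)
  then have "cov c F' G" using covI[OF cF(4), of p c] p c cF by (auto simp: cover_def)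
  then have "x \<in> c" if "x \<in> G" "x \<notin> F'" for x using that by (auto simp: cov_def)
  moreover have "x \<in> c'" if "x \<in> G" "x \<notin> F" for x using that K by (auto simp: cov_def)
  ultimately have "G \<subseteq> F \<union> F'" using C_disjoint[OF c(1,2)] c(3) by auto
  then show "F \<union> F' = G" using cF by (auto simp: cover_def)
qed

text \<open>The interval is a square: steps of different classes can be taken in either order. The
  explicit form of the fourth corner makes the exchange of the two middle flats an involution on
  sets.\<close>

lemma cov_swap:
  assumes c: "c \<in> C" "c' \<in> C" "c \<noteq> c'" and K: "cov c K F" "cov c' F G"
  shows "cov c' K (K \<union> (G - F))" "cov c (K \<union> (G - F)) G"
    "mid K G = {F, K \<union> (G - F)}" "F \<noteq> K \<union> (G - F)"
proof -
  have KF: "K \<subseteq> F" "F \<subseteq> G" using K by (auto simp: cov_def cover_def)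
  obtain F' where F': "F' \<in> mid K G" "F' \<noteq> F" using mid_ex2 K cov_cover by metis
  have eq: "X = K \<union> (G - F)" if "X \<in> mid K G" "X \<noteq> F" for X
    using mid_union[OF c K that] that by (auto simp: mid_def cover_def)
  have Fm: "F \<in> mid K G" using K by (auto simp: mid_def cov_def)
  show "mid K G = {F, K \<union> (G - F)}" using eq F' Fm by auto
  have F'e: "F' = K \<union> (G - F)" using eq F' .
  then show "F \<noteq> K \<union> (G - F)" using F' by auto
  show "cov c' K (K \<union> (G - F))" "cov c (K \<union> (G - F)) G"
    using F' K KF unfolding F'e[symmetric] unfolding cov_def mid_def using F'e by auto
qed

lemma mid_diff:
  "c \<in> C \<Longrightarrow> c' \<in> C \<Longrightarrow> c \<noteq> c' \<Longrightarrow> cov c K F \<Longrightarrow> cov c' F G \<Longrightarrow> card (mid K G) = 2"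
  using cov_swap(3,4)[of c c' K F G] by simp

text \<open>A point of F outside F' is gained both from F' to G and from F \<inter> F' to F, so
  opposite sides of a diamond have the same class.\<close>

lemma cov_meet:
  assumes "c \<in> C" "cov c F' G" "cover F G" "F \<noteq> F'"
  shows "cov c (F \<inter> F') F"
proof -
  obtain p where p: "p \<in> F" "p \<notin> F'" using cover_neqD[OF cov_cover[OF assms(2)] assms(3)] assms(4) by blast
  then have "p \<in> c" using assms by (auto simp: cov_def cover_def)
  then show ?thesis
    using covI[OF cover_meet(1)[OF assms(3) cov_cover[OF assms(2)] assms(4)], of p] p assms(1) by auto
qed

lemma cov_join:
  assumes "c \<in> C" "cov c K F" "cover K F'" "F \<noteq> F'"
  shows "cov c F' (cl (F \<union> F'))"
proof -
  obtain p where p: "p \<in> F" "p \<notin> F'" using cover_neqD'[OF assms(3) cov_cover[OF assms(2)]] assms(4) by blast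
  moreover have "p \<in> cl (F \<union> F')" using p cl_super by blast
  moreover have "p \<in> c" using p assms by (auto simp: cov_def cover_def)
  ultimately show ?thesis
    using covI[OF cover_join(3)[OF cov_cover[OF assms(2)] assms(3,4)], of p] assms(1) by auto
qed

section \<open>The number of coverings of a class at a flat\<close>

definition dn_count :: "'p set \<Rightarrow> 'p set \<Rightarrow> nat" where "dn_count c G = card {F. cov c F G}"
definition up_count :: "'p set \<Rightarrow> 'p set \<Rightarrow> nat" where "up_count c F = card {G. cov c F G}"

lemma finite_cov: "finite {F. cov c F G}" "finite {G. cov c F G}"
  by (rule finite_subset[OF _ finite_L]; auto simp: cov_def cover_def)+

text \<open>The class-c hyperplanes F' \<noteq> F of G are sorted by K = F \<inter> F', which is a
  class-c hyperplane of F. Over each K lie the middle flats between K and G other than F: q c of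
  them if the classes agree, a single one otherwise. For equal classes F itself adds 1, and the
  recursion is that of \<open>qint\<close>.\<close>

lemma dn_count_step:
  assumes c: "c \<in> C" "c' \<in> C" and F: "cov c' F G"
  shows "dn_count c G = (if c = c' then 1 + q c * dn_count c F else dn_count c F)"
proof -
  let ?m = "if c = c' then q c else 1"
  have "{F'. cov c F' G} - {F} = (\<Union>K\<in>{K. cov c K F}. mid K G - {F})"
  proof (intro equalityI subsetI)
    fix F' assume "F' \<in> {F'. cov c F' G} - {F}"
    then have F': "cov c F' G" "F \<noteq> F'" by auto
    show "F' \<in> (\<Union>K\<in>{K. cov c K F}. mid K G - {F})"
      using cov_meet[OF c(1) F'(1) cov_cover[OF F] F'(2)] F'
        cover_meet(2)[OF cov_cover[OF F] cov_cover[OF F'(1)] F'(2)] cov_cover[OF F'(1)]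
      by (intro UN_I[of "F \<inter> F'"]) (auto simp: mid_def)
  next
    fix F' assume "F' \<in> (\<Union>K\<in>{K. cov c K F}. mid K G - {F})"
    then obtain K where K: "cov c K F" "cover K F'" "cover F' G" "F \<noteq> F'" by (auto simp: mid_def)
    have "cl (F \<union> F') = G" using cover_meet(3) cov_cover[OF F] K by auto
    then show "F' \<in> {F'. cov c F' G} - {F}" using cov_join[OF c(1) K(1,2,4)] K by auto
  qed
  moreover have "card (\<Union>K\<in>{K. cov c K F}. mid K G - {F}) = (\<Sum>K\<in>{K. cov c K F}. card (mid K G - {F}))"
  proof (rule card_UN_disjoint)
    show "\<forall>K\<in>{K. cov c K F}. \<forall>K'\<in>{K. cov c K F}. K \<noteq> K' \<longrightarrow> (mid K G - {F}) \<inter> (mid K' G - {F}) = {}"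
      using cover_join(1) by (auto simp: mid_def cov_def) metis+
  qed (auto simp: finite_cov finite_mid)
  moreover have "card (mid K G - {F}) = ?m" if K: "cov c K F" for K
  proof -
    have "F \<in> mid K G" using K F by (auto simp: mid_def cov_def)
    then have "card (mid K G - {F}) = card (mid K G) - 1" by simp
    then show ?thesis using mid_same[OF c(1) K] mid_diff[OF c _ K F] F by auto
  qed
  ultimately have *: "card ({F'. cov c F' G} - {F}) = ?m * dn_count c F"
    by (simp add: dn_count_def)
  show ?thesis
  proof (cases "c = c'")
    case True
    then have "F \<in> {F'. cov c F' G}" using F by auto
    from card.remove[OF finite_cov(1) this] show ?thesis using * True by (simp add: dn_count_def)
  next
    case False
    then have "{F'. cov c F' G} - {F} = {F'. cov c F' G}" using cov_unique[OF _ F c] by auto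
    then show ?thesis using * False by (simp add: dn_count_def)
  qed
qed

text \<open>Dual count: the covers G' \<noteq> G of F are sorted by their join with G.\<close>

lemma up_count_step:
  assumes c: "c \<in> C" "c' \<in> C" and F: "cov c' F G"
  shows "up_count c F = (if c = c' then 1 + q c * up_count c G else up_count c G)"
proof -
  let ?m = "if c = c' then q c else 1"
  have "{G'. cov c F G'} - {G} = (\<Union>H\<in>{H. cov c G H}. mid F H - {G})"
  proof (intro equalityI subsetI)
    fix G' assume "G' \<in> {G'. cov c F G'} - {G}"
    then have G': "cov c F G'" "G' \<noteq> G" by auto
    show "G' \<in> (\<Union>H\<in>{H. cov c G H}. mid F H - {G})"
      using cov_join[OF c(1) G'(1) cov_cover[OF F] G'(2)] G'
        cover_join(2)[OF cov_cover[OF G'(1)] cov_cover[OF F] G'(2)] cov_cover[OF G'(1)]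
      by (intro UN_I[of "cl (G' \<union> G)"]) (auto simp: mid_def)
  next
    fix G' assume "G' \<in> (\<Union>H\<in>{H. cov c G H}. mid F H - {G})"
    then obtain H where H: "cov c G H" "cover F G'" "cover G' H" "G' \<noteq> G" by (auto simp: mid_def)
    have "G' \<inter> G = F" using cover_join(1) cov_cover[OF F] H by auto
    then show "G' \<in> {G'. cov c F G'} - {G}" using cov_meet[OF c(1) H(1,3,4)] H by auto
  qed
  moreover have "card (\<Union>H\<in>{H. cov c G H}. mid F H - {G}) = (\<Sum>H\<in>{H. cov c G H}. card (mid F H - {G}))"
  proof (rule card_UN_disjoint)
    show "\<forall>H\<in>{H. cov c G H}. \<forall>H'\<in>{H. cov c G H}. H \<noteq> H' \<longrightarrow> (mid F H - {G}) \<inter> (mid F H' - {G}) = {}"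
      using cover_meet(3) by (auto simp: mid_def cov_def) metis+
  qed (auto simp: finite_cov finite_mid)
  moreover have "card (mid F H - {G}) = ?m" if H: "cov c G H" for H
  proof -
    have "G \<in> mid F H" using H F by (auto simp: mid_def cov_def)
    then have "card (mid F H - {G}) = card (mid F H) - 1" by simp
    then show ?thesis using mid_same[OF c(1) _ H] mid_diff[OF c(2,1) _ F H] F by auto
  qed
  ultimately have *: "card ({G'. cov c F G'} - {G}) = ?m * up_count c G"
    by (simp add: up_count_def)
  show ?thesis
  proof (cases "c = c'")
    case True
    then have "G \<in> {G'. cov c F G'}" using F by auto
    from card.remove[OF finite_cov(2) this] show ?thesis using * True by (simp add: up_count_def)
  next
    case False
    then have "{G'. cov c F G'} - {G} = {G'. cov c F G'}" using cov_unique[OF _ F c] by auto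
    then show ?thesis using * False by (simp add: up_count_def)
  qed
qed

lemma dn_count_eq: "c \<in> C \<Longrightarrow> F \<in> L \<Longrightarrow> dn_count c F = qint (q c) (rho c F)"
proof (induction "r F" arbitrary: F)
  case 0
  then have "F = {}" using rank_zero[OF 0(3) 0(1)[symmetric]] by blast
  moreover have "{K. cov c K {}} = {}" by (auto simp: cov_def cover_def r_empty)
  ultimately show ?case by (simp add: rho_def r_empty dn_count_def)
next
  case (Suc m F)
  then have "F \<noteq> {}" using r_empty by auto
  then obtain K where K: "cover K F" using lower_cover_ex[OF Suc.prems(2)] by blast
  then obtain c' where c': "c' \<in> C" "cov c' K F" using cov_ex by blast
  have KL: "K \<in> L" "m = r K" using K Suc.hyps(2) by (auto simp: cover_def)
  have *: "dn_count c K = qint (q c) (rho c K)" using Suc.hyps(1)[OF KL(2) Suc.prems(1) KL(1)] .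
  then show ?case
    using dn_count_step[OF Suc.prems(1) c'] cov_rho[OF c'] cov_rho'[OF c'(1) Suc.prems(1) _ c'(2)]
    by (cases "c = c'") auto
qed

text \<open>Induction downwards from P, which has no covers and meets c in all of c.\<close>

lemma up_count_eq: "c \<in> C \<Longrightarrow> F \<in> L \<Longrightarrow> up_count c F = qint (q c) (r c - rho c F)"
proof (induction "r P - r F" arbitrary: F)
  case 0
  have "r F \<le> r P" using r_mono[OF 0(3) P_L] L_sub 0 by auto
  then have F: "F = P" using r_eqD[OF 0(3) P_L L_sub[OF 0(3)]] 0 by auto
  have "{G. cov c P G} = {}"
  proof (rule ccontr)
    assume "{G. cov c P G} \<noteq> {}"
    then obtain G where "cover P G" by (auto simp: cov_def)
    then show False using cover_ex[of P G] L_sub[of G] by (auto simp: cover_def)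
  qed
  moreover have "P \<inter> c = c" using C_sub[OF 0(2)] by auto
  ultimately show ?case by (simp add: F rho_def up_count_def)
next
  case (Suc m F)
  then have "F \<noteq> P" by auto
  then obtain p where p: "p \<in> P" "p \<notin> F" using L_sub[OF Suc.prems(2)] by auto
  then have G: "cover F (cl (insert p F))" using cover_insert[OF Suc.prems(2)] by blast
  let ?G = "cl (insert p F)"
  obtain c' where c': "c' \<in> C" "cov c' F ?G" using cov_ex[OF G] by auto
  have GL: "?G \<in> L" and m: "m = r P - r ?G" using G Suc.hyps(2) by (auto simp: cover_def)
  have *: "up_count c ?G = qint (q c) (r c - rho c ?G)" using Suc.hyps(1)[OF m Suc.prems(1) GL] .
  show ?case
  proof (cases "c = c'")
    case True
    then have 1: "rho c ?G = Suc (rho c F)" using cov_rho[OF c'] by simp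
    then have "r c - rho c F = Suc (r c - rho c ?G)" using rho_le[OF Suc.prems(1) GL] by simp
    then show ?thesis using up_count_step[OF Suc.prems(1) c'] True * by simp
  next
    case False
    then show ?thesis using up_count_step[OF Suc.prems(1) c'] * cov_rho'[OF c'(1) Suc.prems(1) _ c'(2)]
      by simp
  qed
qed

subsection \<open>The raising and lowering operators\<close>

definition upk :: "'p set \<Rightarrow> 'p set \<Rightarrow> 'p set \<Rightarrow> 'k::field_char_0" where
  "upk c F G = (if cov c F G then of_nat (card (G - F)) else 0)"

definition dnk :: "'p set \<Rightarrow> 'p set \<Rightarrow> 'p set \<Rightarrow> 'k::field_char_0" where
  "dnk c G F = (if cov c F G then inverse (of_nat (card (G - F))) else 0)"

lemma lin_upk: "lin L (upk c) f G = (\<Sum>F\<in>{F. cov c F G}. of_nat (card (G - F)) * f F)"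
  unfolding lin_def
  by (rule sum.mono_neutral_cong_right) (auto simp: finite_L upk_def cov_def cover_def)

lemma lin_dnk: "lin L (dnk c) f F = (\<Sum>G\<in>{G. cov c F G}. inverse (of_nat (card (G - F))) * f G)"
  unfolding lin_def
  by (rule sum.mono_neutral_cong_right) (auto simp: finite_L dnk_def cov_def cover_def)

lemma swap_sets:
  assumes "K \<subseteq> F" "F \<subseteq> G"
  shows "G - (K \<union> (G - F)) = F - K" "(K \<union> (G - F)) - K = G - F" "K \<union> (G - (K \<union> (G - F))) = F"
  using assms by auto

lemma cov_sub: "cov c F G \<Longrightarrow> F \<subseteq> G"
  by (simp add: cov_def cover_def)

text \<open>Chains K < F < G with steps of different classes are paired by passing to the other
  corner of the square. This interchanges the increments F - K and G - F, so the product of the two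
  weights is unchanged.\<close>

lemma upk_commute:
  assumes c: "c \<in> C" "c' \<in> C" "c \<noteq> c'"
  shows "lin L (upk c) (lin L (upk c') f) = lin L (upk c') (lin L (upk c) f)"
proof
  fix G
  let ?S = "\<lambda>c c'. SIGMA F:{F. cov c F G}. {K. cov c' K F}"
  let ?g = "\<lambda>(F, K). of_nat (card (G - F)) * (of_nat (card (F - K)) * f K)"
  let ?i = "\<lambda>(F, K). (K \<union> (G - F), K)"
  have *: "lin L (upk c) (lin L (upk c') f) G = sum ?g (?S c c')" for c c'
    by (simp add: lin_upk sum_distrib_left sum.Sigma finite_cov)
  have i: "?i a \<in> ?S c' c \<and> ?i (?i a) = a \<and> ?g (?i a) = ?g a"
    if a': "a \<in> ?S c c'" and that: "c \<in> C" "c' \<in> C" "c \<noteq> c'" for a c c'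
  proof -
    obtain F K where a: "a = (F, K)" "cov c F G" "cov c' K F" using a' by auto
    from cov_swap(1,2)[OF that(2,1) that(3)[symmetric] a(3,2)] show ?thesis
      using swap_sets[OF cov_sub[OF a(3)] cov_sub[OF a(2)]] by (simp add: a)
  qed
  note i1 = i[OF _ c] and i2 = i[OF _ c(2,1) c(3)[symmetric]]
  have "sum ?g (?S c c') = sum ?g (?S c' c)"
    by (rule sum.reindex_bij_witness[of _ ?i ?i])
      (erule i1[THEN conjunct2, THEN conjunct1] i1[THEN conjunct1] i2[THEN conjunct2, THEN conjunct1]
        i2[THEN conjunct1] i1[THEN conjunct2, THEN conjunct2])+
  then show "lin L (upk c) (lin L (upk c') f) G = lin L (upk c') (lin L (upk c) f) G"
    by (simp only: *)
qed

lemma dnk_commute: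
  assumes c: "c \<in> C" "c' \<in> C" "c \<noteq> c'"
  shows "lin L (dnk c) (lin L (dnk c') f) = lin L (dnk c') (lin L (dnk c) f)"
proof
  fix K
  let ?S = "\<lambda>c c'. SIGMA F:{F. cov c K F}. {G. cov c' F G}"
  let ?g = "\<lambda>(F, G). inverse (of_nat (card (F - K))) * (inverse (of_nat (card (G - F))) * f G)"
  let ?i = "\<lambda>(F, G). (K \<union> (G - F), G)"
  have *: "lin L (dnk c) (lin L (dnk c') f) K = sum ?g (?S c c')" for c c'
    by (simp add: lin_dnk sum_distrib_left sum.Sigma finite_cov)
  have i: "?i a \<in> ?S c' c \<and> ?i (?i a) = a \<and> ?g (?i a) = ?g a"
    if a': "a \<in> ?S c c'" and that: "c \<in> C" "c' \<in> C" "c \<noteq> c'" for a c c'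
  proof -
    obtain F G where a: "a = (F, G)" "cov c K F" "cov c' F G" using a' by auto
    from cov_swap(1,2)[OF that a(2,3)] show ?thesis
      using swap_sets[OF cov_sub[OF a(2)] cov_sub[OF a(3)]] by (simp add: a)
  qed
  note i1 = i[OF _ c] and i2 = i[OF _ c(2,1) c(3)[symmetric]]
  have "sum ?g (?S c c') = sum ?g (?S c' c)"
    by (rule sum.reindex_bij_witness[of _ ?i ?i])
      (erule i1[THEN conjunct2, THEN conjunct1] i1[THEN conjunct1] i2[THEN conjunct2, THEN conjunct1]
        i2[THEN conjunct1] i1[THEN conjunct2, THEN conjunct2])+
  then show "lin L (dnk c) (lin L (dnk c') f) K = lin L (dnk c') (lin L (dnk c) f) K"
    by (simp only: *)
qed

text \<open>For F' \<noteq> F the path from F' up to the join and down to F is paired with the path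
  down to the meet and up to F; \<open>diamond_weight\<close> says that both have the same weight.
  Only the round trips starting at F remain. Each has weight 1, and their numbers give the
  scalar.\<close>

lemma dnk_upk:
  fixes f :: "'p set \<Rightarrow> 'k::field_char_0"
  assumes c: "c \<in> C" "c' \<in> C"
  shows "lin L (dnk c) (lin L (upk c') f) F = lin L (upk c') (lin L (dnk c) f) F +
    (if c = c' then (of_nat (up_count c F) - of_nat (dn_count c F)) * f F else 0)"
proof -
  let ?A = "SIGMA G:{G. cov c F G}. {F'. cov c' F' G}"
  let ?B = "SIGMA K:{K. cov c' K F}. {F'. cov c K F'}"
  let ?g = "\<lambda>(G, F'). inverse (of_nat (card (G - F))) * (of_nat (card (G - F')) * f F')"
  let ?h = "\<lambda>(K, F'). of_nat (card (F - K)) * (inverse (of_nat (card (F' - K))) * f F')"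
  have finA: "finite ?A" and finB: "finite ?B" by (auto simp: finite_cov)
  have A: "lin L (dnk c) (lin L (upk c') f) F = sum ?g ?A"
    by (simp add: lin_dnk lin_upk sum_distrib_left sum.Sigma finite_cov)
  have B: "lin L (upk c') (lin L (dnk c) f) F = sum ?h ?B"
    by (simp add: lin_dnk lin_upk sum_distrib_left sum.Sigma finite_cov)
  let ?D = "UNIV \<times> {F}"
  have "sum ?g (?A - ?D) = sum ?h (?B - ?D)"
  proof (rule sum.reindex_bij_witness[of _ "\<lambda>(K, F'). (cl (F \<union> F'), F')" "\<lambda>(G, F'). (F \<inter> F', F')"])
    fix a assume "a \<in> ?A - ?D"
    then obtain G F' where a: "a = (G, F')" "cov c F G" "cov c' F' G" "F \<noteq> F'" by auto
    note cv = cov_cover[OF a(2)] cov_cover[OF a(3)]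
    note m = cover_meet[OF cv a(4)]
    show "(\<lambda>(K, F'). (cl (F \<union> F'), F')) ((\<lambda>(G, F'). (F \<inter> F', F')) a) = a" using m a by simp
    have "cov c (F \<inter> F') F'" using cov_meet[OF c(1) a(2) cv(2)] a(4) by (simp add: Int_commute)
    moreover have "cov c' (F \<inter> F') F" using cov_meet[OF c(2) a(3) cv(1) a(4)] .
    ultimately show "(\<lambda>(G, F'). (F \<inter> F', F')) a \<in> ?B - ?D" using a by auto
    have "(of_nat (card (G - F)) * of_nat (card (F - F \<inter> F')) :: 'k) =
        of_nat (card (G - F')) * of_nat (card (F' - F \<inter> F'))"
      using diamond_weight[OF cv a(4)] by (metis of_nat_mult)
    moreover have "(of_nat (card (G - F)) :: 'k) \<noteq> 0" "(of_nat (card (F' - F \<inter> F')) :: 'k) \<noteq> 0"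
      using cover_Diff_pos[OF cv(1)] cover_Diff_pos[OF m(2)] by auto
    ultimately show "?h ((\<lambda>(G, F'). (F \<inter> F', F')) a) = ?g a"
      by (simp add: a(1) field_simps)
  next
    fix b assume "b \<in> ?B - ?D"
    then obtain K F' where b: "b = (K, F')" "cov c' K F" "cov c K F'" "F \<noteq> F'" by auto
    note cv = cov_cover[OF b(2)] cov_cover[OF b(3)]
    note m = cover_join[OF cv b(4)]
    show "(\<lambda>(G, F'). (F \<inter> F', F')) ((\<lambda>(K, F'). (cl (F \<union> F'), F')) b) = b" using m b by simp
    have "cov c' F' (cl (F \<union> F'))" using cov_join[OF c(2) b(2) cv(2) b(4)] .
    moreover have "cov c F (cl (F \<union> F'))"
      using cov_join[OF c(1) b(3) cv(1)] b(4) by (simp add: Un_commute)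
    ultimately show "(\<lambda>(K, F'). (cl (F \<union> F'), F')) b \<in> ?A - ?D" using b by auto
  qed
  moreover have "sum ?g ?A = sum ?g (?A - ?D) + sum ?g (?A \<inter> ?D)" "sum ?h ?B = sum ?h (?B - ?D) + sum ?h (?B \<inter> ?D)"
    using sum.Int_Diff[OF finA, of ?g ?D] sum.Int_Diff[OF finB, of ?h ?D] by (simp_all add: add.commute)
  moreover have "sum ?g (?A \<inter> ?D) = (if c = c' then of_nat (up_count c F) * f F else 0)"
  proof (cases "c = c'")
    case True
    have "sum ?g (?A \<inter> ?D) = (\<Sum>G\<in>{G. cov c F G}. f F)"
      by (rule sum.reindex_bij_witness[of _ "\<lambda>G. (G, F)" fst])
        (use True cover_Diff_pos in \<open>auto simp: cov_def\<close>)
    then show ?thesis using True by (simp add: up_count_def)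
  next
    case False
    then have "?A \<inter> ?D = {}" using cov_unique c by auto
    then show ?thesis using False by simp
  qed
  moreover have "sum ?h (?B \<inter> ?D) = (if c = c' then of_nat (dn_count c F) * f F else 0)"
  proof (cases "c = c'")
    case True
    have "sum ?h (?B \<inter> ?D) = (\<Sum>K\<in>{K. cov c K F}. f F)"
      by (rule sum.reindex_bij_witness[of _ "\<lambda>K. (K, F)" fst])
        (use True cover_Diff_pos in \<open>auto simp: cov_def\<close>)
    then show ?thesis using True by (simp add: dn_count_def)
  next
    case False
    then have "?B \<inter> ?D = {}" using cov_unique c by auto
    then show ?thesis using False by simp
  qed
  ultimately show ?thesis unfolding A B by (simp add: algebra_simps)
qed

lemma class_rank: "c \<in> C \<Longrightarrow> r c = rho c P"
  using C_sub[of c] by (simp add: rho_def Int_absorb1)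

lemma sl2_up: "sl2_family L C (upk :: _ \<Rightarrow> _ \<Rightarrow> _ \<Rightarrow> 'k::field_char_0) dnk rho r q"
proof
  fix c assume c: "c \<in> C"
  show "1 \<le> q c" by (rule q_pos[OF c])
  show "rho c F \<le> r c" if "F \<in> L" for F by (rule rho_le[OF c that])
  show "x \<in> L \<and> y \<in> L \<and> rho c y = Suc (rho c x)" if "(upk c x y :: 'k) \<noteq> 0" for x y
    using that cov_rho[OF c, of x y] by (auto simp: upk_def cov_def cover_def split: if_splits)
  show "x \<in> L \<and> y \<in> L \<and> rho c y = Suc (rho c x)" if "(dnk c y x :: 'k) \<noteq> 0" for x y
    using that cov_rho[OF c, of x y] by (auto simp: dnk_def cov_def cover_def split: if_splits)
  show "lin L (dnk c) (lin L (upk c) f) x = lin L (upk c) (lin L (dnk c) f) x +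
      (of_nat (qint (q c) (r c - rho c x)) - of_nat (qint (q c) (rho c x))) * f x"
    if "x \<in> L" for x and f :: "'p set \<Rightarrow> 'k"
    using dnk_upk[OF c c, of f x] by (simp add: up_count_eq[OF c that] dn_count_eq[OF c that])
  fix c' assume c': "c' \<in> C"
  show "rho c' y = rho c' x" if "c' \<noteq> c" "(upk c x y :: 'k) \<noteq> 0" for x y
    using that cov_rho'[OF c c', of x y] by (auto simp: upk_def split: if_splits)
  show "rho c' y = rho c' x" if "c' \<noteq> c" "(dnk c y x :: 'k) \<noteq> 0" for x y
    using that cov_rho'[OF c c', of x y] by (auto simp: dnk_def split: if_splits)
  fix f :: "'p set \<Rightarrow> 'k" assume ne: "c \<noteq> c'"
  show "lin L (upk c) (lin L (upk c') f) = lin L (upk c') (lin L (upk c) f)"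
    by (rule upk_commute[OF c c' ne])
  show "lin L (dnk c) (lin L (dnk c') f) = lin L (dnk c') (lin L (dnk c) f)"
    by (rule dnk_commute[OF c c' ne])
  show "lin L (dnk c) (lin L (upk c') f) = lin L (upk c') (lin L (dnk c) f)"
    using dnk_upk[OF c c', of f] ne by auto
qed (use finite_L finite_C in auto)

text \<open>Raising and lowering play symmetric roles once the grading is reversed.\<close>

lemma sl2_dn:
  "sl2_family L C (dnk :: _ \<Rightarrow> _ \<Rightarrow> _ \<Rightarrow> 'k::field_char_0) upk (\<lambda>c F. r c - rho c F) r q"
proof -
  interpret up: sl2_family L C "upk :: _ \<Rightarrow> _ \<Rightarrow> _ \<Rightarrow> 'k" dnk rho r q by (rule sl2_up)
  show ?thesis
  proof
    fix c assume c: "c \<in> C"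
    show "1 \<le> q c" by (rule q_pos[OF c])
    show "y \<in> L \<and> x \<in> L \<and> r c - rho c x = Suc (r c - rho c y)" if "(dnk c y x :: 'k) \<noteq> 0" for x y
      using up.dn_supp[OF c that] rho_le[OF c, of y] by auto
    show "y \<in> L \<and> x \<in> L \<and> r c - rho c x = Suc (r c - rho c y)" if "(upk c x y :: 'k) \<noteq> 0" for x y
      using up.up_supp[OF c that] rho_le[OF c, of y] by auto
    show "lin L (upk c) (lin L (dnk c) f) x = lin L (dnk c) (lin L (upk c) f) x +
        (of_nat (qint (q c) (r c - (r c - rho c x))) - of_nat (qint (q c) (r c - rho c x))) * f x"
      if "x \<in> L" for x and f :: "'p set \<Rightarrow> 'k"
      using up.rel[OF c that, of f] rho_le[OF c that] by (simp add: algebra_simps)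
    fix c' assume c': "c' \<in> C"
    show "r c' - rho c' x = r c' - rho c' y" if "c' \<noteq> c" "(upk c x y :: 'k) \<noteq> 0" for x y
      using up.up_supp'[OF c c' that] by simp
    show "r c' - rho c' x = r c' - rho c' y" if "c' \<noteq> c" "(dnk c y x :: 'k) \<noteq> 0" for x y
      using up.dn_supp'[OF c c' that] by simp
    fix f :: "'p set \<Rightarrow> 'k" assume ne: "c \<noteq> c'"
    show "lin L (upk c) (lin L (upk c') f) = lin L (upk c') (lin L (upk c) f)"
      by (rule upk_commute[OF c c' ne])
    show "lin L (dnk c) (lin L (dnk c') f) = lin L (dnk c') (lin L (dnk c) f)"
      by (rule dnk_commute[OF c c' ne])
    show "lin L (upk c) (lin L (dnk c') f) = lin L (dnk c') (lin L (upk c) f)"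
      using up.DU[OF c' c ne[symmetric], of f] by simp
  qed (use finite_L finite_C in auto)
qed

section \<open>Injectivity of raising and lowering\<close>

definition raise :: "('p set \<Rightarrow> 'k::field_char_0) \<Rightarrow> 'p set \<Rightarrow> 'k" where
  "raise f G = (\<Sum>F\<in>{F. cover F G}. of_nat (card (G - F)) * f F)"

definition lower :: "('p set \<Rightarrow> 'k::field_char_0) \<Rightarrow> 'p set \<Rightarrow> 'k" where
  "lower f F = (\<Sum>G\<in>{G. cover F G}. inverse (of_nat (card (G - F))) * f G)"

lemma finite_cover: "finite {F. cover F G}" "finite {G. cover F G}"
  by (rule finite_subset[OF _ finite_L]; auto simp: cover_def)+

lemma raise_classes: "raise f = (\<lambda>G. \<Sum>c\<in>C. lin L (upk c) f G)"
proof
  fix G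
  have eq: "{F. cover F G} = (\<Union>c\<in>C. {F. cov c F G})"
    by (intro equalityI subsetI) (auto dest: cov_ex cov_cover)
  have disj: "\<forall>c\<in>C. \<forall>c'\<in>C. c \<noteq> c' \<longrightarrow> {F. cov c F G} \<inter> {F. cov c' F G} = {}"
    by (intro ballI impI equals0I) (metis IntD1 IntD2 cov_unique mem_Collect_eq)
  show "raise f G = (\<Sum>c\<in>C. lin L (upk c) f G)"
    unfolding raise_def lin_upk eq
    by (rule sum.UNION_disjoint[OF finite_C _ disj]) (simp add: finite_cov)
qed

lemma lower_classes: "lower f = (\<lambda>F. \<Sum>c\<in>C. lin L (dnk c) f F)"
proof
  fix F
  have eq: "{G. cover F G} = (\<Union>c\<in>C. {G. cov c F G})"
    by (intro equalityI subsetI) (auto dest: cov_ex cov_cover)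
  have disj: "\<forall>c\<in>C. \<forall>c'\<in>C. c \<noteq> c' \<longrightarrow> {G. cov c F G} \<inter> {G. cov c' F G} = {}"
    by (intro ballI impI equals0I) (metis IntD1 IntD2 cov_unique mem_Collect_eq)
  show "lower f F = (\<Sum>c\<in>C. lin L (dnk c) f F)"
    unfolding lower_def lin_dnk eq
    by (rule sum.UNION_disjoint[OF finite_C _ disj]) (simp add: finite_cov)
qed

lemma sum_class_rank: "(\<Sum>c\<in>C. r c) = r P"
  using sum_rho[OF P_L] class_rank by simp

definition level :: "nat \<Rightarrow> 'p set set" where "level i = {F \<in> L. r F = i}"

theorem raise_inj:
  fixes f :: "'p set \<Rightarrow> 'k::field_char_0"
  assumes f: "\<And>F. F \<notin> level i \<Longrightarrow> f F = 0" and m: "m + 2 * i \<le> r P"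
    and z: "(raise ^^ m) f = (\<lambda>_. 0)"
  shows "f = (\<lambda>_. 0)"
proof -
  interpret up: sl2_family L C "upk :: _ \<Rightarrow> _ \<Rightarrow> _ \<Rightarrow> 'k" dnk rho r q by (rule sl2_up)
  have R: "up.Ut = raise" by (auto simp: up.Ut_def up.U_def raise_classes)
  have "F \<in> L \<and> r F = i" if "f F \<noteq> 0" for F using f[of F] that by (auto simp: level_def)
  then have "f \<in> up.H i" using sum_rho unfolding up.H_def up.V_def by (auto 4 3)
  from up.lefschetz[OF this] show ?thesis using m z by (simp add: R sum_class_rank)
qed

text \<open>In the reversed grading a flat of rank i has degree r P - i. A nonzero f provides a flat
  of rank i, so i \<le> r P and this subtraction is not truncated.\<close>

theorem lower_inj:
  fixes f :: "'p set \<Rightarrow> 'k::field_char_0"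
  assumes f: "\<And>F. F \<notin> level i \<Longrightarrow> f F = 0" and m: "m + r P \<le> 2 * i"
    and z: "(lower ^^ m) f = (\<lambda>_. 0)"
  shows "f = (\<lambda>_. 0)"
proof (rule ccontr)
  assume nz: "f \<noteq> (\<lambda>_. 0)"
  interpret dn: sl2_family L C "dnk :: _ \<Rightarrow> _ \<Rightarrow> _ \<Rightarrow> 'k" upk "\<lambda>c F. r c - rho c F" r q by (rule sl2_dn)
  have R: "dn.Ut = lower" by (auto simp: dn.Ut_def dn.U_def lower_classes)
  have "(\<Sum>c\<in>C. r c - rho c F) = r P - r F" if "F \<in> L" for F
    using sum_subtractf_nat[of C "\<lambda>c. rho c F" r] rho_le that by (simp add: sum_rho sum_class_rank)
  moreover have lv: "F \<in> L \<and> r F = i" if "f F \<noteq> 0" for F using f[of F] that by (auto simp: level_def)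
  ultimately have H: "f \<in> dn.H (r P - i)" unfolding dn.H_def dn.V_def by (auto 4 3)
  obtain F where "F \<in> L" "r F = i" using lv nz by blast
  then have "i \<le> r P" using r_mono[OF _ P_L L_sub] by auto
  then have "m + 2 * (r P - i) \<le> r P" using m by arith
  then show False using dn.lefschetz[OF H, of m] z nz by (simp add: R sum_class_rank)
qed

subsection \<open>Multiplication by a point\<close>

text \<open>A flat avoiding p is sent to its span with p, a flat containing p to zero. This is what
  multiplication by a variable becomes on functions of flats (\<open>eta_var\<close>).\<close>

definition pmul :: "'p \<Rightarrow> ('p set \<Rightarrow> 'k::field_char_0) \<Rightarrow> 'p set \<Rightarrow> 'k" where
  "pmul p f G = (\<Sum>F\<in>{F. cover F G \<and> p \<in> G \<and> p \<notin> F}. f F)"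

text \<open>Used twice: A = G yields the raising operator, and A = G - H0 yields the linear
  equations solved in \<open>socle\<close>.\<close>

lemma sum_pmul_Diff:
  assumes "A \<subseteq> G" "finite A"
  shows "(\<Sum>p\<in>A. pmul p f G) = (\<Sum>F\<in>{F. cover F G}. of_nat (card (A - F)) * f F)"
proof -
  have "pmul p f G = (\<Sum>F\<in>{F. cover F G}. if p \<notin> F then f F else 0)" if "p \<in> A" for p
    unfolding pmul_def using that assms
    by (intro sum.mono_neutral_cong_left) (auto simp: finite_cover)
  then have "(\<Sum>p\<in>A. pmul p f G) = (\<Sum>p\<in>A. \<Sum>F\<in>{F. cover F G}. if p \<notin> F then f F else 0)" by simp
  also have "\<dots> = (\<Sum>F\<in>{F. cover F G}. \<Sum>p\<in>A. if p \<notin> F then f F else 0)" by (rule sum.swap)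
  also have "\<dots> = (\<Sum>F\<in>{F. cover F G}. of_nat (card (A - F)) * f F)"
  proof (rule sum.cong[OF refl])
    fix F
    have "(\<Sum>p\<in>A. if p \<notin> F then f F else 0) = (\<Sum>p\<in>A - F. f F)"
      using assms by (intro sum.mono_neutral_cong_right) auto
    then show "(\<Sum>p\<in>A. if p \<notin> F then f F else 0) = of_nat (card (A - F)) * f F" by simp
  qed
  finally show ?thesis .
qed

lemma raise_pmul: "raise f = (\<lambda>G. \<Sum>p\<in>P. pmul p f G)"
proof
  fix G
  show "raise f G = (\<Sum>p\<in>P. pmul p f G)"
  proof (cases "G \<in> L")
    case True
    have "(\<Sum>p\<in>P. pmul p f G) = (\<Sum>p\<in>G. pmul p f G)"
      using L_sub[OF True] finite_P by (intro sum.mono_neutral_right) (auto simp: pmul_def)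
    then show ?thesis using sum_pmul_Diff[of G G f] finite_flat[OF True] by (simp add: raise_def)
  next
    case False
    then show ?thesis by (simp add: raise_def pmul_def cover_def)
  qed
qed

text \<open>In the class \<open>c\<close> the matrix with entries \<open>card (G - H\<^sub>0 - H)\<close> is, up to scaling its rows, a
  multiple of the identity plus a multiple of the all-ones matrix.\<close>

lemma class_gap:
  assumes c: "c \<in> C" and H: "cov c H G" "cov c H0 G" "H \<noteq> H0"
  shows "q c * card (G - H0 - H) + card (G - H0) = q c * card (G - H0)"
proof -
  let ?K = "H \<inter> H0"
  note cv = cov_cover[OF H(1)] cov_cover[OF H(2)]
  have L: "H \<in> L" "H0 \<in> L" "G \<in> L" "H \<subseteq> G" "H0 \<subseteq> G" using cv by (auto simp: cover_def)
  have K: "cov c ?K H0" using cov_meet[OF c H(1) cv(2)] H(3) by (simp add: Int_commute)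
  have mem: "F \<in> mid ?K G \<Longrightarrow> F \<noteq> H0 \<Longrightarrow> F \<inter> H0 = ?K" for F
    using cover_join(1)[of ?K F H0] K by (auto simp: mid_def cov_def)
  obtain x where x: "x \<in> H0" "x \<notin> H" using cover_neqD[OF cv] H(3) by auto
  \<comment> \<open>All these F avoid the same point x of H0, so projection from x gives them the
    same size as H.\<close>
  have cardF: "card (F - ?K) = card (H - H0)" if F: "F \<in> mid ?K G - {H0}" for F
  proof -
    have "F \<in> mid ?K G" "F \<noteq> H0" using F by auto
    then have FL: "F \<inter> H0 = ?K" "cover F G" by (rule mem, simp add: mid_def)
    then have "F \<in> L" by (simp add: cover_def)
    have "x \<notin> F" using x FL(1) by auto
    then have "card F = card H" using card_hyperplane_eq[OF FL(2) cv(1), of x] x L by auto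
    moreover have "?K \<subseteq> F" "?K \<subseteq> H" using FL(1) by blast+
    moreover have "finite ?K" using finite_flat[OF L(1)] by simp
    ultimately have "card (F - ?K) = card (H - ?K)" by (simp only: card_Diff_subset)
    moreover have "H - ?K = H - H0" by blast
    ultimately show ?thesis by simp
  qed
  \<comment> \<open>The middle flats other than H0 cut G - H0 into q c blocks, each of size card (H
    - H0).\<close>
  have "G - H0 = (\<Union>F\<in>mid ?K G - {H0}. F - ?K)"
  proof (intro equalityI subsetI)
    fix y assume y: "y \<in> G - H0"
    then have "y \<in> P" using L(3) L_sub by blast
    then have 1: "cover ?K (cl (insert y ?K))" using cover_insert[OF Int_L[OF L(1,2)]] y by simp
    have 2: "y \<in> cl (insert y ?K)" using cl_super by blast
    have "cl (insert y ?K) \<subseteq> G" using y L by (intro cl_least) auto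
    moreover have "r G = r ?K + 2" using K cv by (auto simp: cov_def cover_def)
    ultimately have "cl (insert y ?K) \<in> mid ?K G" using 1 L by (auto simp: mid_def cover_def)
    then show "y \<in> (\<Union>F\<in>mid ?K G - {H0}. F - ?K)" using 2 y by blast
  next
    fix y assume "y \<in> (\<Union>F\<in>mid ?K G - {H0}. F - ?K)"
    then obtain F where F: "F \<in> mid ?K G" "F \<noteq> H0" "y \<in> F" "y \<notin> ?K" by auto
    then show "y \<in> G - H0" using mem[OF F(1,2)] by (auto simp: mid_def cover_def)
  qed
  moreover have "card (\<Union>F\<in>mid ?K G - {H0}. F - ?K) = (\<Sum>F\<in>mid ?K G - {H0}. card (F - ?K))"
  proof (rule card_UN_disjoint)
    show "finite (mid ?K G - {H0})" using finite_mid by simp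
    show "\<forall>F\<in>mid ?K G - {H0}. finite (F - ?K)" using finite_flat by (auto simp: mid_def cover_def)
    have "F \<inter> F' = ?K" if "F \<in> mid ?K G" "F' \<in> mid ?K G" "F \<noteq> F'" for F F'
      using cover_join(1)[of ?K F F'] that by (simp add: mid_def)
    then show "\<forall>F\<in>mid ?K G - {H0}. \<forall>F'\<in>mid ?K G - {H0}. F \<noteq> F' \<longrightarrow> (F - ?K) \<inter> (F' - ?K) = {}"
      by (intro ballI impI) auto
  qed
  moreover have "card (mid ?K G - {H0}) = q c"
    using mid_same[OF c K H(2)] K cv by (subst card_Diff_singleton) (auto simp: mid_def cov_def)
  ultimately have nu: "card (G - H0) = q c * card (H - H0)" using cardF by simp
  have "card (G - H0 - H) = card (G - H0) - card (H - H0)"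
  proof -
    have "G - H0 - H = (G - H0) - (H - H0)" by auto
    then show ?thesis using L finite_flat by (simp add: card_Diff_subset Diff_mono)
  qed
  moreover have "card (H - H0) \<le> card (G - H0)" using L finite_flat by (intro card_mono) auto
  ultimately have "card (G - H0) = card (G - H0 - H) + card (H - H0)" by simp
  then have "q c * card (G - H0) = q c * card (G - H0 - H) + q c * card (H - H0)"
    by (metis distrib_left)
  then show ?thesis using nu by simp
qed

text \<open>Suppose all points annihilate f at some cover G of F, of class c say. Summing over the
  points of G - H0 gives one equation for each class-c hyperplane H0, and \<open>class_gap\<close>
  brings it to the form f H0 = (1 - q) S, where S is the sum of f over these hyperplanes. Summing
  over their number N gives S * (1 + N(q - 1)) = 0. The second factor is a positive integer because
  q is at least 1, so S = 0 and then f F = 0.\<close>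

lemma socle:
  fixes f :: "'p set \<Rightarrow> 'k::field_char_0"
  assumes F: "F \<in> L" "F \<noteq> P" and f: "f F \<noteq> 0"
  obtains p G where "p \<in> P" "cover F G" "pmul p f G \<noteq> 0"
proof (rule ccontr)
  assume "\<not> thesis"
  then have z: "\<And>p G. p \<in> P \<Longrightarrow> cover F G \<Longrightarrow> pmul p f G = 0" using that by auto
  obtain s where "s \<in> P" "s \<notin> F" using L_sub F by auto
  then have cv: "cover F (cl (insert s F))" using cover_insert F by auto
  define G where "G = cl (insert s F)"
  have G: "cover F G" "G \<in> L" using cv by (auto simp: G_def cover_def)
  obtain c where c: "c \<in> C" "cov c F G" using cov_ex[OF G(1)] by auto
  let ?H = "{H. cov c H G}" and ?S = "\<Sum>H\<in>{H. cov c H G}. f H"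
  have row: "f H0 = (1 - of_nat (q c)) * ?S" if H0: "H0 \<in> ?H" for H0
  proof -
    let ?n = "card (G - H0)"
    have cH0: "cov c H0 G" using H0 by simp
    have "(\<Sum>p\<in>G - H0. pmul p f G) = 0" using z[OF _ G(1)] L_sub[OF G(2)] by (intro sum.neutral) auto
    then have "0 = (\<Sum>p\<in>G - H0. pmul p f G)" by simp
    also have "\<dots> = (\<Sum>H\<in>{H. cover H G}. of_nat (card (G - H0 - H)) * f H)"
      using finite_flat[OF G(2)] by (intro sum_pmul_Diff) auto
    also have "\<dots> = (\<Sum>H\<in>?H. of_nat (card (G - H0 - H)) * f H)"
    proof (intro sum.mono_neutral_right ballI finite_cover)
      show "?H \<subseteq> {H. cover H G}" using cov_cover by auto
      fix H assume H: "H \<in> {H. cover H G} - ?H"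
      \<comment> \<open>A point missing from both hyperplanes would lie in c and put H into class
        c.\<close>
      have "G - H0 - H = {}"
      proof (rule ccontr)
        assume "G - H0 - H \<noteq> {}"
        then obtain p where p: "p \<in> G" "p \<notin> H0" "p \<notin> H" by auto
        then have "p \<in> c" using cH0 by (auto simp: cov_def)
        then have "cov c H G" using covI[of H G p c] p c H by auto
        then show False using H by auto
      qed
      then show "of_nat (card (G - H0 - H)) * f H = 0" by (simp only: card.empty of_nat_0 mult_zero_left)
    qed
    finally have "0 = of_nat (q c) * (\<Sum>H\<in>?H. of_nat (card (G - H0 - H)) * f H)" by simp
    also have "\<dots> = (\<Sum>H\<in>?H. (of_nat (q c) - 1) * of_nat ?n * f H + (if H = H0 then of_nat ?n * f H else 0))"
      unfolding sum_distrib_left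
    proof (rule sum.cong[OF refl])
      fix H assume H: "H \<in> ?H"
      show "of_nat (q c) * (of_nat (card (G - H0 - H)) * f H) =
          (of_nat (q c) - 1) * of_nat ?n * f H + (if H = H0 then of_nat ?n * f H else 0)"
      proof (cases "H = H0")
        case True
        then show ?thesis by (simp add: algebra_simps)
      next
        case False
        have "(of_nat (q c * card (G - H0 - H) + ?n) :: 'k) = of_nat (q c * ?n)"
          using class_gap[OF c(1) _ cH0 False] H by simp
        then have "(of_nat (q c) * of_nat (card (G - H0 - H)) :: 'k) = (of_nat (q c) - 1) * of_nat ?n"
          by (simp add: algebra_simps)
        then show ?thesis using False by (simp add: mult.assoc[symmetric])
      qed
    qed
    also have "\<dots> = (of_nat (q c) - 1) * of_nat ?n * ?S + of_nat ?n * f H0"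
      using finite_cov(1)[of c G] H0 by (simp add: sum.distrib sum_distrib_left)
    also have "\<dots> = of_nat ?n * ((of_nat (q c) - 1) * ?S + f H0)" by (simp add: algebra_simps)
    finally have "of_nat ?n * ((of_nat (q c) - 1) * ?S + f H0) = 0" by simp
    moreover have "(of_nat ?n :: 'k) \<noteq> 0" using cover_Diff_pos[OF cov_cover[OF cH0]] by simp
    ultimately have "(of_nat (q c) - 1) * ?S + f H0 = 0" by simp
    then show ?thesis by (simp add: algebra_simps eq_neg_iff_add_eq_0)
  qed
  have "?S = (\<Sum>H\<in>?H. (1 - of_nat (q c)) * ?S)" by (rule sum.cong[OF refl row])
  also have "\<dots> = of_nat (card ?H) * ((1 - of_nat (q c)) * ?S)" by simp
  finally have "?S * (1 + of_nat (card ?H) * (of_nat (q c) - 1)) = 0" by (simp add: algebra_simps)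
  moreover have "(1 + of_nat (card ?H) * (of_nat (q c) - 1) :: 'k) = of_nat (1 + card ?H * (q c - 1))"
    using q_pos[OF c(1)] by (simp add: of_nat_diff)
  moreover have "(of_nat (1 + card ?H * (q c - 1)) :: 'k) \<noteq> 0" by (simp only: of_nat_eq_0_iff)
  ultimately have "?S = 0" by auto
  then show False using row[of F] c f by simp
qed

end

section \<open>Functions with finite support\<close>

interpretation fun_vs: vector_space "\<lambda>(c::'k::field) (f :: 'a \<Rightarrow> 'k) x. c * f x"
  by standard (auto simp: fun_eq_iff algebra_simps)

interpretation fun_vs_pair: vector_space_pair
    "\<lambda>(c::'k::field) (f :: 'a \<Rightarrow> 'k) x. c * f x" "\<lambda>(c::'k::field) (f :: 'b \<Rightarrow> 'k) x. c * f x"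
  by standard

text \<open>Spaces of this form, with a finite set A, stand in for spaces of dimension card A, so
  that dimension arguments become inequalities between cardinalities.\<close>

definition supported :: "'a set \<Rightarrow> ('a \<Rightarrow> 'k::field) set" where
  "supported A = {f. \<forall>x. x \<notin> A \<longrightarrow> f x = 0}"

definition delta :: "'a \<Rightarrow> 'a \<Rightarrow> 'k::field" where "delta a = (\<lambda>x. if x = a then 1 else 0)"

lemma subspace_supported: "fun_vs.subspace (supported A)"
  by (auto simp: fun_vs.subspace_def supported_def)

lemma delta_supported: "a \<in> A \<Longrightarrow> delta a \<in> supported A"
  by (auto simp: delta_def supported_def)

lemma sum_fun_apply: "(\<Sum>i\<in>I. f i) x = (\<Sum>i\<in>I. f i x)"
  by (induction I rule: infinite_finite_induct) auto

lemma span_delta: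
  assumes "finite A" shows "fun_vs.span (delta ` A) = (supported A :: ('a \<Rightarrow> 'k::field) set)"
proof
  show "fun_vs.span (delta ` A) \<subseteq> (supported A :: ('a \<Rightarrow> 'k) set)"
    using delta_supported by (intro fun_vs.span_minimal subspace_supported) auto
  show "(supported A :: ('a \<Rightarrow> 'k) set) \<subseteq> fun_vs.span (delta ` A)"
  proof
    fix f :: "'a \<Rightarrow> 'k" assume f: "f \<in> supported A"
    have *: "(\<Sum>a\<in>A. f a * delta a x) = f x" for x
    proof -
      have "(\<Sum>a\<in>A. f a * delta a x) = (\<Sum>a\<in>A. if x = a then f a else 0)"
        by (intro sum.cong) (auto simp: delta_def)
      then show ?thesis using f assms by (simp add: supported_def)
    qed
    have "f = (\<Sum>a\<in>A. (\<lambda>x. f a * delta a x))" by (rule ext) (simp add: sum_fun_apply *)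
    also have "\<dots> \<in> fun_vs.span (delta ` A)"
      by (intro fun_vs.span_sum fun_vs.span_scale fun_vs.span_base) auto
    finally show "f \<in> fun_vs.span (delta ` A)" .
  qed
qed

lemma inj_delta: "inj_on (delta :: 'a \<Rightarrow> 'a \<Rightarrow> 'k::field) A"
  by (rule inj_onI) (auto simp: delta_def fun_eq_iff split: if_splits)

lemma independent_delta: "fun_vs.independent (delta ` A :: ('a \<Rightarrow> 'k::field) set)"
proof
  assume "fun_vs.dependent (delta ` A :: ('a \<Rightarrow> 'k) set)"
  then obtain a where a: "a \<in> A" "delta a \<in> fun_vs.span (delta ` A - {delta a :: 'a \<Rightarrow> 'k})"
    by (auto simp: fun_vs.dependent_def)
  have "fun_vs.span (delta ` A - {delta a}) \<subseteq> (supported (- {a}) :: ('a \<Rightarrow> 'k) set)"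
    by (rule fun_vs.span_minimal[OF _ subspace_supported]) (auto intro!: delta_supported)
  then show False using a by (auto simp: supported_def delta_def)
qed

lemma independent_card_le:
  assumes "finite A" "fun_vs.independent B" "B \<subseteq> (supported A :: ('a \<Rightarrow> 'k::field) set)"
  shows "finite B \<and> card B \<le> card A"
proof -
  have "finite B \<and> card B \<le> card (delta ` A :: ('a \<Rightarrow> 'k) set)"
    using assms by (intro fun_vs.independent_span_bound) (auto simp: span_delta)
  then show ?thesis using card_image_le[OF assms(1), of "delta :: 'a \<Rightarrow> 'a \<Rightarrow> 'k"] by linarith
qed

text \<open>The images of the delta functions are independent, which bounds card A. If card B is no
  larger, a vector outside their span would be one independent vector too many.\<close>

lemma linear_injection:
  fixes T :: "('a \<Rightarrow> 'k::field) \<Rightarrow> 'b \<Rightarrow> 'k"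
  assumes fin: "finite A" "finite B"
    and add: "\<And>f g. T (\<lambda>x. f x + g x) = (\<lambda>x. T f x + T g x)"
    and mult: "\<And>a f. T (\<lambda>x. a * f x) = (\<lambda>x. a * T f x)"
    and range: "\<And>f. f \<in> supported A \<Longrightarrow> T f \<in> supported B"
    and inj: "\<And>f. f \<in> supported A \<Longrightarrow> T f = (\<lambda>_. 0) \<Longrightarrow> f = (\<lambda>_. 0)"
  shows "card A \<le> card B" and "card B \<le> card A \<Longrightarrow> y \<in> supported B \<Longrightarrow> \<exists>f\<in>supported A. T f = y"
proof -
  have lin: "Vector_Spaces.linear (\<lambda>c f x. c * f x) (\<lambda>c f x. c * f x) T"
    unfolding Vector_Spaces.linear_iff plus_fun_def
    by (intro conjI allI fun_vs.vector_space_axioms add mult)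
  have inj_T: "inj_on T (supported A)"
  proof (rule inj_onI)
    fix f g assume fg: "f \<in> supported A" "g \<in> supported A" "T f = T g"
    have "T (\<lambda>x. f x + (-1) * g x) = (\<lambda>x. T f x + (-1) * T g x)" unfolding add mult ..
    then have "T (\<lambda>x. f x + (-1) * g x) = (\<lambda>_. 0)" using fg(3) by simp
    moreover have "(\<lambda>x. f x + (-1) * g x) \<in> supported A" using fg(1,2) by (simp add: supported_def)
    ultimately have "(\<lambda>x. f x + (-1) * g x) = (\<lambda>_. 0)" by (intro inj)
    then have "f x + (-1) * g x = 0" for x by (rule fun_cong)
    then show "f = g" by (intro ext) simp
  qed
  let ?D = "delta ` A :: ('a \<Rightarrow> 'k) set"
  have ind: "fun_vs.independent (T ` ?D)"
    using inj_T by (intro fun_vs_pair.linear_independent_injective_image[OF lin independent_delta])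
      (simp add: span_delta fin)
  have sub: "T ` ?D \<subseteq> supported B" by (auto intro!: range delta_supported)
  have D: "?D \<subseteq> supported A" by (auto intro!: delta_supported)
  have "card (T ` ?D) = card ?D" by (rule card_image[OF inj_on_subset[OF inj_T D]])
  also have "card ?D = card A" by (rule card_image[OF inj_delta])
  finally have cardD: "card (T ` ?D) = card A" .
  have "card (T ` ?D) \<le> card B" using independent_card_le[OF fin(2) ind sub] by (rule conjunct2)
  then show "card A \<le> card B" unfolding cardD .
  assume BA: "card B \<le> card A" and y: "y \<in> supported B"
  have "y \<in> fun_vs.span (T ` ?D)"
  proof (rule ccontr)
    assume ny: "y \<notin> fun_vs.span (T ` ?D)"
    then have ind': "fun_vs.independent (insert y (T ` ?D))" using ind by (rule fun_vs.independent_insertI)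
    have "insert y (T ` ?D) \<subseteq> supported B" using y sub by (rule insert_subsetI)
    from independent_card_le[OF fin(2) ind' this] have "card (insert y (T ` ?D)) \<le> card B" by (rule conjunct2)
    moreover have "y \<notin> T ` ?D" using ny fun_vs.span_base[of y "T ` ?D"] by blast
    then have "card (insert y (T ` ?D)) = Suc (card (T ` ?D))" using fin(1)
      by (intro card_insert_disjoint) auto
    ultimately show False using cardD BA by linarith
  qed
  also have "fun_vs.span (T ` ?D) = T ` fun_vs.span ?D"
    by (rule fun_vs_pair.linear_span_image[OF lin])
  also have "fun_vs.span ?D = supported A" by (rule span_delta[OF fin(1)])
  finally show "\<exists>f\<in>supported A. T f = y" by blast
qed

text \<open>Dimension is the largest size of an independent subset. At an index n where it is
  minimal, a proper inclusion further down would allow a largest independent subset of the smaller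
  space to be enlarged inside W n.\<close>

lemma subspace_chain_stabilizes:
  fixes W :: "nat \<Rightarrow> ('a \<Rightarrow> 'k::field) set"
  assumes fin: "finite A" and W: "\<And>n. fun_vs.subspace (W n)" "\<And>n. W n \<subseteq> supported A"
    and dec: "\<And>n. W (Suc n) \<subseteq> W n"
  shows "\<exists>n. \<forall>m\<ge>n. W m = W n"
proof -
  define Q where "Q n d \<longleftrightarrow> (\<exists>B\<subseteq>W n. fun_vs.independent B \<and> card B = d)" for n d
  have bound: "d \<le> card A" if "Q n d" for n d
    using that independent_card_le[OF fin] W(2) unfolding Q_def by blast
  define dm where "dm n = Max {d. Q n d}" for n
  have finQ: "finite {d. Q n d}" for n
    by (rule finite_subset[of _ "{..card A}"]) (use bound in auto)
  have Q0: "Q n 0" for n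
    unfolding Q_def using fun_vs.independent_empty by (intro exI[of _ "{}"]) simp
  have Qdm: "Q n (dm n)" for n unfolding dm_def using Max_in[OF finQ] Q0 by blast
  have dmmax: "d \<le> dm n" if "Q n d" for n d unfolding dm_def using Max_ge[OF finQ] that by blast
  obtain n where n: "\<And>m. dm n \<le> dm m" using ex_has_least_nat[of "\<lambda>_. True" 0 dm] by auto
  have dec': "W m \<subseteq> W n" if "n \<le> m" for m n by (rule lift_Suc_antimono_le[of W, OF dec that])
  have "W m = W n" if nm: "m \<ge> n" for m
  proof (rule ccontr)
    assume "W m \<noteq> W n"
    then obtain x where x: "x \<in> W n" "x \<notin> W m" using dec'[OF nm] by blast
    obtain B where B: "B \<subseteq> W m" "fun_vs.independent B" "card B = dm m" using Qdm[of m] unfolding Q_def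
      by blast
    have "fun_vs.span B \<subseteq> W m" by (rule fun_vs.span_minimal[OF B(1) W(1)])
    then have "x \<notin> fun_vs.span B" using x by auto
    then have "fun_vs.independent (insert x B)" using B(2) by (rule fun_vs.independent_insertI)
    moreover have finB: "finite B" using independent_card_le[OF fin B(2)] B(1) W(2) by blast
    moreover have "x \<notin> B" using x B by blast
    then have "card (insert x B) = Suc (dm m)" using finB B(3) by simp
    moreover have "insert x B \<subseteq> W n" using x B(1) dec'[OF nm] by blast
    ultimately have "Q n (Suc (dm m))" unfolding Q_def by (intro exI[of _ "insert x B"] conjI)
    then show False using dmmax[of n "Suc (dm m)"] n[of m] by simp
  qed
  then show ?thesis by blast
qed

section \<open>The Sperner property of a modular geometry\<close>

context modular_geometry
begin

lemma raise_add: "raise (\<lambda>F. f F + g F) = (\<lambda>G. raise f G + raise g G)"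
  and raise_mult: "raise (\<lambda>F. a * f F) = (\<lambda>G. a * raise f G)"
  and lower_add: "lower (\<lambda>F. f F + g F) = (\<lambda>G. lower f G + lower g G)"
  and lower_mult: "lower (\<lambda>F. a * f F) = (\<lambda>G. a * lower f G)"
  by (simp_all add: raise_def lower_def fun_eq_iff algebra_simps sum.distrib sum_distrib_left)

lemma raise_pow_add: "(raise ^^ m) (\<lambda>F. f F + g F) = (\<lambda>G. (raise ^^ m) f G + (raise ^^ m) g G)"
  and raise_pow_mult: "(raise ^^ m) (\<lambda>F. a * f F) = (\<lambda>G. a * (raise ^^ m) f G)"
  and lower_pow_add: "(lower ^^ m) (\<lambda>F. f F + g F) = (\<lambda>G. (lower ^^ m) f G + (lower ^^ m) g G)"
  and lower_pow_mult: "(lower ^^ m) (\<lambda>F. a * f F) = (\<lambda>G. a * (lower ^^ m) f G)"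
  by (induction m) (simp_all add: raise_add raise_mult lower_add lower_mult)

lemma finite_level: "finite (level i)"
  using finite_L by (simp add: level_def)

lemma raise_supported:
  assumes "f \<in> supported S"
  shows "raise f \<in> supported {G. \<exists>F\<in>S. cover F G}"
  using assms unfolding supported_def raise_def by (auto intro!: sum.neutral)

lemma lower_supported:
  assumes "f \<in> supported S"
  shows "lower f \<in> supported {F. \<exists>G\<in>S. cover F G}"
  using assms unfolding supported_def lower_def by (auto intro!: sum.neutral)

lemma supported_mono: "A \<subseteq> B \<Longrightarrow> supported A \<subseteq> supported B"
  by (auto simp: supported_def)

lemma raise_level: "f \<in> supported (level i) \<Longrightarrow> raise f \<in> supported (level (Suc i))"
  by (rule subsetD[OF supported_mono raise_supported]) (auto simp: level_def cover_def)

lemma lower_level: "f \<in> supported (level (Suc i)) \<Longrightarrow> lower f \<in> supported (level i)"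
  by (rule subsetD[OF supported_mono lower_supported]) (auto simp: level_def cover_def)

lemma raise_pow_level: "f \<in> supported (level i) \<Longrightarrow> (raise ^^ m) f \<in> supported (level (i + m))"
  by (induction m) (auto intro: raise_level)

lemma lower_pow_level: "f \<in> supported (level (i + m)) \<Longrightarrow> (lower ^^ m) f \<in> supported (level i)"
proof (induction m arbitrary: i)
  case (Suc m)
  then have "(lower ^^ m) f \<in> supported (level (Suc i))" by simp
  then show ?case using lower_level by simp
qed simp

text \<open>Both shadow inequalities compare dimensions over the rationals.\<close>

lemma upper_shadow:
  assumes S: "S \<subseteq> level i" and i: "2 * i + 1 \<le> r P"
  shows "card S \<le> card {G. \<exists>F\<in>S. cover F G}"
proof (rule linear_injection(1)[where T = "raise :: ('p set \<Rightarrow> rat) \<Rightarrow> _"])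
  show "finite S" using S finite_level finite_subset by blast
  show "finite {G. \<exists>F\<in>S. cover F G}"
    by (rule finite_subset[OF _ finite_L]) (auto simp: cover_def)
  fix f :: "'p set \<Rightarrow> rat" assume f: "f \<in> supported S" "raise f = (\<lambda>_. 0)"
  show "f = (\<lambda>_. 0)"
    using raise_inj[of i f 1] f S i by (auto simp: supported_def)
qed (auto simp: raise_add raise_mult raise_supported)

lemma lower_shadow:
  assumes S: "S \<subseteq> level i" and i: "r P + 1 \<le> 2 * i"
  shows "card S \<le> card {F. \<exists>G\<in>S. cover F G}"
proof (rule linear_injection(1)[where T = "lower :: ('p set \<Rightarrow> rat) \<Rightarrow> _"])
  show "finite S" using S finite_level finite_subset by blast
  show "finite {F. \<exists>G\<in>S. cover F G}"
    by (rule finite_subset[OF _ finite_L]) (auto simp: cover_def)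
  fix f :: "'p set \<Rightarrow> rat" assume f: "f \<in> supported S" "lower f = (\<lambda>_. 0)"
  show "f = (\<lambda>_. 0)"
    using lower_inj[of i f 1] f S i by (auto simp: supported_def)
qed (auto simp: lower_add lower_mult lower_supported)

text \<open>Injectivity of lowering gives the inequality opposite to the one from raising. With
  both, raising between complementary levels is bijective, which is how
  \<open>raise_pow_surj\<close> uses it.\<close>

lemma card_level_sym:
  assumes "2 * i \<le> r P" shows "card (level (r P - i)) \<le> card (level i)"
proof (rule linear_injection(1)[where T = "lower ^^ (r P - 2 * i) :: ('p set \<Rightarrow> rat) \<Rightarrow> _"])
  have e: "r P - i = i + (r P - 2 * i)" using assms by simp
  fix f :: "'p set \<Rightarrow> rat" assume f: "f \<in> supported (level (r P - i))"
  show "(lower ^^ (r P - 2 * i)) f \<in> supported (level i)" using lower_pow_level f unfolding e .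
  assume "(lower ^^ (r P - 2 * i)) f = (\<lambda>_. 0)"
  then show "f = (\<lambda>_. 0)" using lower_inj[of "r P - i" f "r P - 2 * i"] f assms by (auto simp: supported_def)
qed (auto simp: finite_level lower_pow_add lower_pow_mult)

theorem raise_pow_surj:
  fixes f :: "'p set \<Rightarrow> 'k::field_char_0"
  assumes i: "2 * i \<le> r P" and f: "f \<in> supported (level (r P - i))"
  obtains g where "g \<in> supported (level i)" "(raise ^^ (r P - 2 * i)) g = f"
proof -
  have "\<exists>g\<in>supported (level i). (raise ^^ (r P - 2 * i)) g = f"
  proof (rule linear_injection(2)[OF finite_level finite_level _ _ _ _ card_level_sym[OF i] f])
    have e: "r P - i = i + (r P - 2 * i)" using i by simp
    fix g :: "'p set \<Rightarrow> 'k" assume g: "g \<in> supported (level i)"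
    show "(raise ^^ (r P - 2 * i)) g \<in> supported (level (r P - i))" using raise_pow_level[OF g] unfolding e .
    assume "(raise ^^ (r P - 2 * i)) g = (\<lambda>_. 0)"
    then show "g = (\<lambda>_. 0)" using raise_inj[of i g "r P - 2 * i"] g i by (auto simp: supported_def)
  qed (auto simp: raise_pow_add raise_pow_mult)
  then show ?thesis using that by blast
qed

definition achain :: "'p set set \<Rightarrow> bool" where
  "achain A \<longleftrightarrow> A \<subseteq> L \<and> (\<forall>X\<in>A. \<forall>Y\<in>A. X \<subseteq> Y \<longrightarrow> X = Y)"

text \<open>The members of lowest rank i are replaced by all their covers. A cover below a remaining
  member would put the flat it covers below that member too, so the antichain property survives, and
  \<open>upper_shadow\<close> keeps the size from dropping.\<close>

lemma achain_push_up:
  assumes A: "achain A" "\<forall>X\<in>A. i \<le> r X" and i: "2 * i + 1 \<le> r P"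
  shows "\<exists>A'. achain A' \<and> (\<forall>X\<in>A'. Suc i \<le> r X) \<and> card A \<le> card A'"
proof -
  let ?S = "A \<inter> level i"
  let ?U = "{G. \<exists>F\<in>?S. cover F G}"
  let ?R = "A - level i"
  have AL: "A \<subseteq> L" "finite A" using A finite_L finite_subset by (auto simp: achain_def)
  have finU: "finite ?U" by (rule finite_subset[OF _ finite_L]) (auto simp: cover_def)
  have R: "Suc i \<le> r X" if "X \<in> ?R" for X using that A(2) AL by (force simp: level_def)
  have U: "r X = Suc i" "X \<in> L" if "X \<in> ?U" for X using that by (auto simp: level_def cover_def)
  have incomp: "\<not> X \<subseteq> Y" if X': "X \<in> ?U" and Y': "Y \<in> ?R" for X Y
  proof
    assume XY: "X \<subseteq> Y"
    obtain F where F: "F \<in> A" "F \<in> level i" "cover F X" using X' by auto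
    then have "F \<subseteq> Y" using XY by (auto simp: cover_def)
    then have "F = Y" using A(1) F Y' unfolding achain_def by blast
    then show False using F Y' by auto
  qed
  have "achain (?U \<union> ?R)"
    unfolding achain_def
  proof (intro conjI ballI impI)
    show "?U \<union> ?R \<subseteq> L" using U(2) AL by auto
    fix X Y assume X: "X \<in> ?U \<union> ?R" and Y: "Y \<in> ?U \<union> ?R" and XY: "X \<subseteq> Y"
    have XL: "X \<in> L" "Y \<in> L" using X Y U(2) AL by auto
    show "X = Y"
    proof (cases "Y \<in> ?U")
      case True
      have "Suc i \<le> r X" using X R U(1) by force
      then show ?thesis using r_eqD[OF XL XY] U(1)[OF True] by simp
    next
      case False
      then have YR: "Y \<in> ?R" using Y by auto
      then have "X \<notin> ?U" using incomp XY by blast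
      then have "X \<in> ?R" using X by auto
      then show ?thesis using A(1) YR XY unfolding achain_def by blast
    qed
  qed
  moreover have "\<forall>X\<in>?U \<union> ?R. Suc i \<le> r X" using R U(1) by fastforce
  moreover have "card A \<le> card (?U \<union> ?R)"
  proof -
    have "?U \<inter> ?R = {}" using incomp by blast
    then have "card (?U \<union> ?R) = card ?U + card ?R" using finU AL by (intro card_Un_disjoint) auto
    moreover have "card ?S \<le> card ?U" using upper_shadow[of ?S i] i by auto
    moreover have "card A = card ?S + card ?R"
      using card_Int_Diff[OF AL(2), of "level i"] .
    ultimately show ?thesis by linarith
  qed
  ultimately show ?thesis by blast
qed

text \<open>The dual replacement at the highest rank. The lower bound m is carried along so that the
  members are finally trapped in one level.\<close>

lemma achain_push_down:
  assumes A: "achain A" "\<forall>X\<in>A. m \<le> r X \<and> r X \<le> i" and i: "r P + 1 \<le> 2 * i" "m < i"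
  shows "\<exists>A'. achain A' \<and> (\<forall>X\<in>A'. m \<le> r X \<and> r X \<le> i - 1) \<and> card A \<le> card A'"
proof -
  let ?S = "A \<inter> level i"
  let ?U = "{F. \<exists>G\<in>?S. cover F G}"
  let ?R = "A - level i"
  have AL: "A \<subseteq> L" "finite A" using A finite_L finite_subset by (auto simp: achain_def)
  have finU: "finite ?U" by (rule finite_subset[OF _ finite_L]) (auto simp: cover_def)
  have R: "m \<le> r X \<and> r X \<le> i - 1" if "X \<in> ?R" for X using that A(2) AL by (force simp: level_def)
  have U: "Suc (r X) = i" "X \<in> L" if "X \<in> ?U" for X using that by (auto simp: level_def cover_def)
  have incomp: "\<not> Y \<subseteq> X" if X': "X \<in> ?U" and Y': "Y \<in> ?R" for X Y
  proof
    assume XY: "Y \<subseteq> X"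
    obtain F where F: "F \<in> A" "F \<in> level i" "cover X F" using X' by auto
    then have "Y \<subseteq> F" using XY by (auto simp: cover_def)
    then have "F = Y" using A(1) F Y' unfolding achain_def by blast
    then show False using F Y' by auto
  qed
  have "achain (?U \<union> ?R)"
    unfolding achain_def
  proof (intro conjI ballI impI)
    show "?U \<union> ?R \<subseteq> L" using U(2) AL by auto
    fix X Y assume X: "X \<in> ?U \<union> ?R" and Y: "Y \<in> ?U \<union> ?R" and XY: "X \<subseteq> Y"
    have XL: "X \<in> L" "Y \<in> L" using X Y U(2) AL by auto
    show "X = Y"
    proof (cases "X \<in> ?U")
      case True
      have "r Y \<le> i - 1" using Y R U(1) by force
      then show ?thesis using r_eqD[OF XL XY] U(1)[OF True] by simp
    next
      case False
      then have XR: "X \<in> ?R" using X by auto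
      then have "Y \<notin> ?U" using incomp XY by blast
      then have "Y \<in> ?R" using Y by auto
      then show ?thesis using A(1) XR XY unfolding achain_def by blast
    qed
  qed
  moreover have "\<forall>X\<in>?U \<union> ?R. m \<le> r X \<and> r X \<le> i - 1" using R U(1) i by fastforce
  moreover have "card A \<le> card (?U \<union> ?R)"
  proof -
    have "?U \<inter> ?R = {}" using incomp by blast
    then have "card (?U \<union> ?R) = card ?U + card ?R" using finU AL by (intro card_Un_disjoint) auto
    moreover have "card ?S \<le> card ?U" using lower_shadow[of ?S i] i by auto
    moreover have "card A = card ?S + card ?R"
      using card_Int_Diff[OF AL(2), of "level i"] .
    ultimately show ?thesis by linarith
  qed
  ultimately show ?thesis by blast
qed

theorem achain_card_le:
  assumes A: "achain A" shows "card A \<le> card (level ((r P + 1) div 2))"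
proof -
  \<comment> \<open>Rounded up, so that for either parity raising is injective from every level
    below and lowering from every level above.\<close>
  let ?m = "(r P + 1) div 2"
  have up: "\<exists>A'. achain A' \<and> (\<forall>X\<in>A'. i \<le> r X) \<and> card A \<le> card A'" if "i \<le> ?m" for i
    using that
  proof (induction i)
    case 0
    then show ?case using A by blast
  next
    case (Suc i)
    then obtain A' where A': "achain A'" "\<forall>X\<in>A'. i \<le> r X" "card A \<le> card A'" by auto
    have "2 * i + 1 \<le> r P" using Suc.prems by linarith
    from achain_push_up[OF A'(1,2) this] show ?case using A'(3) le_trans by blast
  qed
  have down: "\<exists>A'. achain A' \<and> (\<forall>X\<in>A'. ?m \<le> r X \<and> r X \<le> r P - j) \<and> card A \<le> card A'"
    if "?m + j \<le> r P" for j
    using that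
  proof (induction j)
    case 0
    obtain A' where A': "achain A'" "\<forall>X\<in>A'. ?m \<le> r X" "card A \<le> card A'" using up[of ?m] by auto
    have "\<forall>X\<in>A'. r X \<le> r P - 0" using A'(1) r_mono[OF _ P_L L_sub] by (auto simp: achain_def)
    then show ?case using A' by blast
  next
    case (Suc j)
    then obtain A' where A': "achain A'" "\<forall>X\<in>A'. ?m \<le> r X \<and> r X \<le> r P - j" "card A \<le> card A'" by auto
    have "r P + 1 \<le> 2 * (r P - j)" "?m < r P - j" using Suc.prems by linarith+
    from achain_push_down[OF A'(1,2) this] show ?case using A'(3) le_trans
      by (metis diff_Suc_eq_diff_pred diff_commute diff_diff_left plus_1_eq_Suc add.commute)
  qed
  obtain A' where A': "achain A'" "\<forall>X\<in>A'. ?m \<le> r X \<and> r X \<le> r P - (r P - ?m)" "card A \<le> card A'"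
    using down[of "r P - ?m"] by (cases "r P") auto
  then have "A' \<subseteq> level ?m" by (force simp: achain_def level_def)
  then show ?thesis using A'(3) card_mono[OF finite_level] by (meson le_trans)
qed

end

section \<open>Modular geometric lattices as modular geometries\<close>

locale modular_geometric =
  fixes L :: "'a gorder" (structure) and rk :: "'a \<Rightarrow> nat"
  assumes mg: "modular_geometric_lattice L rk"
begin

lemma graded: "finite_graded_lattice L rk"
  using mg by (simp add: modular_geometric_lattice_def modular_lattice_def)

sublocale lattice L
  using graded by (simp add: finite_graded_lattice_def)

lemma finite_carrier: "finite (carrier L)" and carrier_nonempty: "carrier L \<noteq> {}"
  and rk_bottom: "rk \<bottom> = 0" and rk_covers: "covers L x y \<Longrightarrow> rk y = Suc (rk x)"
  using graded by (auto simp: finite_graded_lattice_def)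

lemma rk_modular:
  "x \<in> carrier L \<Longrightarrow> y \<in> carrier L \<Longrightarrow> rk x + rk y = rk (x \<sqinter> y) + rk (x \<squnion> y)"
  using mg unfolding modular_geometric_lattice_def modular_lattice_def by blast

lemma bottom_least: "least L \<bottom> (carrier L)"
proof -
  have "greatest L (\<Sqinter>(carrier L)) (Lower L (carrier L))"
    by (rule finite_inf_greatest[OF finite_carrier order_refl carrier_nonempty])
  then have "least L (\<Sqinter>(carrier L)) (carrier L)" unfolding greatest_def least_def Lower_def by blast
  then show ?thesis unfolding bottom_def by (rule someI)
qed

lemma bottom_carrier: "\<bottom> \<in> carrier L" and bottom_le: "x \<in> carrier L \<Longrightarrow> \<bottom> \<sqsubseteq> x"
  using bottom_least unfolding least_def by blast+

lemma top_ex: "\<exists>t\<in>carrier L. \<forall>x\<in>carrier L. x \<sqsubseteq> t"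
proof -
  have "least L (\<Squnion>(carrier L)) (Upper L (carrier L))"
    by (rule finite_sup_least[OF finite_carrier order_refl carrier_nonempty])
  then show ?thesis unfolding least_def Upper_def by blast
qed

lemma lless_iff: "x \<sqsubset> y \<longleftrightarrow> x \<sqsubseteq> y \<and> x \<noteq> y"
  by (simp add: lless_def eq_is_equal)

lemma atom_carrier: "a \<in> atoms L \<Longrightarrow> a \<in> carrier L"
  by (simp add: atoms_def covers_def)

text \<open>Only coverings are known to increase the rank. Any other interval is split at an inner
  element into two intervals with fewer elements.\<close>

lemma rk_strict:
  "x \<in> carrier L \<Longrightarrow> y \<in> carrier L \<Longrightarrow> x \<sqsubseteq> y \<Longrightarrow> x \<noteq> y \<Longrightarrow> rk x < rk y"
proof (induction "card {z \<in> carrier L. x \<sqsubseteq> z \<and> z \<sqsubseteq> y}" arbitrary: x y rule: less_induct)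
  case less
  show ?case
  proof (cases "covers L x y")
    case True
    then show ?thesis using rk_covers by simp
  next
    case False
    then obtain z where z: "z \<in> carrier L" "x \<sqsubseteq> z" "x \<noteq> z" "z \<sqsubseteq> y" "z \<noteq> y"
      using less.prems by (auto simp: covers_def lless_iff)
    have sub1: "{w \<in> carrier L. x \<sqsubseteq> w \<and> w \<sqsubseteq> z} \<subseteq> {w \<in> carrier L. x \<sqsubseteq> w \<and> w \<sqsubseteq> y} - {y}"
      using z less.prems le_trans[OF _ z(4)] le_antisym[OF z(4)] by auto
    have sub2: "{w \<in> carrier L. z \<sqsubseteq> w \<and> w \<sqsubseteq> y} \<subseteq> {w \<in> carrier L. x \<sqsubseteq> w \<and> w \<sqsubseteq> y} - {x}"
      using z less.prems le_trans[OF z(2)] le_antisym[OF z(2)] by auto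
    have fin: "finite {w \<in> carrier L. x \<sqsubseteq> w \<and> w \<sqsubseteq> y}" using finite_carrier by simp
    have "card {w \<in> carrier L. x \<sqsubseteq> w \<and> w \<sqsubseteq> z} < card {w \<in> carrier L. x \<sqsubseteq> w \<and> w \<sqsubseteq> y}"
      using sub1 less.prems by (intro psubset_card_mono[OF fin]) auto
    moreover have "card {w \<in> carrier L. z \<sqsubseteq> w \<and> w \<sqsubseteq> y} < card {w \<in> carrier L. x \<sqsubseteq> w \<and> w \<sqsubseteq> y}"
      using sub2 less.prems by (intro psubset_card_mono[OF fin]) auto
    ultimately have "rk x < rk z" "rk z < rk y" using less z by auto
    then show ?thesis by simp
  qed
qed

definition At :: "'a \<Rightarrow> 'a set" where "At x = {a \<in> atoms L. a \<sqsubseteq> x}"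

text \<open>The supremum is defined by choice, so its existence must be secured. For the empty set
  it is the least element, for other sets it comes from finiteness.\<close>

lemma sup_atoms:
  assumes "S \<subseteq> atoms L" shows "least L (\<Squnion>S) (Upper L S)"
proof (cases "S = {}")
  case True
  have "Upper L {} = carrier L" by (auto simp: Upper_def)
  then show ?thesis using bottom_least unfolding True sup_def by (auto intro: someI)
next
  case False
  have "S \<subseteq> carrier L" using assms atom_carrier by auto
  then show ?thesis using finite_sup_least False finite_carrier finite_subset by metis
qed

text \<open>Here atomicity enters: x is the supremum of atoms that belong to \<open>At x\<close>,
  and if these lie below y, then so does x.\<close>

lemma At_le:
  assumes "x \<in> carrier L" "y \<in> carrier L" shows "At x \<subseteq> At y \<longleftrightarrow> x \<sqsubseteq> y"
proof
  assume xy: "x \<sqsubseteq> y"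
  show "At x \<subseteq> At y"
  proof
    fix a assume "a \<in> At x"
    then have a: "a \<in> atoms L" "a \<sqsubseteq> x" by (simp_all add: At_def)
    then have "a \<sqsubseteq> y" using le_trans[OF a(2) xy atom_carrier[OF a(1)] assms] by simp
    then show "a \<in> At y" using a by (simp add: At_def)
  qed
next
  assume sub: "At x \<subseteq> At y"
  obtain S where S: "S \<subseteq> atoms L" "x = \<Squnion>S"
    using mg assms unfolding modular_geometric_lattice_def geometric_lattice_def atomic_lattice_def by blast
  note lst = sup_atoms[OF S(1), folded S(2)]
  have "a \<sqsubseteq> y" if "a \<in> S" for a
  proof -
    have a: "a \<in> atoms L" "a \<in> carrier L" using S(1) that atom_carrier by blast+
    have "x \<in> Upper L S" using lst by (simp add: least_def)
    then have "a \<sqsubseteq> x" using that a by (simp add: Upper_def)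
    then have "a \<in> At x" using a by (simp add: At_def)
    then show ?thesis using sub by (auto simp: At_def)
  qed
  then have "y \<in> Upper L S" using assms by (simp add: Upper_def)
  then show "x \<sqsubseteq> y" using lst by (simp add: least_def)
qed

lemma At_inj: "inj_on At (carrier L)"
proof (rule inj_onI)
  fix x y assume xy: "x \<in> carrier L" "y \<in> carrier L" "At x = At y"
  then have "x \<sqsubseteq> y" "y \<sqsubseteq> x" using At_le[of x y] At_le[of y x] by auto
  then show "x = y" using le_antisym xy by blast
qed

lemma At_meet:
  assumes xy: "x \<in> carrier L" "y \<in> carrier L"
  shows "At (x \<sqinter> y) = At x \<inter> At y"
proof -
  have m: "x \<sqinter> y \<in> carrier L" using meet_closed xy by simp
  have "a \<sqsubseteq> x \<sqinter> y \<longleftrightarrow> a \<sqsubseteq> x \<and> a \<sqsubseteq> y" if a: "a \<in> atoms L" for a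
  proof
    note ac = atom_carrier[OF a]
    show "a \<sqsubseteq> x \<and> a \<sqsubseteq> y" if "a \<sqsubseteq> x \<sqinter> y"
      using le_trans[OF that meet_left[OF xy] ac m xy(1)] le_trans[OF that meet_right[OF xy] ac m xy(2)]
        by simp
    show "a \<sqsubseteq> x \<sqinter> y" if "a \<sqsubseteq> x \<and> a \<sqsubseteq> y"
      using that meet_le[OF _ _ xy ac] by simp
  qed
  then show ?thesis by (auto simp: At_def)
qed

definition flat_rank :: "'a set \<Rightarrow> nat" where "flat_rank X = rk (the_inv_into (carrier L) At X)"

lemma flat_rank_At: "x \<in> carrier L \<Longrightarrow> flat_rank (At x) = rk x"
  by (simp add: flat_rank_def the_inv_into_f_f[OF At_inj])

lemma atomD: "a \<in> atoms L \<Longrightarrow> \<bottom> \<noteq> a"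
  by (simp add: atoms_def covers_def lless_iff)

lemma At_bottom: "At \<bottom> = {}"
proof -
  have "\<not> a \<sqsubseteq> \<bottom>" if "a \<in> atoms L" for a
    using that atomD[OF that] le_antisym[OF _ bottom_le] bottom_carrier atom_carrier[OF that] by metis
  then show ?thesis by (auto simp: At_def)
qed

lemma At_atom: assumes p: "p \<in> atoms L" shows "At p = {p}"
proof -
  have "a = p" if a: "a \<in> atoms L" "a \<sqsubseteq> p" for a
  proof (rule ccontr)
    assume "a \<noteq> p"
    then have "\<bottom> \<sqsubset> a" "a \<sqsubset> p"
      using a atomD[OF a(1)] bottom_le[OF atom_carrier[OF a(1)]] by (simp_all add: lless_iff)
    then show False using p atom_carrier[OF a(1)] by (auto simp: atoms_def covers_def)
  qed
  moreover have "p \<sqsubseteq> p" using atom_carrier[OF p] by simp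
  ultimately show ?thesis using p by (auto simp: At_def)
qed

text \<open>The union of the atom sets may be smaller than the atom set of the join. The join is the
  least atom set above it, as the modular axiom of the geometry requires.\<close>

lemma join_closure:
  assumes xy: "x \<in> carrier L" "y \<in> carrier L"
  shows "\<Inter>{H \<in> At ` carrier L. At x \<union> At y \<subseteq> H} = At (x \<squnion> y)"
proof
  have "At x \<union> At y \<subseteq> At (x \<squnion> y)"
    using At_le[of x "x \<squnion> y"] At_le[of y "x \<squnion> y"] join_left[OF xy] join_right[OF xy] xy by simp
  then show "\<Inter>{H \<in> At ` carrier L. At x \<union> At y \<subseteq> H} \<subseteq> At (x \<squnion> y)" using xy by auto
  have "At (x \<squnion> y) \<subseteq> At z" if "z \<in> carrier L" "At x \<union> At y \<subseteq> At z" for z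
    using that At_le[of x z] At_le[of y z] At_le[of "x \<squnion> y" z] join_le[of x z y] xy by simp
  then show "At (x \<squnion> y) \<subseteq> \<Inter>{H \<in> At ` carrier L. At x \<union> At y \<subseteq> H}" by auto
qed

sublocale geom: modular_geometry "atoms L" "At ` carrier L" flat_rank
proof
  show "finite (atoms L)" using finite_carrier atom_carrier finite_subset[of "atoms L" "carrier L"] by blast
  obtain t where t: "t \<in> carrier L" "\<forall>x\<in>carrier L. x \<sqsubseteq> t" using top_ex by auto
  then have "At t = atoms L" using atom_carrier by (auto simp: At_def)
  then show "atoms L \<in> At ` carrier L" using t by blast
  show "{} \<in> At ` carrier L" using At_bottom bottom_carrier by blast
  show "flat_rank {} = 0" using flat_rank_At[OF bottom_carrier] by (simp add: At_bottom rk_bottom)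
  show "F \<subseteq> atoms L" if "F \<in> At ` carrier L" for F using that by (auto simp: At_def)
  show "{p} \<in> At ` carrier L" if "p \<in> atoms L" for p using At_atom[OF that] atom_carrier[OF that] by blast
  show "flat_rank {p} = 1" if "p \<in> atoms L" for p
    using flat_rank_At[OF atom_carrier[OF that]] At_atom[OF that] rk_covers[of \<bottom> p] that
    by (simp add: atoms_def rk_bottom)
  fix F G assume FG: "F \<in> At ` carrier L" "G \<in> At ` carrier L"
  then obtain x y where xy: "x \<in> carrier L" "y \<in> carrier L" "F = At x" "G = At y" by blast
  have "F \<inter> G = At (x \<sqinter> y)" using At_meet xy by simp
  then show "F \<inter> G \<in> At ` carrier L" using meet_closed xy by blast
  show "flat_rank F < flat_rank G" if "F \<subset> G"
    using that At_le[of x y] rk_strict[of x y] xy by (auto simp: flat_rank_At)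
  show "flat_rank F + flat_rank G = flat_rank (F \<inter> G) +
      flat_rank (\<Inter>{H \<in> At ` carrier L. F \<union> G \<subseteq> H})"
    unfolding xy(3,4) join_closure[OF xy(1,2)] At_meet[OF xy(1,2), symmetric]
    using rk_modular[OF xy(1,2)] xy(1,2) by (simp add: flat_rank_At)
qed

end

context modular_geometric
begin

text \<open>Levels are antichains, which gives one inequality between the maxima. For the other, an
  antichain is moved by \<open>At\<close> to the geometry, where one middle level bounds its
  size.\<close>

theorem sperner: "sperner_property L rk"
proof -
  let ?S = "{card A | A. antichain L A}" and ?T = "{card (level_set L rk i) | i. True}"
  have fin: "finite (level_set L rk i)" for i using finite_carrier by (simp add: level_set_def)
  have le: "card A \<le> card (carrier L)" if "antichain L A" for A
    using that finite_carrier by (intro card_mono) (auto simp: antichain_def)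
  have finS: "finite ?S" by (rule finite_subset[of _ "{..card (carrier L)}"]) (use le in auto)
  have level: "antichain L (level_set L rk i)" for i
    unfolding antichain_def
  proof (intro conjI ballI impI)
    show "level_set L rk i \<subseteq> carrier L" by (auto simp: level_set_def)
    fix x y assume "x \<in> level_set L rk i" "y \<in> level_set L rk i" "x \<sqsubseteq> y"
    then show "x = y" using rk_strict[of x y] by (auto simp: level_set_def)
  qed
  then have sub: "?T \<subseteq> ?S" by blast
  have T: "?T \<noteq> {}" by auto
  have bound: "card A \<le> Max ?T" if A: "antichain L A" for A
  proof -
    have AL: "A \<subseteq> carrier L" using A by (simp add: antichain_def)
    have "geom.achain (At ` A)"
      unfolding geom.achain_def
    proof (intro conjI ballI impI)
      show "At ` A \<subseteq> At ` carrier L" using AL by blast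
      fix X Y assume "X \<in> At ` A" "Y \<in> At ` A" and XY: "X \<subseteq> Y"
      then obtain x y where xy: "x \<in> A" "y \<in> A" "X = At x" "Y = At y" by blast
      moreover have "x \<in> carrier L" "y \<in> carrier L" using xy AL by auto
      ultimately have "x \<sqsubseteq> y" using XY At_le[of x y] by simp
      then show "X = Y" using A xy by (auto simp: antichain_def)
    qed
    then have "card (At ` A) \<le> card (geom.level ((flat_rank (atoms L) + 1) div 2))"
      by (rule geom.achain_card_le)
    moreover have "geom.level i = At ` level_set L rk i" for i
      unfolding geom.level_def level_set_def using flat_rank_At by auto
    moreover have "card (At ` level_set L rk i) \<le> card (level_set L rk i)" for i
      by (rule card_image_le[OF fin])
    moreover have "card (At ` A) = card A"
      by (rule card_image[OF inj_on_subset[OF At_inj AL]])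
    ultimately have "card A \<le> card (level_set L rk ((flat_rank (atoms L) + 1) div 2))"
      by (metis order_trans)
    also have "\<dots> \<le> Max ?T" using finite_subset[OF sub finS] by (intro Max_ge) auto
    finally show ?thesis .
  qed
  have "Max ?S = Max ?T"
  proof (rule antisym)
    have "?S \<noteq> {}" using sub T by blast
    then have "Max ?S \<in> ?S" using finS by (rule Max_in[rotated])
    then show "Max ?S \<le> Max ?T" using bound by auto
    show "Max ?T \<le> Max ?S" by (rule Max_mono[OF sub T finS])
  qed
  then show ?thesis by (simp add: sperner_property_def)
qed

end

section \<open>Rank and closure in a matroid\<close>

context matroid
begin

abbreviation "rank \<equiv> matroid_rank F"
abbreviation "closure \<equiv> matroid_closure E F"

lemma indep_finite: "I \<in> F \<Longrightarrow> finite I"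
  using indep_subset_ground finite_ground finite_subset by blast

lemma finite_indep_cards: "finite {card I | I. I \<in> F \<and> I \<subseteq> S}"
proof (rule finite_subset)
  show "{card I | I. I \<in> F \<and> I \<subseteq> S} \<subseteq> card ` Pow E" using indep_subset_ground by blast
qed (use finite_ground in simp)

lemma rank_ge: "I \<in> F \<Longrightarrow> I \<subseteq> S \<Longrightarrow> card I \<le> rank S"
  unfolding matroid_rank_def by (rule Max_ge[OF finite_indep_cards]) blast

lemma rank_witness: "\<exists>I\<in>F. I \<subseteq> S \<and> card I = rank S"
proof -
  have "{card I | I. I \<in> F \<and> I \<subseteq> S} \<noteq> {}" using empty_indep by blast
  from Max_in[OF finite_indep_cards this] show ?thesis unfolding matroid_rank_def by auto
qed

lemma rank_mono: "S \<subseteq> T \<Longrightarrow> rank S \<le> rank T"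
  using rank_witness[of S] rank_ge[of _ T] by (metis order_trans)

lemma rank_le_card: "finite S \<Longrightarrow> rank S \<le> card S"
  using rank_witness[of S] by (metis card_mono)

lemma rank_indep: "I \<in> F \<Longrightarrow> rank I = card I"
  using rank_ge[of I I] rank_le_card[OF indep_finite] by (simp add: antisym)

lemma indep_iff_rank: assumes "finite S" shows "S \<in> F \<longleftrightarrow> rank S = card S"
proof
  assume "rank S = card S"
  then obtain I where "I \<in> F" "I \<subseteq> S" "card I = card S" using rank_witness[of S] by auto
  then show "S \<in> F" using card_subset_eq[OF assms] by metis
qed (rule rank_indep)

lemma extend_to_rank:
  assumes "I \<in> F" "I \<subseteq> S" shows "\<exists>J\<in>F. I \<subseteq> J \<and> J \<subseteq> S \<and> card J = rank S"
  using assms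
proof (induction "rank S - card I" arbitrary: I)
  case 0
  then show ?case using rank_ge[of I S] by (intro bexI[of _ I]) auto
next
  case (Suc n I)
  obtain K where K: "K \<in> F" "K \<subseteq> S" "card K = rank S" using rank_witness by blast
  then have "card I < card K" using Suc.hyps(2) by linarith
  then obtain e where e: "e \<in> K - I" "insert e I \<in> F" using augmentation[OF Suc.prems(1) K(1)] by blast
  then have "n = rank S - card (insert e I)" using Suc.hyps(2) indep_finite[OF Suc.prems(1)] by simp
  from Suc.hyps(1)[OF this e(2)] show ?case using e K Suc.prems(2) by auto
qed

lemma closure_sub: "closure S \<subseteq> E"
  by (auto simp: matroid_closure_def)

lemma closure_super: "S \<subseteq> E \<Longrightarrow> S \<subseteq> closure S"
  by (auto simp: matroid_closure_def insert_absorb)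

text \<open>If the closure had larger rank, a largest independent J in S could be augmented by some
  e of the closure, contradicting that adding e to S leaves the rank unchanged.\<close>

lemma rank_closure: "rank (closure S) = rank S" if S: "S \<subseteq> E"
proof (rule ccontr)
  assume "rank (closure S) \<noteq> rank S"
  then have lt: "rank S < rank (closure S)" using rank_mono[OF closure_super[OF S]] by simp
  obtain J where J: "J \<in> F" "J \<subseteq> S" "card J = rank S" using rank_witness by blast
  obtain K where K: "K \<in> F" "K \<subseteq> closure S" "card K = rank (closure S)" using rank_witness by blast
  obtain e where e: "e \<in> K - J" "insert e J \<in> F" using augmentation[OF J(1) K(1)] lt J K by auto
  have "card (insert e J) \<le> rank (insert e S)" using e J by (intro rank_ge) auto
  moreover have "rank (insert e S) = rank S" using e K by (auto simp: matroid_closure_def)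
  ultimately show False using e J indep_finite[OF J(1)] by simp
qed

lemma closure_bound:
  assumes "S \<subseteq> T" "T \<subseteq> E" "rank T = rank S" shows "T \<subseteq> closure S"
proof
  fix e assume e: "e \<in> T"
  have "rank S \<le> rank (insert e S)" "rank (insert e S) \<le> rank T"
    using e assms by (intro rank_mono; auto)+
  then show "e \<in> closure S" using e assms by (auto simp: matroid_closure_def)
qed

lemma closure_flat: assumes S: "S \<subseteq> E" shows "closure S \<in> flats E F"
proof -
  have "closure (closure S) \<subseteq> closure S"
  proof (rule closure_bound)
    show "S \<subseteq> closure (closure S)" using closure_super[OF S] closure_super[OF closure_sub] by blast
    show "rank (closure (closure S)) = rank S" using rank_closure[OF closure_sub] rank_closure[OF S] by simp
  qed (rule closure_sub)
  then show ?thesis using closure_super[OF closure_sub] closure_sub by (auto simp: flats_def)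
qed

text \<open>For e outside G, a largest independent J in S extends to one of G and then to one of
  insert e G, which has to contain e. Hence insert e J is independent, so e raises the rank of
  S.\<close>

lemma closure_least:
  assumes G: "G \<in> flats E F" and S: "S \<subseteq> G" shows "closure S \<subseteq> G"
proof
  fix e assume e: "e \<in> closure S"
  have GE: "G \<subseteq> E" "closure G = G" using G by (auto simp: flats_def)
  show "e \<in> G"
  proof (rule ccontr)
    assume ne: "e \<notin> G"
    then have "rank (insert e G) \<noteq> rank G" using e GE by (auto simp: matroid_closure_def)
    then have lt: "rank G < rank (insert e G)" using rank_mono[OF subset_insertI]
      by (simp add: order.not_eq_order_implies_strict)
    obtain J where J: "J \<in> F" "J \<subseteq> S" "card J = rank S" using rank_witness by blast
    obtain K where K: "K \<in> F" "J \<subseteq> K" "K \<subseteq> G" "card K = rank G" using extend_to_rank[OF J(1), of G] J S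
      by auto
    obtain K' where K': "K' \<in> F" "K \<subseteq> K'" "K' \<subseteq> insert e G" "card K' = rank (insert e G)"
      using extend_to_rank[OF K(1), of "insert e G"] K by auto
    have "e \<in> K'"
    proof (rule ccontr)
      assume "e \<notin> K'"
      then have "card K' \<le> rank G" using K' by (intro rank_ge) auto
      then show False using lt K' by simp
    qed
    then have "insert e J \<in> F" using hereditary[OF K'(1), of "insert e J"] K K' by auto
    then have "card (insert e J) \<le> rank (insert e S)" using J by (intro rank_ge) auto
    moreover have "rank (insert e S) = rank S" using e by (simp add: matroid_closure_def)
    moreover have "e \<notin> J" using J S ne by auto
    ultimately show False using J indep_finite[OF J(1)] by simp
  qed
qed

lemma bases_iff: "B \<in> bases F \<longleftrightarrow> B \<in> F \<and> card B = rank E"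
proof
  assume B: "B \<in> bases F"
  then have BF: "B \<in> F" by (simp add: bases_def)
  obtain J where "J \<in> F" "B \<subseteq> J" "card J = rank E"
    using extend_to_rank[OF BF indep_subset_ground[OF BF]] by blast
  then show "B \<in> F \<and> card B = rank E" using B BF by (auto simp: bases_def)
next
  assume B: "B \<in> F \<and> card B = rank E"
  have "I = B" if "I \<in> F" "B \<subseteq> I" for I
    using card_subset_eq[OF indep_finite[OF that(1)] that(2)] card_mono[OF indep_finite[OF that(1)] that(2)]
      rank_ge[OF that(1) indep_subset_ground[OF that(1)]] B by simp
  then show "B \<in> bases F" using B by (auto simp: bases_def)
qed

end

section \<open>The geometry of a modular matroid\<close>

locale modular_matroid = matroid E F + modular_geometric "lattice_of_flats E F" "matroid_rank F"
  for E :: "'e set" and F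
begin

abbreviation "Lf \<equiv> lattice_of_flats E F"

definition nonloops :: "'e set" where "nonloops = {e \<in> E. {e} \<in> F}"

text \<open>Parallel elements span the same rank-one flat, so this labelling of atoms need not be
  injective; loops span no atom and receive no label.\<close>

definition point :: "'e \<Rightarrow> 'e set" where "point e = closure {e}"

lemma carrier_flats: "carrier Lf = flats E F" and le_flats: "X \<sqsubseteq>\<^bsub>Lf\<^esub> Y \<longleftrightarrow> X \<subseteq> Y"
  by (simp_all add: lattice_of_flats_def)

lemma rank_one_atom:
  assumes X: "X \<in> flats E F" "rank X = 1" shows "X \<in> atoms Lf"
proof -
  have Xc: "X \<in> carrier Lf" using X by (simp add: carrier_flats)
  have "\<bottom>\<^bsub>Lf\<^esub> \<noteq> X" using rk_bottom X by auto
  then have "\<bottom>\<^bsub>Lf\<^esub> \<sqsubset>\<^bsub>Lf\<^esub> X" using bottom_le[OF Xc] by (simp add: lless_iff)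
  moreover have False if "Z \<in> carrier Lf" "\<bottom>\<^bsub>Lf\<^esub> \<sqsubset>\<^bsub>Lf\<^esub> Z" "Z \<sqsubset>\<^bsub>Lf\<^esub> X" for Z
    using that rk_strict[OF bottom_carrier that(1)] rk_strict[OF that(1) Xc] X
    by (auto simp: lless_iff)
  ultimately show ?thesis using bottom_carrier Xc unfolding atoms_def covers_def by auto
qed

lemma atom_rank: "X \<in> atoms Lf \<Longrightarrow> rank X = 1"
  using rk_covers[of "\<bottom>\<^bsub>Lf\<^esub>" X] rk_bottom by (simp add: atoms_def)

lemma point_atom: assumes "e \<in> nonloops" shows "point e \<in> atoms Lf"
proof -
  have e: "e \<in> E" "{e} \<in> F" using assms by (auto simp: nonloops_def)
  then have "rank (closure {e}) = 1" using rank_closure[of "{e}"] rank_indep[of "{e}"] by simp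
  then show ?thesis unfolding point_def using e by (intro rank_one_atom closure_flat) auto
qed

lemma point_image: "point ` nonloops = atoms Lf"
proof
  show "point ` nonloops \<subseteq> atoms Lf" using point_atom by blast
  show "atoms Lf \<subseteq> point ` nonloops"
  proof
    fix X assume X: "X \<in> atoms Lf"
    then have Xf: "X \<in> flats E F" using atom_carrier by (simp add: carrier_flats)
    obtain I where I: "I \<in> F" "I \<subseteq> X" "card I = 1" using rank_witness[of X] atom_rank[OF X] by auto
    then obtain e where e: "I = {e}" by (auto simp: card_1_singleton_iff)
    have eE: "e \<in> nonloops" using I e indep_subset_ground[OF I(1)] by (auto simp: nonloops_def)
    have "point e \<subseteq> X" unfolding point_def using I e by (intro closure_least[OF Xf]) auto
    moreover have "rank (point e) = rank X" using atom_rank[OF X] atom_rank[OF point_atom[OF eE]] by simp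
    ultimately have "point e = X"
      using rk_strict[OF atom_carrier[OF point_atom[OF eE]] atom_carrier[OF X]] by (auto simp: le_flats)
    then show "X \<in> point ` nonloops" using eE by blast
  qed
qed

text \<open>A flat contains S exactly when it contains all the points spanned by elements of S, so
  both closures are least over corresponding families.\<close>

lemma geom_cl: assumes S: "S \<subseteq> nonloops" shows "geom.cl (point ` S) = At (closure S)"
proof
  have SE: "S \<subseteq> E" using S by (auto simp: nonloops_def)
  note cS = closure_flat[OF SE]
  have "point e \<subseteq> closure S" if "e \<in> S" for e
    unfolding point_def using that closure_super[OF SE] by (intro closure_least[OF cS]) auto
  then have "point ` S \<subseteq> At (closure S)" using S point_atom by (auto simp: At_def le_flats)
  then show "geom.cl (point ` S) \<subseteq> At (closure S)"
    using cS by (intro geom.cl_least) (auto simp: carrier_flats)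
  show "At (closure S) \<subseteq> geom.cl (point ` S)"
    unfolding geom.cl_def
  proof (rule Inter_greatest)
    fix H assume "H \<in> {H \<in> At ` carrier Lf. point ` S \<subseteq> H}"
    then obtain G where G: "H = At G" "G \<in> flats E F" "point ` S \<subseteq> At G" by (auto simp: carrier_flats)
    have "S \<subseteq> G"
    proof
      fix e assume e: "e \<in> S"
      then have "point e \<subseteq> G" using G(3) by (auto simp: At_def le_flats)
      then show "e \<in> G" using closure_super[of "{e}"] e SE by (auto simp: point_def)
    qed
    then have "closure S \<subseteq> G" using closure_least[OF G(2)] by simp
    then show "At (closure S) \<subseteq> H" using At_le[of "closure S" G] cS G by (simp add: carrier_flats le_flats)
  qed
qed

lemma flat_rank_cl: "S \<subseteq> nonloops \<Longrightarrow> flat_rank (geom.cl (point ` S)) = rank S"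
proof -
  assume S: "S \<subseteq> nonloops"
  then have SE: "S \<subseteq> E" by (auto simp: nonloops_def)
  show ?thesis using geom_cl[OF S] flat_rank_At[of "closure S"] closure_flat[OF SE] rank_closure[OF SE]
    by (simp add: carrier_flats)
qed

lemma flat_rank_top: "flat_rank (atoms Lf) = rank E"
proof -
  have "closure E = E" using closure_super[of E] closure_sub[of E] by auto
  then have E: "E \<in> carrier Lf" by (simp add: carrier_flats flats_def)
  have "At E = atoms Lf" using atom_carrier by (auto simp: At_def le_flats carrier_flats flats_def)
  then show ?thesis using flat_rank_At[OF E] by simp
qed

text \<open>Bases are expressed by labels and the rank of the geometry alone, so the treatment of
  polynomials can be carried out without the matroid.\<close>

lemma bases_geom:
  "B \<in> bases F \<longleftrightarrow> B \<subseteq> nonloops \<and> card B = flat_rank (atoms Lf) \<and>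
    flat_rank (geom.cl (point ` B)) = card B"
proof -
  have "B \<subseteq> nonloops" if "B \<in> F" for B
    using that indep_subset_ground[OF that] hereditary[OF that] by (auto simp: nonloops_def)
  moreover have "finite B" if "B \<subseteq> nonloops" for B
    using that finite_ground finite_subset[of B E] by (auto simp: nonloops_def)
  ultimately show ?thesis using bases_iff flat_rank_cl flat_rank_top indep_iff_rank by metis
qed

end

section \<open>The coefficient map of a labelled geometry\<close>

lemma poly_mapping_sum_single: "p = (\<Sum>m\<in>Poly_Mapping.keys p. Poly_Mapping.single m (Poly_Mapping.lookup p m))"
proof (rule poly_mapping_eqI)
  fix n
  have "(\<Sum>m\<in>Poly_Mapping.keys p. Poly_Mapping.lookup (Poly_Mapping.single m (Poly_Mapping.lookup p m)) n) =
      (\<Sum>m\<in>Poly_Mapping.keys p. if m = n then Poly_Mapping.lookup p m else 0)"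
    by (intro sum.cong) (auto simp: lookup_single when_def)
  then show "Poly_Mapping.lookup p n =
      Poly_Mapping.lookup (\<Sum>m\<in>Poly_Mapping.keys p. Poly_Mapping.single m (Poly_Mapping.lookup p m)) n"
    by (simp add: lookup_sum in_keys_iff)
qed

text \<open>The linear extension of g from monomials to polynomials. Coefficients and
  \<open>eta\<close> are instances, and multiplication by a monomial turns into a shift of
  g.\<close>

definition ev :: "('m \<Rightarrow> 'k) \<Rightarrow> ('m \<Rightarrow>\<^sub>0 'k) \<Rightarrow> 'k::comm_ring_1" where
  "ev g p = (\<Sum>m\<in>Poly_Mapping.keys p. Poly_Mapping.lookup p m * g m)"

lemma ev_superset:
  "finite A \<Longrightarrow> Poly_Mapping.keys p \<subseteq> A \<Longrightarrow> ev g p = (\<Sum>m\<in>A. Poly_Mapping.lookup p m * g m)"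
  unfolding ev_def by (rule sum.mono_neutral_left) (auto simp: in_keys_iff)

lemma ev_zero [simp]: "ev g 0 = 0"
  by (simp add: ev_def)

lemma ev_add: "ev g (p + q) = ev g p + ev g q"
proof -
  let ?A = "Poly_Mapping.keys p \<union> Poly_Mapping.keys q"
  have "ev g (p + q) = (\<Sum>m\<in>?A. Poly_Mapping.lookup (p + q) m * g m)"
    using keys_add[of p q] by (intro ev_superset) auto
  also have "\<dots> = (\<Sum>m\<in>?A. Poly_Mapping.lookup p m * g m) + (\<Sum>m\<in>?A. Poly_Mapping.lookup q m * g m)"
    by (simp add: lookup_add distrib_right sum.distrib)
  finally show ?thesis by (simp add: ev_superset[of ?A])
qed

lemma ev_sum: "ev g (\<Sum>i\<in>I. f i) = (\<Sum>i\<in>I. ev g (f i))"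
  by (induction I rule: infinite_finite_induct) (auto simp: ev_add)

lemma ev_single [simp]: "ev g (Poly_Mapping.single m c) = c * g m"
  by (simp add: ev_def)

lemma ev_single_mult: "ev g (Poly_Mapping.single a c * p) = c * ev (\<lambda>m. g (a + m)) p"
proof -
  have "Poly_Mapping.single a c * p =
      (\<Sum>m\<in>Poly_Mapping.keys p. Poly_Mapping.single (a + m) (c * Poly_Mapping.lookup p m))"
    by (subst poly_mapping_sum_single[of p]) (simp only: sum_distrib_left mult_single)
  then have "ev g (Poly_Mapping.single a c * p) =
      (\<Sum>m\<in>Poly_Mapping.keys p. c * Poly_Mapping.lookup p m * g (a + m))"
    by (simp only: ev_sum ev_single)
  then show ?thesis by (simp add: ev_def[of "\<lambda>m. g (a + m)"] sum_distrib_left mult.assoc)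
qed

lemma ev_lookup: "ev (\<lambda>m. if m = n then 1 else 0) p = Poly_Mapping.lookup p n"
proof -
  have "ev (\<lambda>m. if m = n then 1 else 0) p =
      (\<Sum>m\<in>Poly_Mapping.keys p. if m = n then Poly_Mapping.lookup p m else 0)"
    unfolding ev_def by (intro sum.cong) auto
  then show ?thesis by (simp add: in_keys_iff)
qed

lemma ev_cong: "(\<And>m. g m = h m) \<Longrightarrow> ev g p = ev h p"
  by (simp add: ev_def)

lemma ev_sum_fun: "(\<Sum>i\<in>I. ev (g i) p) = ev (\<lambda>m. \<Sum>i\<in>I. g i m) p"
  unfolding ev_def sum_distrib_left by (rule sum.swap)

lemma lookup_const_mult: "Poly_Mapping.lookup (mconst c * f) n = c * Poly_Mapping.lookup f n"
  unfolding mconst_def ev_lookup[symmetric] ev_single_mult by simp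

section \<open>Coefficients of iterated derivatives\<close>

lemma lookup_partial_deriv_pow:
  "Poly_Mapping.lookup ((partial_deriv e ^^ k) f) n =
    (\<Prod>j<k. of_nat (Suc (Poly_Mapping.lookup n e + j))) *
      Poly_Mapping.lookup f (n + Poly_Mapping.single e k)"
proof (induction k arbitrary: n)
  case (Suc k)
  have "n + Poly_Mapping.single e 1 + Poly_Mapping.single e k = n + Poly_Mapping.single e (Suc k)"
    by (simp add: add.assoc single_add[symmetric])
  then show ?case
    by (simp add: lookup_partial_deriv Suc lookup_add prod.lessThan_Suc_shift mult.assoc del: prod.lessThan_Suc)
qed simp

lemma lookup_fold_deriv:
  fixes f :: "('e, 'k::comm_ring_1) mpoly"
  assumes "finite S"
  shows "Poly_Mapping.lookup (Finite_Set.fold (\<lambda>e. partial_deriv e ^^ w e) f S) n =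
    (\<Prod>e\<in>S. \<Prod>j<w e. of_nat (Suc (Poly_Mapping.lookup n e + j))) *
      Poly_Mapping.lookup f (n + (\<Sum>e\<in>S. Poly_Mapping.single e (w e)))"
  using assms
proof (induction S arbitrary: n)
  case (insert x S)
  interpret comp_fun_commute "\<lambda>e. (partial_deriv e :: ('e, 'k) mpoly \<Rightarrow> _) ^^ w e"
    by (rule comp_fun_commute_partial_deriv)
  have "(\<Prod>e\<in>S. \<Prod>j<w e. of_nat (Suc (Poly_Mapping.lookup (n + Poly_Mapping.single x (w x)) e + j))) =
      (\<Prod>e\<in>S. \<Prod>j<w e. of_nat (Suc (Poly_Mapping.lookup n e + j)) :: 'k)"
    using insert.hyps by (intro prod.cong refl) (auto simp: lookup_add lookup_single when_def)
  then show ?case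
    using insert by (simp add: fold_insert lookup_partial_deriv_pow mult.assoc add.assoc del: of_nat_Suc)
qed simp

text \<open>The products are the rising factorials left by differentiating powers. For squarefree n
  + m every factor is 1, the case that matters for the basis polynomial.\<close>

lemma lookup_monomial_deriv:
  "Poly_Mapping.lookup (monomial_deriv m f) n =
    (\<Prod>e\<in>Poly_Mapping.keys m. \<Prod>j<Poly_Mapping.lookup m e. of_nat (Suc (Poly_Mapping.lookup n e + j))) *
      Poly_Mapping.lookup f (n + m)"
  using lookup_fold_deriv[OF finite_keys, of "Poly_Mapping.lookup m" f m n]
  by (simp only: monomial_deriv_def poly_mapping_sum_single[of m, symmetric])

abbreviation mdeg :: "('e \<Rightarrow>\<^sub>0 nat) \<Rightarrow> nat" where
  "mdeg m \<equiv> (\<Sum>e\<in>Poly_Mapping.keys m. Poly_Mapping.lookup m e)"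

lemma keys_add_nat: "Poly_Mapping.keys (m + n) = Poly_Mapping.keys m \<union> Poly_Mapping.keys (n :: 'e \<Rightarrow>\<^sub>0 nat)"
  by (auto simp: in_keys_iff lookup_add)

lemma mdeg_add: "mdeg (m + n) = mdeg m + mdeg n"
proof -
  let ?A = "Poly_Mapping.keys m \<union> Poly_Mapping.keys n"
  have "mdeg m = (\<Sum>e\<in>?A. Poly_Mapping.lookup m e)" "mdeg n = (\<Sum>e\<in>?A. Poly_Mapping.lookup n e)"
    by (auto intro!: sum.mono_neutral_left simp: in_keys_iff)
  then show ?thesis by (simp add: keys_add_nat lookup_add sum.distrib)
qed

lemma mdeg_single [simp]: "mdeg (Poly_Mapping.single e k) = k"
  by simp

lemma card_keys_le: "card (Poly_Mapping.keys m) \<le> mdeg m"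
proof -
  have "(\<Sum>e\<in>Poly_Mapping.keys m. 1) \<le> mdeg m" by (rule sum_mono) (simp add: in_keys_iff Suc_le_eq)
  then show ?thesis by simp
qed

lemma exponent_cases:
  fixes m :: "'e \<Rightarrow>\<^sub>0 nat"
  assumes "m \<noteq> 0" obtains e n where "m = Poly_Mapping.single e 1 + n" "e \<in> Poly_Mapping.keys m"
proof -
  obtain e where e: "e \<in> Poly_Mapping.keys m" using assms by fastforce
  have "m = Poly_Mapping.single e 1 + (m - Poly_Mapping.single e 1)"
    using e by (intro poly_mapping_eqI) (auto simp: lookup_add lookup_minus lookup_single in_keys_iff when_def)
  then show ?thesis using that e by blast
qed

lemma monomial_induct [case_names zero add]:
  assumes "Q 0" "\<And>e n. Q n \<Longrightarrow> Q (Poly_Mapping.single e 1 + n)" shows "Q (m :: 'e \<Rightarrow>\<^sub>0 nat)"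
proof (induction "mdeg m" arbitrary: m rule: less_induct)
  case less
  show ?case
  proof (cases "m = 0")
    case False
    then obtain e n where m: "m = Poly_Mapping.single e 1 + n" by (rule exponent_cases)
    have "mdeg n < mdeg m" unfolding m mdeg_add by simp
    then show ?thesis using less assms(2) m by blast
  qed (simp add: assms(1))
qed

lemma mvar_mult_single:
  "Poly_Mapping.single (Poly_Mapping.single e 1 + n) 1 * p = mvar e * (Poly_Mapping.single n 1 * p)"
  by (simp add: mvar_def mult_single mult.assoc[symmetric])

section \<open>Monomials and the flats they span\<close>

text \<open>Variables in E0 are labelled by points, possibly several by the same one; the other
  variables of E model loops.\<close>

locale labelled_geometry = modular_geometry P L r
  for P :: "'p set" and L :: "'p set set" and r :: "'p set \<Rightarrow> nat" +
  fixes E E0 :: "'e set" and \<pi> :: "'e \<Rightarrow> 'p"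
  assumes finite_E: "finite E" and E0_sub: "E0 \<subseteq> E" and label: "\<pi> ` E0 = P"
begin

definition flat :: "('e \<Rightarrow>\<^sub>0 nat) \<Rightarrow> 'p set" where
  "flat m = cl (\<pi> ` Poly_Mapping.keys m)"

text \<open>The rank is at most the number of variables occurring, which is at most the degree.
  Equality thus encodes at once that the monomial is squarefree and that its points are
  independent.\<close>

definition indep :: "('e \<Rightarrow>\<^sub>0 nat) \<Rightarrow> bool" where
  "indep m \<longleftrightarrow> Poly_Mapping.keys m \<subseteq> E0 \<and> r (flat m) = mdeg m"

definition eta :: "('e, 'k::field_char_0) mpoly \<Rightarrow> 'p set \<Rightarrow> 'k" where
  "eta p Z = ev (\<lambda>m. if indep m \<and> flat m = Z then 1 else 0) p"

lemma flat_L: "Poly_Mapping.keys m \<subseteq> E0 \<Longrightarrow> flat m \<in> L"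
  unfolding flat_def using label by (intro cl_L) blast

lemma cl_insert_cl: "S \<subseteq> P \<Longrightarrow> p \<in> P \<Longrightarrow> cl (insert p (cl S)) = cl (insert p S)"
proof
  assume S: "S \<subseteq> P" "p \<in> P"
  have L: "cl (insert p S) \<in> L" using S by (intro cl_L) auto
  show "cl (insert p (cl S)) \<subseteq> cl (insert p S)"
    using cl_super[of "insert p S"] cl_mono[of S "insert p S"] by (intro cl_least[OF L]) auto
  show "cl (insert p S) \<subseteq> cl (insert p (cl S))"
    using cl_super[of S] by (intro cl_mono) auto
qed

lemma r_cl_insert: "X \<in> L \<Longrightarrow> p \<in> P \<Longrightarrow> r (cl (insert p X)) = (if p \<in> X then r X else Suc (r X))"
  using cover_insert[of X p] cl_flat[of X] by (auto simp: insert_absorb cover_def)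

lemma flat_insert:
  assumes "e \<in> E0" "Poly_Mapping.keys m \<subseteq> E0"
  shows "flat (Poly_Mapping.single e 1 + m) = cl (insert (\<pi> e) (flat m))"
proof -
  have "\<pi> ` Poly_Mapping.keys m \<subseteq> P" "\<pi> e \<in> P" using assms label by auto
  then show ?thesis using cl_insert_cl by (simp add: flat_def keys_add_nat)
qed

lemma r_flat_le: "Poly_Mapping.keys m \<subseteq> E0 \<Longrightarrow> r (flat m) \<le> card (Poly_Mapping.keys m)"
proof -
  have "r (cl (\<pi> ` S)) \<le> card S" if "finite S" "S \<subseteq> E0" for S
    using that
  proof (induction S)
    case empty
    then show ?case using cl_flat[OF empty_L] r_empty by simp
  next
    case (insert e S)
    have P: "\<pi> ` S \<subseteq> P" "\<pi> e \<in> P" using insert.prems label by auto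
    have "r (cl (insert (\<pi> e) (\<pi> ` S))) = r (cl (insert (\<pi> e) (cl (\<pi> ` S))))"
      using cl_insert_cl[OF P] by simp
    also have "\<dots> \<le> Suc (r (cl (\<pi> ` S)))" using r_cl_insert[OF cl_L[OF P(1)] P(2)] by simp
    finally show ?case using insert by simp
  qed
  then show "Poly_Mapping.keys m \<subseteq> E0 \<Longrightarrow> ?thesis" by (simp add: flat_def)
qed

lemma indep_step:
  "indep (Poly_Mapping.single e 1 + m) \<longleftrightarrow> e \<in> E0 \<and> indep m \<and> \<pi> e \<notin> flat m"
proof (cases "e \<in> E0 \<and> Poly_Mapping.keys m \<subseteq> E0")
  case True
  then have e: "e \<in> E0" "Poly_Mapping.keys m \<subseteq> E0" "\<pi> e \<in> P" using label by auto
  have "r (flat (Poly_Mapping.single e 1 + m)) = (if \<pi> e \<in> flat m then r (flat m) else Suc (r (flat m)))"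
    using flat_insert[OF e(1,2)] r_cl_insert[OF flat_L[OF e(2)] e(3)] by simp
  moreover have "mdeg (Poly_Mapping.single e 1 + m) = Suc (mdeg m)" unfolding mdeg_add by simp
  moreover have "r (flat m) \<le> mdeg m" using r_flat_le[OF e(2)] card_keys_le[of m] by linarith
  ultimately show ?thesis using e by (auto simp: indep_def keys_add_nat)
next
  case False
  then show ?thesis by (auto simp: indep_def keys_add_nat)
qed

lemma indep_squarefree: assumes "indep m" shows "Poly_Mapping.lookup m e \<le> 1"
proof (rule ccontr)
  assume e: "\<not> Poly_Mapping.lookup m e \<le> 1"
  then have ek: "e \<in> Poly_Mapping.keys m" by (auto simp: in_keys_iff)
  have "(\<Sum>e\<in>Poly_Mapping.keys m. 1) < mdeg m"
  proof (rule sum_strict_mono_ex1)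
    show "\<exists>a\<in>Poly_Mapping.keys m. 1 < Poly_Mapping.lookup m a" using ek e by (intro bexI[of _ e]) auto
  qed (auto simp: in_keys_iff Suc_le_eq)
  then show False using assms r_flat_le[of m] by (simp add: indep_def)
qed

lemma eta_add: "eta (p + p') = (\<lambda>Z. eta p Z + eta p' Z)"
  by (simp add: eta_def ev_add fun_eq_iff)

lemma eta_zero: "eta 0 = (\<lambda>Z. 0)"
  by (simp add: eta_def fun_eq_iff)

lemma eta_sum: "eta (\<Sum>i\<in>I. f i) = (\<lambda>Z. \<Sum>i\<in>I. eta (f i) Z)"
  by (simp add: eta_def ev_sum fun_eq_iff)

lemma eta_single: "eta (Poly_Mapping.single m c) = (\<lambda>Z. if indep m \<and> flat m = Z then c else 0)"
  by (simp add: eta_def fun_eq_iff)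

lemma eta_const_mult: "eta (Poly_Mapping.single 0 c * p) = (\<lambda>Z. c * eta p Z)"
  by (simp add: eta_def ev_single_mult fun_eq_iff)

lemma eta_uminus: "eta (- p) = (\<lambda>Z. - eta p Z)"
  using eta_add[of p "- p"] by (simp add: eta_zero fun_eq_iff eq_neg_iff_add_eq_0 add.commute)

lemma eta_diff: "eta (p - p') = (\<lambda>Z. eta p Z - eta p' Z)"
  using eta_add[of p "- p'"] by (simp add: eta_uminus)

text \<open>Multiplication by a variable keeps a monomial independent exactly when its point lies
  outside the flat, and then adds that point to the flat; \<open>pmul\<close> records this.
  Variables without a label destroy independence.\<close>

lemma eta_var:
  fixes p :: "('e, 'k::field_char_0) mpoly"
  shows "eta (mvar e * p) = (if e \<in> E0 then pmul (\<pi> e) (eta p) else (\<lambda>_. 0))"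
proof
  fix G
  have 1: "eta (mvar e * p) G = ev (\<lambda>m. if indep (Poly_Mapping.single e 1 + m) \<and>
      flat (Poly_Mapping.single e 1 + m) = G then 1 else 0) p"
    by (simp add: eta_def mvar_def ev_single_mult)
  show "eta (mvar e * p) G = (if e \<in> E0 then pmul (\<pi> e) (eta p) else (\<lambda>_. 0)) G"
  proof (cases "e \<in> E0")
    case False
    then show ?thesis unfolding 1 by (simp add: indep_step ev_def del: One_nat_def)
  next
    case True
    then have eP: "\<pi> e \<in> P" using label by blast
    let ?A = "{F. cover F G \<and> \<pi> e \<in> G \<and> \<pi> e \<notin> F}"
    have finA: "finite ?A" by (rule finite_subset[OF _ finite_L]) (auto simp: cover_def)
    have "pmul (\<pi> e) (eta p) G = ev (\<lambda>m. \<Sum>F\<in>?A. if indep m \<and> flat m = F then 1 else 0) p"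
      unfolding pmul_def eta_def by (rule ev_sum_fun)
    also have "\<dots> = eta (mvar e * p) G"
      unfolding 1
    proof (rule ev_cong)
      fix m
      have "(\<Sum>F\<in>?A. if indep m \<and> flat m = F then 1 else 0 :: 'k) =
          (if indep m \<and> flat m \<in> ?A then 1 else 0)"
        using finA by (cases "indep m") simp_all
      moreover have "indep m \<and> flat m \<in> ?A \<longleftrightarrow>
          indep (Poly_Mapping.single e 1 + m) \<and> flat (Poly_Mapping.single e 1 + m) = G"
      proof (cases "indep m \<and> \<pi> e \<notin> flat m")
        case True
        then have k: "Poly_Mapping.keys m \<subseteq> E0" by (simp add: indep_def)
        have "cover (flat m) G \<and> \<pi> e \<in> G \<longleftrightarrow> cl (insert (\<pi> e) (flat m)) = G"
          using cover_cl[of "flat m" G "\<pi> e"] cover_insert[OF flat_L[OF k] eP] cl_super[of "insert (\<pi> e) (flat m)"] True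
          by auto
        then show ?thesis using True \<open>e \<in> E0\<close> flat_insert[OF _ k] by (simp add: indep_step del: One_nat_def)
      next
        case False
        then show ?thesis by (auto simp: indep_step simp del: One_nat_def)
      qed
      ultimately show "(\<Sum>F\<in>?A. if indep m \<and> flat m = F then 1 else 0 :: 'k) =
        (if indep (Poly_Mapping.single e 1 + m) \<and> flat (Poly_Mapping.single e 1 + m) = G then 1 else 0)"
        by simp
    qed
    finally show ?thesis using True by simp
  qed
qed

lemma pmul_zero: "pmul p (\<lambda>_. 0) = (\<lambda>_. 0)"
  by (rule ext) (simp add: pmul_def)

lemma eta_kernel_mult:
  assumes "eta p = (\<lambda>_. 0)" shows "eta (s * p) = (\<lambda>_. 0)"
proof -
  have 1: "eta (Poly_Mapping.single n 1 * p) = (\<lambda>_. 0)" for n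
  proof (induction n rule: monomial_induct)
    case zero
    then show ?case using assms by (simp add: eta_const_mult)
  next
    case (add e n)
    then show ?case unfolding mvar_mult_single eta_var by (simp add: pmul_zero)
  qed
  have "eta (Poly_Mapping.single n c * p) = (\<lambda>_. 0)" for n c
  proof -
    have "Poly_Mapping.single n c * p = Poly_Mapping.single 0 c * (Poly_Mapping.single n 1 * p)"
      by (simp add: mult_single mult.assoc[symmetric])
    then show ?thesis by (simp add: eta_const_mult 1)
  qed
  then have "eta (\<Sum>n\<in>Poly_Mapping.keys s. Poly_Mapping.single n (Poly_Mapping.lookup s n) * p) = (\<lambda>_. 0)"
    by (simp add: eta_sum)
  then show ?thesis unfolding sum_distrib_right[symmetric] poly_mapping_sum_single[of s, symmetric] .
qed

text \<open>By \<open>socle\<close> some variable carries a nonzero value from a flat below P to one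
  of the next rank; repetition ends at P.\<close>

lemma eta_top:
  assumes "F \<in> L" "eta (Poly_Mapping.single n 1 * p) F \<noteq> 0"
  shows "\<exists>n. eta (Poly_Mapping.single n 1 * p) P \<noteq> 0"
  using assms
proof (induction "r P - r F" arbitrary: F n)
  case 0
  have "r F \<le> r P" using r_mono[OF 0(2) P_L L_sub[OF 0(2)]] .
  then have "F = P" using r_eqD[OF 0(2) P_L L_sub[OF 0(2)]] 0(1) by simp
  then show ?case using 0 by blast
next
  case (Suc k)
  then have "F \<noteq> P" by auto
  then obtain p' G
    where G: "p' \<in> P" "cover F G" "pmul p' (eta (Poly_Mapping.single n 1 * p)) G \<noteq> 0"
    using socle[of F "eta (Poly_Mapping.single n 1 * p)"] Suc.prems by blast
  obtain e where e: "e \<in> E0" "\<pi> e = p'" using G(1) label by blast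
  have "eta (Poly_Mapping.single (Poly_Mapping.single e 1 + n) 1 * p) G \<noteq> 0"
    unfolding mvar_mult_single eta_var using e G(3) by simp
  moreover have "k = r P - r G" "G \<in> L" using Suc.hyps(2) G(2) by (auto simp: cover_def)
  ultimately show ?case using Suc.hyps(1) by blast
qed

lemma eta_outside: "F \<notin> L \<Longrightarrow> eta p F = 0"
  unfolding eta_def ev_def by (intro sum.neutral) (auto simp: indep_def dest: flat_L)

theorem eta_kernel_iff:
  "eta p = (\<lambda>_. 0) \<longleftrightarrow> (\<forall>n. eta (Poly_Mapping.single n 1 * p) P = 0)"
proof
  assume a: "\<forall>n. eta (Poly_Mapping.single n 1 * p) P = 0"
  show "eta p = (\<lambda>_. 0)"
  proof (rule ccontr)
    assume "eta p \<noteq> (\<lambda>_. 0)"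
    then obtain F where F: "eta p F \<noteq> 0" by auto
    then have "F \<in> L" using eta_outside by blast
    moreover have "eta (Poly_Mapping.single 0 1 * p) F \<noteq> 0" using F by (simp add: eta_const_mult)
    ultimately show False using eta_top a by blast
  qed
next
  assume "eta p = (\<lambda>_. 0)"
  then have "eta (Poly_Mapping.single n 1 * p) = (\<lambda>_. 0)" for n by (rule eta_kernel_mult)
  then show "\<forall>n. eta (Poly_Mapping.single n 1 * p) P = 0" by simp
qed

lemma indep_top: assumes "indep m" shows "flat m = P \<longleftrightarrow> mdeg m = r P"
proof -
  have FL: "flat m \<in> L" "r (flat m) = mdeg m" using assms flat_L by (auto simp: indep_def)
  show ?thesis
  proof
    assume "mdeg m = r P"
    then show "flat m = P" using FL(2) by (intro r_eqD[OF FL(1) P_L L_sub[OF FL(1)]]) linarith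
  qed (use FL(2) in simp)
qed

text \<open>The coefficient of the derivative at n sums those coefficients of p whose monomial m
  makes n + m a monomial of the basis polynomial; this is the value at P of \<open>eta\<close>
  applied to x^n p. As n + m is squarefree, differentiation contributes the factor 1.\<close>

theorem diff_action_zero_iff:
  fixes \<Phi> :: "('e, 'k::field_char_0) mpoly"
  assumes \<Phi>: "\<And>m. Poly_Mapping.lookup \<Phi> m = (if indep m \<and> mdeg m = r P then 1 else 0)"
  shows "diff_action p \<Phi> = 0 \<longleftrightarrow> eta p = (\<lambda>_. 0)"
proof -
  have "Poly_Mapping.lookup (diff_action p \<Phi>) n = eta (Poly_Mapping.single n 1 * p) P" for n
  proof -
    have "Poly_Mapping.lookup (monomial_deriv m \<Phi>) n = (if indep (n + m) \<and> flat (n + m) = P then 1 else 0)" for m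
    proof (cases "indep (n + m) \<and> mdeg (n + m) = r P")
      case True
      have "(\<Prod>j<Poly_Mapping.lookup m e. of_nat (Suc (Poly_Mapping.lookup n e + j))) = (1 :: 'k)"
        if "e \<in> Poly_Mapping.keys m" for e
      proof -
        have "Poly_Mapping.lookup n e + Poly_Mapping.lookup m e \<le> 1" "Poly_Mapping.lookup m e \<noteq> 0"
          using indep_squarefree[of "n + m" e] True that by (auto simp: lookup_add in_keys_iff)
        then have "Poly_Mapping.lookup n e = 0" "Poly_Mapping.lookup m e = 1" by linarith+
        then show ?thesis by simp
      qed
      then show ?thesis using True indep_top[of "n + m"]
        by (simp add: lookup_monomial_deriv \<Phi> del: of_nat_Suc)
    next
      case False
      then show ?thesis using indep_top[of "n + m"] by (auto simp: lookup_monomial_deriv \<Phi>)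
    qed
    then have "Poly_Mapping.lookup (diff_action p \<Phi>) n =
        ev (\<lambda>m. if indep (n + m) \<and> flat (n + m) = P then 1 else 0) p"
      by (simp add: diff_action_def lookup_sum lookup_const_mult ev_def)
    then show ?thesis by (simp add: eta_def ev_single_mult)
  qed
  then show ?thesis unfolding eta_kernel_iff by (metis lookup_zero poly_mapping_eqI)
qed

end

section \<open>The quotient algebra\<close>

lemma poly_ring_simps [simp]:
  "mult (poly_ring E) = (*)" "one (poly_ring E) = 1" "zero (poly_ring E) = 0" "add (poly_ring E) = (+)"
  by (simp_all add: poly_ring_def)

lemma poly_carrier: "p \<in> carrier (poly_ring E) \<longleftrightarrow> (\<forall>m\<in>Poly_Mapping.keys p. Poly_Mapping.keys m \<subseteq> E)"
  by (simp add: poly_ring_def)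

lemma poly_carrier_add:
  "p \<in> carrier (poly_ring E) \<Longrightarrow> p' \<in> carrier (poly_ring E) \<Longrightarrow> p + p' \<in> carrier (poly_ring E)"
  unfolding poly_carrier using keys_add[of p p'] by blast

lemma poly_carrier_mult:
  assumes "p \<in> carrier (poly_ring E)" "p' \<in> carrier (poly_ring E)" shows "p * p' \<in> carrier (poly_ring E)"
  unfolding poly_carrier
proof
  fix m assume "m \<in> Poly_Mapping.keys (p * p')"
  then obtain a b where "m = a + b" "a \<in> Poly_Mapping.keys p" "b \<in> Poly_Mapping.keys p'"
    using keys_mult[of p p'] by blast
  then show "Poly_Mapping.keys m \<subseteq> E" using assms by (simp add: poly_carrier keys_add_nat)
qed

lemma poly_carrier_zero: "0 \<in> carrier (poly_ring E)"
  by (simp add: poly_carrier)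

lemma poly_carrier_one: "(1 :: ('e, 'k::comm_ring_1) mpoly) \<in> carrier (poly_ring E)"
  using single_one[where ?'a = "'e \<Rightarrow>\<^sub>0 nat" and ?'b = 'k]
    by (metis poly_carrier keys_single keys_zero empty_iff empty_subsetI singletonD)

lemma poly_carrier_uminus: "p \<in> carrier (poly_ring E) \<Longrightarrow> - p \<in> carrier (poly_ring E)"
  by (simp add: poly_carrier)

lemma cring_poly_ring: "cring (poly_ring E :: ('e, 'k::comm_ring_1) mpoly ring)"
proof (rule cringI)
  show "abelian_group (poly_ring E :: ('e, 'k) mpoly ring)"
  proof (rule abelian_groupI)
    show "\<exists>y\<in>carrier (poly_ring E). y \<oplus>\<^bsub>poly_ring E\<^esub> x = \<zero>\<^bsub>poly_ring E\<^esub>"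
      if "x \<in> carrier (poly_ring E)" for x :: "('e, 'k) mpoly"
      using poly_carrier_uminus[OF that] by (intro bexI[of _ "- x"]) auto
  qed (auto simp: poly_carrier_add poly_carrier_zero algebra_simps)
  show "comm_monoid (poly_ring E :: ('e, 'k) mpoly ring)"
    by (rule comm_monoidI) (auto simp: poly_carrier_mult poly_carrier_one algebra_simps)
qed (simp add: algebra_simps)

lemma poly_ring_minus:
  fixes p :: "('e, 'k::comm_ring_1) mpoly"
  assumes "p \<in> carrier (poly_ring E)" "p' \<in> carrier (poly_ring E)"
  shows "p \<ominus>\<^bsub>poly_ring E\<^esub> p' = p - p'"
proof -
  interpret cring "poly_ring E :: ('e, 'k) mpoly ring" by (rule cring_poly_ring)
  have "\<ominus>\<^bsub>poly_ring E\<^esub> p' = - p'"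
    using minus_equality[of "- p'" p'] assms poly_carrier_uminus[OF assms(2)] by simp
  then show ?thesis by (simp add: a_minus_def)
qed

lemma homog_iff: "p \<in> homogeneous_polys E d \<longleftrightarrow>
    p \<in> carrier (poly_ring E) \<and> (\<forall>m\<in>Poly_Mapping.keys p. mdeg m = d)"
  by (simp add: homogeneous_polys_def)

lemma homog_zero: "0 \<in> homogeneous_polys E d"
  by (simp add: homog_iff poly_carrier_zero)

lemma homog_add: "p \<in> homogeneous_polys E d \<Longrightarrow> p' \<in> homogeneous_polys E d \<Longrightarrow> p + p' \<in> homogeneous_polys E d"
  unfolding homog_iff using keys_add[of p p'] poly_carrier_add by blast

lemma homog_uminus: "p \<in> homogeneous_polys E d \<Longrightarrow> - p \<in> homogeneous_polys E d"
  by (simp add: homog_iff poly_carrier_uminus)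

lemma homog_sum: "(\<And>i. i \<in> I \<Longrightarrow> f i \<in> homogeneous_polys E d) \<Longrightarrow> (\<Sum>i\<in>I. f i) \<in> homogeneous_polys E d"
  by (induction I rule: infinite_finite_induct) (auto simp: homog_zero homog_add)

lemma homog_mult:
  assumes "p \<in> homogeneous_polys E i" "p' \<in> homogeneous_polys E j" shows "p * p' \<in> homogeneous_polys E (i + j)"
  unfolding homog_iff
proof (intro conjI ballI)
  show "p * p' \<in> carrier (poly_ring E)" using assms by (simp add: homog_iff poly_carrier_mult)
  fix m assume "m \<in> Poly_Mapping.keys (p * p')"
  then obtain a b where "m = a + b" "a \<in> Poly_Mapping.keys p" "b \<in> Poly_Mapping.keys p'"
    using keys_mult[of p p'] by blast
  then show "mdeg m = i + j" using assms unfolding homog_iff by (simp only: mdeg_add)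
qed

lemma homog_single: "Poly_Mapping.keys m \<subseteq> E \<Longrightarrow> Poly_Mapping.single m c \<in> homogeneous_polys E (mdeg m)"
  by (simp add: homog_iff poly_carrier)

lemma homog_one: "(1 :: ('e, 'k::comm_ring_1) mpoly) \<in> homogeneous_polys E 0"
  using homog_single[of 0 E "1 :: 'k"] by simp

lemma homog_pow: "p \<in> homogeneous_polys E 1 \<Longrightarrow> p ^ m \<in> homogeneous_polys E m"
proof (induction m)
  case (Suc m)
  then show ?case using homog_mult[of p E 1 "p ^ m" m] by simp
qed (simp add: homog_one)

context labelled_geometry
begin

lemma eta_supported_L: "eta p \<in> supported L"
  by (simp add: supported_def eta_outside)

lemma eta_homog:
  assumes "p \<in> homogeneous_polys E d" shows "eta p \<in> supported (level d)"
  unfolding supported_def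
proof (intro CollectI allI impI)
  fix Z assume Z: "Z \<notin> level d"
  have "\<not> (indep m \<and> flat m = Z)" if "m \<in> Poly_Mapping.keys p" for m
    using that assms Z flat_L[of m] by (auto simp: homog_iff indep_def level_def)
  then show "eta p Z = 0" unfolding eta_def ev_def by (intro sum.neutral) auto
qed

lemma monomial_ex: "Z \<in> L \<Longrightarrow> \<exists>m. indep m \<and> flat m = Z"
proof (induction "r Z" arbitrary: Z)
  case 0
  then have "Z = {}" using rank_zero[OF 0(2)] by simp
  then show ?case using cl_flat[OF empty_L] r_empty by (intro exI[of _ 0]) (simp add: indep_def flat_def)
next
  case (Suc k)
  then have "Z \<noteq> {}" using r_empty by auto
  then obtain K where K: "cover K Z" using lower_cover_ex[OF Suc.prems] by blast
  then have "K \<in> L" "k = r K" using Suc.hyps(2) by (auto simp: cover_def)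
  then obtain m where m: "indep m" "flat m = K" using Suc.hyps(1) by blast
  obtain p where p: "p \<in> Z" "p \<notin> K" using cover_ex[OF K] .
  then obtain e where e: "e \<in> E0" "\<pi> e = p" using L_sub[OF Suc.prems] label by blast
  have "indep (Poly_Mapping.single e 1 + m)" using indep_step[of e m] m e p by simp
  moreover have "flat (Poly_Mapping.single e 1 + m) = Z"
    using flat_insert[OF e(1), of m] m e cover_cl[OF K p] by (simp add: indep_def)
  ultimately show ?case by blast
qed

text \<open>One independent monomial for each flat of rank d suffices, since \<open>eta\<close>
  sends it to the delta function of that flat.\<close>

lemma eta_surj:
  assumes f: "f \<in> supported (level d)" shows "\<exists>p\<in>homogeneous_polys E d. eta p = f"
proof -
  define mon where "mon Z = (SOME m. indep m \<and> flat m = Z)" for Z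
  have mon: "indep (mon Z)" "flat (mon Z) = Z" if "Z \<in> L" for Z
    using someI_ex[OF monomial_ex[OF that]] by (auto simp: mon_def)
  define p where "p = (\<Sum>Z\<in>level d. Poly_Mapping.single (mon Z) (f Z))"
  have "Poly_Mapping.single (mon Z) (f Z) \<in> homogeneous_polys E d" if "Z \<in> level d" for Z
  proof -
    have Z: "Z \<in> L" "r Z = d" using that by (auto simp: level_def)
    have "Poly_Mapping.keys (mon Z) \<subseteq> E" "mdeg (mon Z) = d"
      using mon[OF Z(1)] Z E0_sub by (auto simp: indep_def)
    then show ?thesis using homog_single[of "mon Z" E "f Z"] by simp
  qed
  then have "p \<in> homogeneous_polys E d" unfolding p_def by (rule homog_sum)
  moreover have "eta p = f"
  proof
    fix Y
    have "eta p Y = (\<Sum>Z\<in>level d. if Z = Y then f Z else 0)"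
      unfolding p_def eta_sum eta_single using mon by (intro sum.cong) (auto simp: level_def)
    then show "eta p Y = f Y" using f finite_level[of d] by (simp add: supported_def)
  qed
  ultimately show ?thesis by blast
qed

definition ker :: "('e, 'k::field_char_0) mpoly set" where
  "ker = {p \<in> carrier (poly_ring E). eta p = (\<lambda>_. 0)}"

definition coset :: "('e, 'k::field_char_0) mpoly \<Rightarrow> ('e, 'k) mpoly set" where
  "coset p = ker +>\<^bsub>poly_ring E\<^esub> p"

definition alg :: "('e, 'k::field_char_0) mpoly set ring" where
  "alg = poly_ring E Quot ker"

lemma ideal_ker: "ideal (ker :: ('e, 'k::field_char_0) mpoly set) (poly_ring E)"
proof -
  interpret cring "poly_ring E :: ('e, 'k) mpoly ring" by (rule cring_poly_ring)
  have minus: "\<ominus>\<^bsub>poly_ring E\<^esub> p = - p" if "p \<in> carrier (poly_ring E)" for p :: "('e, 'k) mpoly"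
    using minus_equality[of "- p" p] that poly_carrier_uminus[OF that] by simp
  show ?thesis
  proof (rule idealI)
    show "ring (poly_ring E :: ('e, 'k) mpoly ring)" by (rule ring_axioms)
    show "subgroup ker (add_monoid (poly_ring E :: ('e, 'k) mpoly ring))"
    proof (rule group.subgroupI[OF a_group])
      show "ker \<subseteq> carrier (add_monoid (poly_ring E :: ('e, 'k) mpoly ring))" by (auto simp: ker_def)
      have "(0 :: ('e, 'k) mpoly) \<in> ker" by (simp add: ker_def poly_carrier_zero eta_zero)
      then show "(ker :: ('e, 'k) mpoly set) \<noteq> {}" by blast
      fix a assume a: "a \<in> (ker :: ('e, 'k) mpoly set)"
      then have "inv\<^bsub>add_monoid (poly_ring E)\<^esub> a = - a" using minus[of a] by (simp add: a_inv_def ker_def)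
      then show "inv\<^bsub>add_monoid (poly_ring E)\<^esub> a \<in> ker"
        using a by (simp add: ker_def poly_carrier_uminus eta_uminus)
      fix b assume "b \<in> (ker :: ('e, 'k) mpoly set)"
      then show "a \<otimes>\<^bsub>add_monoid (poly_ring E)\<^esub> b \<in> ker"
        using a by (simp add: ker_def poly_carrier_add eta_add)
    qed
    fix a x :: "('e, 'k) mpoly"
    assume "a \<in> ker" "x \<in> carrier (poly_ring E)"
    then show "x \<otimes>\<^bsub>poly_ring E\<^esub> a \<in> ker" "a \<otimes>\<^bsub>poly_ring E\<^esub> x \<in> ker"
      by (simp_all add: ker_def poly_carrier_mult eta_kernel_mult mult.commute[of a])
  qed
qed

lemma coset_hom: "ring_hom_ring (poly_ring E) alg (coset :: ('e, 'k::field_char_0) mpoly \<Rightarrow> _)"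
  using ideal.rcos_ring_hom_ring[OF ideal_ker] by (simp add: coset_def[abs_def] alg_def)

lemma cring_alg: "cring (alg :: ('e, 'k::field_char_0) mpoly set ring)"
  unfolding alg_def by (rule ideal.quotient_is_cring[OF ideal_ker cring_poly_ring])

lemma carrier_alg: "carrier (alg :: ('e, 'k::field_char_0) mpoly set ring) = coset ` carrier (poly_ring E)"
  by (auto simp: alg_def FactRing_def A_RCOSETS_def' coset_def)

text \<open>Elements of the quotient are thereby identified with functions on flats, where the
  remaining claims are proved.\<close>

lemma coset_eq:
  fixes p p' :: "('e, 'k::field_char_0) mpoly"
  assumes "p \<in> carrier (poly_ring E)" "p' \<in> carrier (poly_ring E)"
  shows "coset p = coset p' \<longleftrightarrow> eta p = eta p'"
proof -
  interpret cring "poly_ring E :: ('e, 'k) mpoly ring" by (rule cring_poly_ring)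
  have "coset p = coset p' \<longleftrightarrow> p - p' \<in> ker"
    using quotient_eq_iff_same_a_r_cos[OF ideal_ker assms] poly_ring_minus[OF assms]
    by (simp add: coset_def)
  moreover have "p - p' \<in> carrier (poly_ring E)"
    using poly_carrier_add[OF assms(1) poly_carrier_uminus[OF assms(2)]] by simp
  ultimately show ?thesis by (simp add: ker_def eta_diff fun_eq_iff)
qed

lemma coset_add: "p \<in> carrier (poly_ring E) \<Longrightarrow> p' \<in> carrier (poly_ring E) \<Longrightarrow>
    coset p \<oplus>\<^bsub>alg\<^esub> coset p' = coset (p + p')"
  using ring_hom_add[OF ring_hom_ring.homh[OF coset_hom], of p p'] by simp

lemma coset_mult: "p \<in> carrier (poly_ring E) \<Longrightarrow> p' \<in> carrier (poly_ring E) \<Longrightarrow>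
    coset p \<otimes>\<^bsub>alg\<^esub> coset p' = coset (p * p')"
  using ring_hom_mult[OF ring_hom_ring.homh[OF coset_hom], of p p'] by simp

lemma coset_one: "\<one>\<^bsub>alg\<^esub> = (coset 1 :: ('e, 'k::field_char_0) mpoly set)"
proof -
  interpret ring_hom_ring "poly_ring E" alg "coset :: ('e, 'k) mpoly \<Rightarrow> _" by (rule coset_hom)
  show ?thesis using hom_one by simp
qed

lemma coset_zero: "\<zero>\<^bsub>alg\<^esub> = (coset 0 :: ('e, 'k::field_char_0) mpoly set)"
proof -
  interpret ring_hom_ring "poly_ring E" alg "coset :: ('e, 'k) mpoly \<Rightarrow> _" by (rule coset_hom)
  show ?thesis using hom_zero by simp
qed

lemma coset_uminus:
  fixes p :: "('e, 'k::field_char_0) mpoly"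
  assumes p: "p \<in> carrier (poly_ring E)" shows "\<ominus>\<^bsub>alg\<^esub> coset p = coset (- p)"
proof -
  interpret A: cring "alg :: ('e, 'k) mpoly set ring" by (rule cring_alg)
  have "coset (- p) \<oplus>\<^bsub>alg\<^esub> coset p = \<zero>\<^bsub>alg\<^esub>"
    using p by (simp add: coset_add poly_carrier_uminus coset_zero)
  then show ?thesis using p by (intro A.minus_equality) (auto simp: carrier_alg poly_carrier_uminus)
qed

lemma coset_pow:
  fixes p :: "('e, 'k::field_char_0) mpoly"
  assumes p: "p \<in> carrier (poly_ring E)" shows "coset p [^]\<^bsub>alg\<^esub> (m::nat) = coset (p ^ m)"
proof -
  interpret A: cring "alg :: ('e, 'k) mpoly set ring" by (rule cring_alg)
  have "p ^ m \<in> carrier (poly_ring E) \<and> coset p [^]\<^bsub>alg\<^esub> m = coset (p ^ m)"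
    by (induction m) (use p in \<open>auto simp: coset_one coset_mult poly_carrier_one poly_carrier_mult mult.commute\<close>)
  then show ?thesis by simp
qed

lemma coset_finsum:
  fixes p :: "'i \<Rightarrow> ('e, 'k::field_char_0) mpoly"
  assumes "finite S" "\<And>d. d \<in> S \<Longrightarrow> p d \<in> carrier (poly_ring E)"
  shows "finsum alg (\<lambda>d. coset (p d)) S = coset (\<Sum>d\<in>S. p d) \<and> (\<Sum>d\<in>S. p d) \<in> carrier (poly_ring E)"
proof -
  interpret A: cring "alg :: ('e, 'k) mpoly set ring" by (rule cring_alg)
  show ?thesis using assms
  proof (induction S)
    case empty
    then show ?case by (simp add: coset_zero poly_carrier_zero)
  next
    case (insert d S)
    then have "finsum alg (\<lambda>d. coset (p d)) (insert d S) = coset (p d) \<oplus>\<^bsub>alg\<^esub> finsum alg (\<lambda>d. coset (p d)) S"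
      by (intro A.finsum_insert) (auto simp: carrier_alg)
    then show ?case using insert by (simp add: coset_add poly_carrier_add)
  qed
qed

text \<open>Under \<open>eta\<close> an ideal becomes a subspace of the functions on the finite set
  L, because constant polynomials act as scalars. Chains of subspaces stabilize, and an ideal is
  recovered from its image since \<open>eta\<close> separates cosets.\<close>

lemma artinian_alg: "artinian_ring (alg :: ('e, 'k::field_char_0) mpoly set ring)"
  unfolding artinian_ring_def
proof (intro conjI allI impI)
  show "cring (alg :: ('e, 'k) mpoly set ring)" by (rule cring_alg)
  fix J :: "nat \<Rightarrow> ('e, 'k) mpoly set set"
  assume J: "\<forall>n. ideal (J n) alg \<and> J (Suc n) \<subseteq> J n"
  define W where "W n = eta ` {p \<in> carrier (poly_ring E). coset p \<in> J n}" for n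
  have sub: "fun_vs.subspace (W n)" for n
  proof -
    interpret I: ideal "J n" alg using J by blast
    show ?thesis
    proof (rule fun_vs.subspaceI)
      have "coset (0 :: ('e, 'k) mpoly) \<in> J n" 
        using additive_subgroup.zero_closed[OF I.additive_subgroup_axioms] by (simp add: coset_zero)
      then have "eta (0 :: ('e, 'k) mpoly) \<in> W n" unfolding W_def using poly_carrier_zero by blast
      then show "0 \<in> W n" by (simp add: eta_zero zero_fun_def)
      fix f g assume "f \<in> W n" "g \<in> W n"
      then obtain p p' :: "('e, 'k) mpoly" where p: "p \<in> carrier (poly_ring E)" "coset p \<in> J n" "f = eta p"
        "p' \<in> carrier (poly_ring E)" "coset p' \<in> J n" "g = eta p'" unfolding W_def by blast
      have "coset (p + p') \<in> J n" 
        using additive_subgroup.a_closed[OF I.additive_subgroup_axioms p(2,5)] p by (simp add: coset_add)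
      then have "eta (p + p') \<in> W n" unfolding W_def using p poly_carrier_add by blast
      then show "f + g \<in> W n" using p by (simp add: eta_add plus_fun_def)
    next
      fix c f assume "f \<in> W n"
      then obtain p :: "('e, 'k) mpoly" where p: "p \<in> carrier (poly_ring E)" "coset p \<in> J n" "f = eta p"
        unfolding W_def by blast
      let ?c = "Poly_Mapping.single 0 c :: ('e, 'k) mpoly"
      have c: "?c \<in> carrier (poly_ring E)" by (simp add: poly_carrier)
      have "coset ?c \<otimes>\<^bsub>alg\<^esub> coset p \<in> J n"
        by (rule I.I_l_closed[OF p(2)]) (use c in \<open>auto simp: carrier_alg\<close>)
      then have "coset (?c * p) \<in> J n" using c p by (simp add: coset_mult)
      then have "eta (?c * p) \<in> W n" unfolding W_def using c p poly_carrier_mult by blast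
      then show "(\<lambda>x. c * f x) \<in> W n" using p by (simp add: eta_const_mult)
    qed
  qed
  have "W n \<subseteq> supported L" for n using eta_supported_L by (auto simp: W_def)
  moreover have "W (Suc n) \<subseteq> W n" for n using J unfolding W_def by blast
  ultimately obtain n where n: "\<forall>m\<ge>n. W m = W n"
    using subspace_chain_stabilizes[OF finite_L, of W] sub by blast
  have dec: "J m \<subseteq> J n" if "n \<le> m" for m by (rule lift_Suc_antimono_le[of J, OF _ that]) (use J in blast)
  have "J m = J n" if m: "m \<ge> n" for m
  proof
    show "J m \<subseteq> J n" using dec m by blast
    show "J n \<subseteq> J m"
    proof
      fix x assume x: "x \<in> J n"
      interpret I: ideal "J n" alg using J by blast
      obtain p where p: "p \<in> carrier (poly_ring E)" "x = coset p" using I.Icarr[OF x]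
        by (auto simp: carrier_alg)
      then have "eta p \<in> W m" using n m x unfolding W_def by blast
      then obtain p' where p': "p' \<in> carrier (poly_ring E)" "coset p' \<in> J m" "eta p' = eta p"
        unfolding W_def by fastforce
      then show "x \<in> J m" using coset_eq[OF p(1) p'(1)] p by simp
    qed
  qed
  then show "\<exists>n. \<forall>m\<ge>n. J m = J n" by blast
qed

section \<open>The grading and the Lefschetz element\<close>

definition comp :: "nat \<Rightarrow> ('e, 'k::field_char_0) mpoly set set" where
  "comp d = coset ` homogeneous_polys E d"

lemma homog_carrier: "p \<in> homogeneous_polys E d \<Longrightarrow> p \<in> carrier (poly_ring E)"
  by (simp add: homog_iff)

lemma level_empty: "d > r P \<Longrightarrow> level d = {}"
  using r_mono[OF _ P_L L_sub] by (fastforce simp: level_def)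

text \<open>At a flat of rank d only the summand of degree d has a nonzero value, so the sum
  determines each summand modulo the kernel.\<close>

lemma comp_inj:
  fixes p p' :: "nat \<Rightarrow> ('e, 'k::field_char_0) mpoly"
  assumes p: "\<And>d. d \<le> D \<Longrightarrow> p d \<in> homogeneous_polys E d" "\<And>d. d \<le> D \<Longrightarrow> p' d \<in> homogeneous_polys E d"
    and eq: "eta (\<Sum>d\<le>D. p d) = eta (\<Sum>d\<le>D. p' d)" and d: "d \<le> D"
  shows "eta (p d) = eta (p' d)"
proof
  have *: "eta (\<Sum>d\<le>D. s d) Z = eta (s d) Z"
    if s: "\<And>d. d \<le> D \<Longrightarrow> s d \<in> homogeneous_polys E d" and Z: "Z \<in> level d"
    for s :: "nat \<Rightarrow> ('e, 'k) mpoly" and Z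
  proof -
    have "eta (\<Sum>d\<le>D. s d) Z = (\<Sum>i\<le>D. if i = d then eta (s i) Z else 0)"
      unfolding eta_sum
    proof (intro sum.cong refl)
      fix i assume i: "i \<in> {..D}"
      have "eta (s i) Z = 0" if "i \<noteq> d"
        using eta_homog[OF s[of i]] i Z that by (auto simp: supported_def level_def)
      then show "eta (s i) Z = (if i = d then eta (s i) Z else 0)" by simp
    qed
    then show ?thesis using d by simp
  qed
  fix Z
  show "eta (p d) Z = eta (p' d) Z"
  proof (cases "Z \<in> level d")
    case True
    then show ?thesis using *[of p Z] *[of p' Z] p eq by simp
  next
    case False
    then show ?thesis using eta_homog[OF p(1)[OF d]] eta_homog[OF p(2)[OF d]] by (simp add: supported_def)
  qed
qed

lemma graded_alg: "graded_artinian_algebra (alg :: ('e, 'k::field_char_0) mpoly set ring) comp (r P)"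
  unfolding graded_artinian_algebra_def
proof (intro conjI allI impI ballI)
  interpret A: cring "alg :: ('e, 'k) mpoly set ring" by (rule cring_alg)
  show "artinian_ring (alg :: ('e, 'k) mpoly set ring)" by (rule artinian_alg)
  show "\<one>\<^bsub>alg\<^esub> \<in> (comp 0 :: ('e, 'k) mpoly set set)" unfolding comp_def coset_one using homog_one by blast
  show "x \<otimes>\<^bsub>alg\<^esub> y \<in> comp (i + j)" if xy: "x \<in> comp i" "y \<in> comp j" for i j and x y :: "('e, 'k) mpoly set"
  proof -
    obtain p p' where p: "p \<in> homogeneous_polys E i" "x = coset p" "p' \<in> homogeneous_polys E j" "y = coset p'"
      using xy unfolding comp_def by blast
    then have "x \<otimes>\<^bsub>alg\<^esub> y = coset (p * p')" by (simp add: coset_mult homog_carrier)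
    then show ?thesis unfolding comp_def using homog_mult[OF p(1,3)] by blast
  qed
  show "additive_subgroup (comp d) (alg :: ('e, 'k) mpoly set ring)" for d
  proof (rule additive_subgroupI, rule group.subgroupI[OF A.a_group])
    show "(comp d :: ('e, 'k) mpoly set set) \<subseteq> carrier (add_monoid alg)"
      by (auto simp: comp_def carrier_alg homog_carrier)
    show "(comp d :: ('e, 'k) mpoly set set) \<noteq> {}" unfolding comp_def using homog_zero by blast
    fix a assume "a \<in> (comp d :: ('e, 'k) mpoly set set)"
    then obtain p where p: "p \<in> homogeneous_polys E d" "a = coset p" unfolding comp_def by blast
    have "inv\<^bsub>add_monoid alg\<^esub> a = coset (- p)"
      using coset_uminus[OF homog_carrier[OF p(1)]] p by (simp add: a_inv_def)
    then show "inv\<^bsub>add_monoid alg\<^esub> a \<in> comp d" unfolding comp_def using homog_uminus[OF p(1)] by blast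
    fix b assume "b \<in> (comp d :: ('e, 'k) mpoly set set)"
    then obtain p' where p': "p' \<in> homogeneous_polys E d" "b = coset p'" unfolding comp_def by blast
    have "a \<otimes>\<^bsub>add_monoid alg\<^esub> b = coset (p + p')" using p p' by (simp add: coset_add homog_carrier)
    then show "a \<otimes>\<^bsub>add_monoid alg\<^esub> b \<in> comp d" unfolding comp_def using homog_add[OF p(1) p'(1)] by blast
  qed
  have compD: "\<exists>p. p \<in> homogeneous_polys E d \<and> x = coset p"
    if "x \<in> comp d" for d and x :: "('e, 'k) mpoly set"
    using that unfolding comp_def by blast
  show "comp d = {\<zero>\<^bsub>alg :: ('e, 'k) mpoly set ring\<^esub>}" if d: "d > r P" for d
  proof -
    have "coset p = coset 0" if "p \<in> homogeneous_polys E d" for p :: "('e, 'k) mpoly"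
    proof -
      have "eta p = eta 0" using eta_homog[OF that] by (auto simp: level_empty[OF d] supported_def eta_zero)
      then show ?thesis using coset_eq[OF homog_carrier[OF that] poly_carrier_zero] by simp
    qed
    then show ?thesis unfolding comp_def coset_zero using homog_zero by blast
  qed
  show "comp (r P) \<noteq> {\<zero>\<^bsub>alg :: ('e, 'k) mpoly set ring\<^esub>}"
  proof -
    have "(delta P :: _ \<Rightarrow> 'k) \<in> supported (level (r P))" using P_L
      by (intro delta_supported) (simp add: level_def)
    then obtain p :: "('e, 'k) mpoly" where p: "p \<in> homogeneous_polys E (r P)" "eta p = delta P"
      using eta_surj by blast
    have "eta p P \<noteq> eta 0 P" using p by (simp add: delta_def eta_zero)
    then have "coset p \<noteq> coset 0" using coset_eq[OF homog_carrier[OF p(1)] poly_carrier_zero] by auto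
    then show ?thesis unfolding comp_def coset_zero using p by blast
  qed
  let ?D = "r P"
  have fs: "finsum alg a {..?D} = coset (\<Sum>d\<le>?D. p d)" and fsc: "(\<Sum>d\<le>?D. p d) \<in> carrier (poly_ring E)"
    if "\<And>d. d \<le> ?D \<Longrightarrow> p d \<in> homogeneous_polys E d \<and> a d = coset (p d)"
    for a and p :: "nat \<Rightarrow> ('e, 'k) mpoly"
  proof -
    have c: "p d \<in> carrier (poly_ring E)" if "d \<in> {..?D}" for d
      using \<open>\<And>d. d \<le> ?D \<Longrightarrow> _\<close>[of d] that homog_carrier by auto
    have "finsum alg a {..?D} = finsum alg (\<lambda>d. coset (p d)) {..?D}"
      by (rule A.finsum_cong') (use that c in \<open>auto simp: carrier_alg\<close>)
    then show "finsum alg a {..?D} = coset (\<Sum>d\<le>?D. p d)" "(\<Sum>d\<le>?D. p d) \<in> carrier (poly_ring E)"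
      using coset_finsum[OF finite_atMost c] by simp_all
  qed
  show "bij_betw (\<lambda>a. finsum alg a {..?D}) (\<Pi>\<^sub>E d\<in>{..?D}. comp d) (carrier (alg :: ('e, 'k) mpoly set ring))"
  proof (rule bij_betwI')
    fix a b :: "nat \<Rightarrow> ('e, 'k) mpoly set"
    assume a: "a \<in> (\<Pi>\<^sub>E d\<in>{..?D}. comp d)" and b: "b \<in> (\<Pi>\<^sub>E d\<in>{..?D}. comp d)"
    have "\<forall>d. \<exists>p. d \<le> ?D \<longrightarrow> p \<in> homogeneous_polys E d \<and> a d = coset p"
      using a compD by (auto simp: PiE_iff)
    then obtain p where p: "\<And>d. d \<le> ?D \<Longrightarrow> p d \<in> homogeneous_polys E d \<and> a d = coset (p d)" by metis
    have "\<forall>d. \<exists>p. d \<le> ?D \<longrightarrow> p \<in> homogeneous_polys E d \<and> b d = coset p"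
      using b compD by (auto simp: PiE_iff)
    then obtain p' where p': "\<And>d. d \<le> ?D \<Longrightarrow> p' d \<in> homogeneous_polys E d \<and> b d = coset (p' d)" by metis
    show "finsum alg a {..?D} = finsum alg b {..?D} \<longleftrightarrow> a = b"
    proof
      assume "finsum alg a {..?D} = finsum alg b {..?D}"
      then have "eta (\<Sum>d\<le>?D. p d) = eta (\<Sum>d\<le>?D. p' d)"
        using fs[OF p] fs[OF p'] coset_eq[OF fsc[OF p] fsc[OF p']] by simp
      then have "eta (p d) = eta (p' d)" if "d \<le> ?D" for d
        using comp_inj[of ?D p p' d] p p' that by blast
      then have "a d = b d" if "d \<in> {..?D}" for d
        using coset_eq[of "p d" "p' d"] p[of d] p'[of d] that homog_carrier by auto
      then show "a = b" using a b by (intro PiE_ext) auto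
    qed simp
    show "finsum alg a {..?D} \<in> carrier alg" using fs[OF p] fsc[OF p] by (simp add: carrier_alg)
  next
    fix x assume "x \<in> carrier (alg :: ('e, 'k) mpoly set ring)"
    then obtain p where p: "p \<in> carrier (poly_ring E)" "x = coset p" by (auto simp: carrier_alg)
    \<comment> \<open>The function \<open>eta p\<close> is cut into its restrictions to the levels,
      and each piece is lifted to a homogeneous polynomial.\<close>
    have "\<exists>s\<in>homogeneous_polys E d. eta s = (\<lambda>Z. if Z \<in> level d then eta p Z else 0)" for d
      by (rule eta_surj) (simp add: supported_def)
    then have "\<forall>d. \<exists>s. s \<in> homogeneous_polys E d \<and> eta s = (\<lambda>Z. if Z \<in> level d then eta p Z else 0)"
      by blast
    then obtain s where s: "\<And>d. s d \<in> homogeneous_polys E d"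
      "\<And>d. eta (s d) = (\<lambda>Z. if Z \<in> level d then eta p Z else 0)" by metis
    let ?a = "restrict (\<lambda>d. coset (s d)) {..?D}"
    have a: "\<And>d. d \<le> ?D \<Longrightarrow> s d \<in> homogeneous_polys E d \<and> ?a d = coset (s d)" using s by simp
    have "eta (\<Sum>d\<le>?D. s d) = eta p"
    proof
      fix Z
      show "eta (\<Sum>d\<le>?D. s d) Z = eta p Z"
      proof (cases "Z \<in> L")
        case True
        have "eta (\<Sum>d\<le>?D. s d) Z = (\<Sum>d\<le>?D. if d = r Z then eta p Z else 0)"
          unfolding eta_sum s(2) using True by (intro sum.cong) (auto simp: level_def)
        then show ?thesis using r_mono[OF True P_L L_sub[OF True]] by simp
      qed (simp add: eta_outside)
    qed
    then have 1: "coset (\<Sum>d\<le>?D. s d) = x" using p coset_eq[OF fsc[OF a] p(1)] by simp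
    have 2: "finsum alg ?a {..?D} = coset (\<Sum>d\<le>?D. s d)" by (rule fs[OF a])
    have "x = finsum alg ?a {..?D}" by (rule sym[OF trans[OF 2 1]])
    moreover have "?a \<in> (\<Pi>\<^sub>E d\<in>{..?D}. comp d)" using s by (auto simp: comp_def)
    ultimately show "\<exists>a\<in>\<Pi>\<^sub>E d\<in>{..?D}. comp d. x = finsum alg a {..?D}" by blast
  qed
qed

theorem slp_alg: "strong_lefschetz_property (alg :: ('e, 'k::field_char_0) mpoly set ring) comp"
proof -
  define s where "s p = (SOME e. e \<in> E0 \<and> \<pi> e = p)" for p
  have s: "s p \<in> E0" "\<pi> (s p) = p" if "p \<in> P" for p
    using someI_ex[of "\<lambda>e. e \<in> E0 \<and> \<pi> e = p"] that label by (auto simp: s_def)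
  \<comment> \<open>With all labelled variables in place of representatives, a point would count
    once for each parallel element and the weights of \<open>raise\<close> would be lost.\<close>
  define l :: "('e, 'k) mpoly" where "l = (\<Sum>p\<in>P. mvar (s p))"
  have "(mvar (s p) :: ('e, 'k) mpoly) \<in> homogeneous_polys E 1" if "p \<in> P" for p
  proof -
    have "s p \<in> E" using s(1)[OF that] E0_sub by blast
    then show ?thesis
      using homog_single[of "Poly_Mapping.single (s p) 1" E "1 :: 'k"] by (simp add: mvar_def)
  qed
  then have l: "l \<in> homogeneous_polys E 1" unfolding l_def by (rule homog_sum)
  have eta_l: "eta (l * p) = raise (eta p)" for p
  proof
    fix G
    have "eta (l * p) G = (\<Sum>x\<in>P. eta (mvar (s x) * p) G)" unfolding l_def sum_distrib_right eta_sum ..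
    also have "\<dots> = (\<Sum>x\<in>P. pmul x (eta p) G)" using s by (intro sum.cong refl) (simp add: eta_var)
    finally show "eta (l * p) G = raise (eta p) G" by (simp add: raise_pmul)
  qed
  have eta_pow: "eta (l ^ m * p) = (raise ^^ m) (eta p)" for m p
    by (induction m) (simp_all add: mult.assoc eta_l)
  have "bij_betw (\<lambda>x. coset l [^]\<^bsub>alg\<^esub> (r P - 2 * i) \<otimes>\<^bsub>alg\<^esub> x) (comp i) (comp (r P - i))"
    if i: "i \<le> r P div 2" for i
  proof -
    let ?m = "r P - 2 * i"
    have i2: "2 * i \<le> r P" "r P - i = ?m + i" using i by linarith+
    have mul: "coset l [^]\<^bsub>alg\<^esub> ?m \<otimes>\<^bsub>alg\<^esub> coset p = coset (l ^ ?m * p)" if "p \<in> homogeneous_polys E i" for p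
      by (simp only: coset_pow[OF homog_carrier[OF l]]
          coset_mult[OF homog_carrier[OF homog_pow[OF l]] homog_carrier[OF that]])
    have lp: "l ^ ?m * p \<in> homogeneous_polys E (r P - i)" if "p \<in> homogeneous_polys E i" for p
      unfolding i2(2) by (rule homog_mult[OF homog_pow[OF l] that])
    show ?thesis
    proof (rule bij_betwI')
      fix x y :: "('e, 'k) mpoly set" assume "x \<in> comp i" "y \<in> comp i"
      then obtain p p'
        where p: "p \<in> homogeneous_polys E i" "x = coset p" "p' \<in> homogeneous_polys E i" "y = coset p'"
        unfolding comp_def by blast
      show "coset l [^]\<^bsub>alg\<^esub> ?m \<otimes>\<^bsub>alg\<^esub> x = coset l [^]\<^bsub>alg\<^esub> ?m \<otimes>\<^bsub>alg\<^esub> y \<longleftrightarrow> x = y"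
      proof
        assume "coset l [^]\<^bsub>alg\<^esub> ?m \<otimes>\<^bsub>alg\<^esub> x = coset l [^]\<^bsub>alg\<^esub> ?m \<otimes>\<^bsub>alg\<^esub> y"
        then have "eta (l ^ ?m * p) = eta (l ^ ?m * p')"
          using mul p coset_eq[OF homog_carrier[OF lp[OF p(1)]] homog_carrier[OF lp[OF p(3)]]] by simp
        then have "eta (l ^ ?m * (p - p')) = (\<lambda>_. 0)" by (simp add: right_diff_distrib eta_diff)
        then have z: "(raise ^^ ?m) (eta (p - p')) = (\<lambda>_. 0)" unfolding eta_pow .
        have "p - p' \<in> homogeneous_polys E i" using homog_add[OF p(1) homog_uminus[OF p(3)]] by simp
        then have "eta (p - p') \<in> supported (level i)" by (rule eta_homog)
        then have "eta (p - p') = (\<lambda>_. 0)" using raise_inj[OF _ _ z, of i] i2 by (simp add: supported_def)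
        then have "eta p = eta p'" by (simp add: eta_diff fun_eq_iff)
        then show "x = y" using coset_eq[OF homog_carrier[OF p(1)] homog_carrier[OF p(3)]] p by simp
      qed simp
      show "coset l [^]\<^bsub>alg\<^esub> ?m \<otimes>\<^bsub>alg\<^esub> x \<in> comp (r P - i)"
        unfolding comp_def p(2) mul[OF p(1)] using lp[OF p(1)] by blast
    next
      fix y :: "('e, 'k) mpoly set" assume "y \<in> comp (r P - i)"
      then obtain p' where p': "p' \<in> homogeneous_polys E (r P - i)" "y = coset p'" unfolding comp_def by blast
      obtain g where g: "g \<in> supported (level i)" "(raise ^^ ?m) g = eta p'"
        using raise_pow_surj[OF i2(1) eta_homog[OF p'(1)]] .
      obtain p where p: "p \<in> homogeneous_polys E i" "eta p = g" using eta_surj[OF g(1)] by blast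
      have "eta (l ^ ?m * p) = eta p'" unfolding eta_pow using p g by simp
      then have "y = coset l [^]\<^bsub>alg\<^esub> ?m \<otimes>\<^bsub>alg\<^esub> coset p"
        using mul[OF p(1)] coset_eq[OF homog_carrier[OF lp[OF p(1)]] homog_carrier[OF p'(1)]] p' by simp
      then show "\<exists>x\<in>comp i. y = coset l [^]\<^bsub>alg\<^esub> ?m \<otimes>\<^bsub>alg\<^esub> x" unfolding comp_def using p by blast
    qed
  qed
  moreover have "coset l \<in> comp 1" unfolding comp_def using l by blast
  ultimately show ?thesis unfolding strong_lefschetz_property_def using graded_alg by blast
qed

end

section \<open>The basis polynomial\<close>

definition ind :: "'e set \<Rightarrow> ('e \<Rightarrow>\<^sub>0 nat)" where
  "ind B = (\<Sum>b\<in>B. Poly_Mapping.single b 1)"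

lemma lookup_ind: "finite B \<Longrightarrow> Poly_Mapping.lookup (ind B) e = (if e \<in> B then 1 else 0)"
  by (simp add: ind_def lookup_sum lookup_single when_def)

lemma keys_ind: "finite B \<Longrightarrow> Poly_Mapping.keys (ind B) = B"
  by (auto simp: in_keys_iff lookup_ind split: if_splits)

lemma prod_mvar: "finite B \<Longrightarrow> (\<Prod>b\<in>B. mvar b) = Poly_Mapping.single (ind B) (1 :: 'k::comm_ring_1)"
  by (induction B rule: finite_induct) (simp_all add: ind_def mvar_def mult_single)

context modular_matroid
begin

sublocale lab: labelled_geometry "atoms Lf" "At ` carrier Lf" flat_rank E nonloops point
  by unfold_locales (use finite_ground point_image in \<open>auto simp: nonloops_def\<close>)

text \<open>The support is handled by \<open>bases_geom\<close>; that all exponents are 1 follows on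
  the geometric side from \<open>indep_squarefree\<close>.\<close>

lemma ind_keys_iff:
  "Poly_Mapping.keys m \<in> bases F \<and> ind (Poly_Mapping.keys m) = m \<longleftrightarrow>
    lab.indep m \<and> mdeg m = flat_rank (atoms Lf)"
proof
  assume a: "Poly_Mapping.keys m \<in> bases F \<and> ind (Poly_Mapping.keys m) = m"
  have "Poly_Mapping.lookup m e = 1" if "e \<in> Poly_Mapping.keys m" for e
    using a lookup_ind[of "Poly_Mapping.keys m" e] that by simp
  then have "mdeg m = card (Poly_Mapping.keys m)" by simp
  then show "lab.indep m \<and> mdeg m = flat_rank (atoms Lf)"
    using a bases_geom[of "Poly_Mapping.keys m"] by (simp add: lab.indep_def lab.flat_def)
next
  assume a: "lab.indep m \<and> mdeg m = flat_rank (atoms Lf)"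
  have one: "Poly_Mapping.lookup m e = 1" if "e \<in> Poly_Mapping.keys m" for e
    using lab.indep_squarefree[of m e] a that by (simp add: in_keys_iff)
  then have "mdeg m = card (Poly_Mapping.keys m)" by simp
  then have "Poly_Mapping.keys m \<in> bases F"
    using a bases_geom[of "Poly_Mapping.keys m"] by (simp add: lab.indep_def lab.flat_def)
  moreover have "ind (Poly_Mapping.keys m) = m"
    using one by (intro poly_mapping_eqI) (simp add: lookup_ind in_keys_iff)
  ultimately show "Poly_Mapping.keys m \<in> bases F \<and> ind (Poly_Mapping.keys m) = m" by simp
qed

lemma lookup_basis_polynomial:
  "Poly_Mapping.lookup (basis_polynomial F :: ('e, 'k::comm_ring_1) mpoly) m =
    (if lab.indep m \<and> mdeg m = flat_rank (atoms Lf) then 1 else 0)"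
proof -
  have finB: "finite B" if "B \<in> bases F" for B using that indep_finite by (simp add: bases_def)
  have finite_bases: "finite (bases F)"
    by (rule finite_subset[of _ "Pow E"]) (use indep_subset_ground finite_ground in \<open>auto simp: bases_def\<close>)
  \<comment> \<open>The monomial of a basis determines the basis as its support, so at most the term
    with B equal to the support of m contributes.\<close>
  have "Poly_Mapping.lookup (basis_polynomial F :: ('e, 'k) mpoly) m =
      (\<Sum>B\<in>bases F. if B = Poly_Mapping.keys m then (if ind B = m then 1 else 0) else 0)"
    unfolding basis_polynomial_def lookup_sum
  proof (rule sum.cong[OF HOL.refl])
    fix B assume "B \<in> bases F"
    then have B: "finite B" using finB by blast
    show "Poly_Mapping.lookup (\<Prod>b\<in>B. mvar b :: ('e, 'k) mpoly) m =
        (if B = Poly_Mapping.keys m then (if ind B = m then 1 else 0) else 0)"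
      unfolding prod_mvar[OF B] using keys_ind[OF B] by (auto simp: lookup_single when_def)
  qed
  also have "\<dots> = (if Poly_Mapping.keys m \<in> bases F \<and> ind (Poly_Mapping.keys m) = m then 1 else 0)"
    using finite_bases by simp
  finally show ?thesis unfolding ind_keys_iff .
qed

lemma annihilator_ker: "annihilator E (basis_polynomial F :: ('e, 'k::field_char_0) mpoly) = lab.ker"
  unfolding annihilator_def lab.ker_def
  using lab.diff_action_zero_iff[OF lookup_basis_polynomial] by blast

theorem slp: "strong_lefschetz_property
    (matroid_algebra E F :: ('e, 'k::field_char_0) mpoly set ring) (matroid_algebra_component E F)"
proof -
  have "matroid_algebra E F = (lab.alg :: ('e, 'k) mpoly set ring)"
    by (simp add: matroid_algebra_def lab.alg_def annihilator_ker)
  moreover have "matroid_algebra_component E F = (lab.comp :: nat \<Rightarrow> ('e, 'k) mpoly set set)"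
    by (rule ext) (simp add: matroid_algebra_component_def lab.comp_def lab.coset_def[abs_def] annihilator_ker)
  moreover have "strong_lefschetz_property (lab.alg :: ('e, 'k) mpoly set ring) lab.comp"
    by (rule lab.slp_alg)
  ultimately show ?thesis by simp
qed

end

theorem corollary5p8:
  shows "(\<forall>(E :: 'e set) F. matroid E F \<longrightarrow>
            modular_geometric_lattice (lattice_of_flats E F) (matroid_rank F) \<longrightarrow>
            strong_lefschetz_property
              (matroid_algebra E F :: ('e, 'k::field_char_0) mpoly set ring)
              (matroid_algebra_component E F))
       \<and> (\<forall>(L :: 'a gorder) r. modular_geometric_lattice L r \<longrightarrow> sperner_property L r)"
proof (intro conjI allI impI)
  fix E :: "'e set" and F
  assume "matroid E F" "modular_geometric_lattice (lattice_of_flats E F) (matroid_rank F)"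
  then interpret modular_matroid E F by (simp add: modular_matroid_def modular_geometric_def)
  show "strong_lefschetz_property (matroid_algebra E F :: ('e, 'k) mpoly set ring)
      (matroid_algebra_component E F)" by (rule slp)
next
  fix L :: "'a gorder" and r
  assume "modular_geometric_lattice L r"
  then interpret modular_geometric L r by unfold_locales
  show "sperner_property L r" by (rule sperner)
qed

end
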